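(* Let $X$ be a spectrally negative Lévy process (non-monotone paths) with Laplace exponent $\varphi$, whose Lévy measure $\Pi$ has a density with respect to Lebesgue measure, and suppose that $X$ drifts to $\infty$. Let $D=\int_0^\infty 1(X(t)<0)\,dt$ denote the total duration for $X$ to stay below $0$. Then for $x>0$, $\beta>0$, $$E_x e^{-\beta D}=\varphi'(0+)\,\Phi(\beta)\,e^{\Phi(\beta)x}\int_x^\infty e^{-\Phi(\beta)y}W(y)\,dy .$$ In particular, $$E_0 e^{-\beta D}=\varphi'(0+)\,\frac{\Phi(\beta)}{\beta}.$$
   Context: $X=\{X(t),t\ge 0\}$ is a real-valued spectrally negative Lévy process (càdlàg paths, no positive jumps, stationary independent increments) on a filtered probability space satisfying the usual conditions; the case of monotone paths is excluded. $P_x$ is the law of $X$ with $X(0)=x$, and $E_x$ the corresponding expectation. The Laplace exponent $\varphi$ is defined by $E_0 e^{\alpha X(t)}=e^{t\varphi(\alpha)}$, $\alpha\ge 0$, with $$\varphi(\alpha)=\mu\alpha+\tfrac12\sigma^2\alpha^2+\int_{-\infty}^0\big(e^{\alpha x}-1-\alpha x 1_{(x>-1)}\big)\Pi(dx),$$ where $\mu\in\mathbb{R}$, $\sigma\ge 0$ and the Lévy measure $\Pi$ on $(-\infty,0)$ satisfies $\int_{-\infty}^0(x^2\wedge 1)\Pi(dx)<\infty$. Standing assumption: $\Pi$ has a density with respect to Lebesgue measure. For $q\ge 0$, $\Phi(q)=\sup\{\alpha\ge 0:\varphi(\alpha)=q\}$. The scale function $W:(-\infty,\infty)\to[0,\infty)$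 is the unique function that is identically zero for $x<0$, continuous on $(0,\infty)$, and has Laplace transform $\int_0^\infty e^{-\alpha x}W(x)dx=\frac{1}{\varphi(\alpha)}$ for $\alpha>\Phi(0)$. *)

theory Defs
  imports "HOL-Probability.Probability"
begin

definition cadlag :: "(real \<Rightarrow> real) \<Rightarrow> bool" where
  "cadlag f \<longleftrightarrow>
     (\<forall>t\<ge>0. continuous (at_right t) f) \<and> (\<forall>t>0. \<exists>l. (f \<longlongrightarrow> l) (at_left t))"

definition no_positive_jumps :: "(real \<Rightarrow> real) \<Rightarrow> bool" where
  "no_positive_jumps f \<longleftrightarrow> (\<forall>t>0. f t - Lim (at_left t) f \<le> 0)"

text \<open>Time is \<open>[0, \<infinity>)\<close>, represented inside the type \<^typ>\<open>real\<close>. The values of \<open>F\<close> and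
  \<open>X\<close> at negative times play no role: a filtration indexed by \<open>[0, \<infinity>)\<close> extends to all of
  \<^typ>\<open>real\<close> by \<open>F t = F 0\<close> for \<open>t < 0\<close>.\<close>

locale filtered_prob_space_usual = prob_space M + complete_measure M + filtration "space M" F
  for M :: "'a measure" and F :: "real \<Rightarrow> 'a measure" +
  assumes filtration_subalgebra: "\<And>t. t \<ge> 0 \<Longrightarrow> subalgebra M (F t)"
    and filtration_complete: "null_sets M \<subseteq> sets (F 0)"
    and filtration_right_continuous: "\<And>s. s \<ge> 0 \<Longrightarrow> sets (F s) = (\<Inter>t\<in>{s<..}. sets (F t))"

text \<open>The measure \<open>M\<close> is the law \<open>P\<^sub>0\<close>, under which \<open>X\<close> starts at \<open>0\<close>.\<close>

locale levy_process = filtered_prob_space_usual M F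
  for M :: "'a measure" and F :: "real \<Rightarrow> 'a measure" and X :: "real \<Rightarrow> 'a \<Rightarrow> real" +
  assumes adapted: "\<And>t. t \<ge> 0 \<Longrightarrow> X t \<in> borel_measurable (F t)"
    and starts_at_zero: "AE \<omega> in M. X 0 \<omega> = 0"
    and cadlag_paths: "AE \<omega> in M. cadlag (\<lambda>t. X t \<omega>)"
    and independent_increments: "\<And>s t. 0 \<le> s \<Longrightarrow> s \<le> t \<Longrightarrow>
      indep_set (sets (F s)) (sets (vimage_algebra (space M) (\<lambda>\<omega>. X t \<omega> - X s \<omega>) borel))"
    and stationary_increments: "\<And>s t. 0 \<le> s \<Longrightarrow> s \<le> t \<Longrightarrow>
      distr M borel (\<lambda>\<omega>. X t \<omega> - X s \<omega>) = distr M borel (\<lambda>\<omega>. X (t - s) \<omega> - X 0 \<omega>)"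

locale spectrally_negative_levy_process = levy_process M F X
  for M :: "'a measure" and F :: "real \<Rightarrow> 'a measure" and X :: "real \<Rightarrow> 'a \<Rightarrow> real" +
  assumes no_positive_jumps_paths: "AE \<omega> in M. no_positive_jumps (\<lambda>t. X t \<omega>)"
    and not_monotone_paths:
      "\<not> (AE \<omega> in M. mono_on {0..} (\<lambda>t. X t \<omega>) \<or> antimono_on {0..} (\<lambda>t. X t \<omega>))"

definition negative_levy_measure :: "real measure \<Rightarrow> bool" where
  "negative_levy_measure \<nu> \<longleftrightarrow>
     sets \<nu> = sets borel \<and> emeasure \<nu> {0..} = 0 \<and> (\<integral>\<^sup>+x. ennreal (min (x\<^sup>2) 1) \<partial>\<nu>) < \<infinity>"

definition has_lebesgue_density :: "real measure \<Rightarrow> bool" where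
  "has_lebesgue_density \<nu> \<longleftrightarrow> (\<exists>f \<in> borel_measurable borel. \<nu> = density lborel f)"

definition laplace_exponent :: "real \<Rightarrow> real \<Rightarrow> real measure \<Rightarrow> real \<Rightarrow> real" where
  "laplace_exponent \<mu> \<sigma> \<nu> \<alpha> = \<mu> * \<alpha> + \<sigma>\<^sup>2 * \<alpha>\<^sup>2 / 2 +
     (LINT x:{..<0}|\<nu>. exp (\<alpha> * x) - 1 - \<alpha> * x * indicator {-1<..} x)"

text \<open>By the Levy-Khintchine formula every spectrally negative Levy process has a triplet in this
  sense, and it is unique.\<close>

definition has_levy_triplet ::
    "'a measure \<Rightarrow> (real \<Rightarrow> 'a \<Rightarrow> real) \<Rightarrow> real \<Rightarrow> real \<Rightarrow> real measure \<Rightarrow> bool" where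
  "has_levy_triplet M X \<mu> \<sigma> \<nu> \<longleftrightarrow>
     \<sigma> \<ge> 0 \<and> negative_levy_measure \<nu> \<and>
     (\<forall>t\<ge>0. \<forall>\<alpha>\<ge>0. integrable M (\<lambda>\<omega>. exp (\<alpha> * X t \<omega>)) \<and>
        (\<integral>\<omega>. exp (\<alpha> * X t \<omega>) \<partial>M) = exp (t * laplace_exponent \<mu> \<sigma> \<nu> \<alpha>))"

definition right_inverse_exponent :: "(real \<Rightarrow> real) \<Rightarrow> real \<Rightarrow> real" where
  "right_inverse_exponent \<phi> q = Sup {\<alpha>. \<alpha> \<ge> 0 \<and> \<phi> \<alpha> = q}"

text \<open>These conditions determine \<open>W\<close> on \<open>\<real> - {0}\<close>; they leave \<open>W 0\<close> free.\<close>

definition is_scale_function :: "(real \<Rightarrow> real) \<Rightarrow> (real \<Rightarrow> real) \<Rightarrow> bool" where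
  "is_scale_function \<phi> W \<longleftrightarrow>
     (\<forall>x. W x \<ge> 0) \<and> (\<forall>x<0. W x = 0) \<and> continuous_on {0<..} W \<and>
     (\<forall>\<alpha>>right_inverse_exponent \<phi> 0.
        set_integrable lborel {0..} (\<lambda>x. exp (- \<alpha> * x) * W x) \<and>
        (LBINT x:{0..}. exp (- \<alpha> * x) * W x) = 1 / \<phi> \<alpha>)"

definition drifts_to_infinity :: "'a measure \<Rightarrow> (real \<Rightarrow> 'a \<Rightarrow> real) \<Rightarrow> bool" where
  "drifts_to_infinity M X \<longleftrightarrow> (AE \<omega> in M. filterlim (\<lambda>t. X t \<omega>) at_top at_top)"

text \<open>\<open>derivative_at_0_plus \<phi>\<close> is \<open>\<phi>'(0+)\<close>, the limit of \<open>\<phi>'(\<alpha>)\<close> as \<open>\<alpha>\<close> decreases to \<open>0\<close>.\<close>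

definition derivative_at_0_plus :: "(real \<Rightarrow> real) \<Rightarrow> real" where
  "derivative_at_0_plus \<phi> = Lim (at_right 0) (deriv \<phi>)"

text \<open>The law \<open>P\<^sub>x\<close> is that of \<open>x + X\<close> under \<open>M\<close>; \<open>path_expectation M X x G\<close> is \<open>E\<^sub>x\<close> of the
  functional \<open>G\<close> of the path.\<close>

definition path_expectation ::
    "'a measure \<Rightarrow> (real \<Rightarrow> 'a \<Rightarrow> real) \<Rightarrow> real \<Rightarrow> ((real \<Rightarrow> real) \<Rightarrow> real) \<Rightarrow> real" where
  "path_expectation M X x G = (\<integral>\<omega>. G (\<lambda>t. x + X t \<omega>) \<partial>M)"

definition time_below_zero :: "(real \<Rightarrow> real) \<Rightarrow> ennreal" where
  "time_below_zero f = (\<integral>\<^sup>+t\<in>{0..}. indicator {..<0} (f t) \<partial>lborel)"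

text \<open>With the convention \<open>exp (- \<infinity>) = 0\<close>.\<close>

definition exp_neg :: "real \<Rightarrow> ennreal \<Rightarrow> real" where
  "exp_neg \<beta> d = (if d = \<infinity> then 0 else exp (- \<beta> * enn2real d))"

end

theory Submission
  imports Defs "HOL-Complex_Analysis.Cauchy_Integral_Formula"
begin

text \<open>Let \<open>D\<close> be the time spent below \<open>0\<close> and \<open>f x = E\<^sub>x (exp (- \<beta> * D))\<close>. For \<open>x < 0\<close> the process creeps
  continuously upwards over every level, so the strong Markov property at first passage times makes
  \<open>f\<close> multiplicative there: \<open>f x = f 0 * exp (\<theta> * x)\<close> for some \<open>\<theta> > 0\<close>. The Markov property at a fixed
  time gives Kac's equation \<open>E (f (x + X\<^sub>t)) = f x + \<beta> * (\<integral>s=0..t. E (f (x + X\<^sub>s); x + X\<^sub>s < 0))\<close>.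
  Its bilateral Laplace transform at \<open>l\<close>, which converges for \<open>0 < l < \<theta>\<close>, reads
  \<open>\<phi> l * (P l + f 0 / (\<theta> - l)) = \<beta> * f 0 / (\<theta> - l)\<close> with \<open>P l = (\<integral>x=0..\<infinity>. exp (- l * x) * f x)\<close>. Since \<open>P\<close> has
  no pole at \<open>\<theta>\<close>, \<open>\<phi> \<theta> = \<beta>\<close>, that is \<open>\<theta> = \<Phi> \<beta>\<close>; since \<open>f\<close> tends to \<open>1\<close>, \<open>l * P l\<close> tends to \<open>1\<close> as \<open>l\<close>
  decreases to \<open>0\<close>, which gives \<open>f 0 = \<phi>'(0+) * \<theta> / \<beta>\<close>. The right-hand side of the first formula has the
  same Laplace transform on \<open>(0, \<theta>)\<close>, and both sides are right-continuous.\<close>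

section \<open>Uniqueness of Laplace transforms\<close>

text \<open>The rate \<theta> is not known in advance: multiplicativity yields some exponential
  rate, and the pole alone identifies it, so no exponential martingale or optional stopping enters.
  The transform equation is confined to \<open>(0, \<theta>)\<close> because from \<theta> on the
  contribution of the negative half-line diverges; hence uniqueness has to start from a short
  interval, by power series continuation followed by Weierstrass approximation. The time below zero
  is not a function of finitely many values of the path, and the indicator of the negative half-line
  is discontinuous. The Markov property is therefore proved for products over grid times and carried
  to \<open>exp (- \<beta> * below p)\<close> by two limits: Riemann sums first, then continuous
  ramps below the indicator. At first passage, grid times approach the passage time from the right,
  so right-continuity of the paths and of \<open>f\<close> is what the strong Markov property rests
  on. Almost sure properties of the paths are made sure by changing the process on a null
  set.\<close>

lemma powser_coeffs_zero:
  fixes a :: "nat \<Rightarrow> real"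
  assumes r: "r > 0" and z: "\<And>x. \<bar>x\<bar> < r \<Longrightarrow> (\<lambda>n. a n * x ^ n) sums 0"
  shows "a n = 0"
proof (cases "n = 0")
  case True
  then show ?thesis using z[of 0] r by (simp add: powser_sums_zero_iff)
next
  case False
  show ?thesis
  proof (rule ccontr)
    assume "a n \<noteq> 0"
    \<comment> \<open>Zeros of a non-trivial power series are isolated; for the zero function the
      promised punctured disc contains \<open>s\<close> itself. A positive index is required here,
      hence the separate case \<open>n = 0\<close>.\<close>
    with powser_0_nonzero[of r 0 a "\<lambda>_. 0" n] r z False
    obtain s where s: "0 < s" "\<And>z::real. z \<in> cball 0 s - {0} \<Longrightarrow> (0::real) \<noteq> 0" by auto
    from s(2)[of s] s(1) show False by auto
  qed
qed

text \<open>One term of the exponential series at \<open>d * x\<close>. A power of \<open>x\<close>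
  thus costs a factor \<open>exp (d * x)\<close>, which a Laplace integrand affords by lowering
  \<open>l\<close> to \<open>l - d\<close>.\<close>

lemma power_le_exp:
  fixes d x :: real
  assumes "d > 0" "x \<ge> 0"
  shows "x ^ n / fact n \<le> exp (d * x) / d ^ n"
proof -
  have "(\<Sum>i\<in>{n}. (d * x) ^ i /\<^sub>R fact i) \<le> (\<Sum>i. (d * x) ^ i /\<^sub>R fact i)"
    using assms exp_converges[of "d * x"] by (intro sum_le_suminf) (auto simp: sums_iff)
  also have "\<dots> = exp (d * x)" by (simp add: exp_def)
  finally have "(\<Sum>i\<in>{n}. (d * x) ^ i /\<^sub>R fact i) \<le> exp (d * x)" .
  then show ?thesis using assms by (simp add: field_simps)
qed

abbreviation laplace :: "(real \<Rightarrow> real) \<Rightarrow> real \<Rightarrow> real" where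
  "laplace k l \<equiv> \<integral>x. exp (- l * x) * k x \<partial>lborel"

text \<open>Expanding \<open>exp (- s * x)\<close> under the integral is legitimate because the
  absolute values of the terms add up to the absolute integrand at \<open>l - \<bar>s\<bar>\<close>,
  still a point of the domain. So the radius of convergence at \<open>l\<close> is at least
  \<open>l\<close>.\<close>

lemma laplace_power_series:
  fixes k :: "real \<Rightarrow> real"
  assumes int: "\<And>l. l > 0 \<Longrightarrow> integrable lborel (\<lambda>x. exp (- l * x) * k x)"
    and supp: "\<And>x. x < 0 \<Longrightarrow> k x = 0" and s: "\<bar>s\<bar> < l"
  shows "(\<lambda>n. (\<integral>x. (- x) ^ n / fact n * (exp (- l * x) * k x) \<partial>lborel) * s ^ n) sums
           laplace k (l + s)"
proof -
  \<comment> \<open>A margin strictly inside \<open>(0, l)\<close>: \<open>exp (d * x)\<close>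
    absorbs the powers of \<open>x\<close>, and \<open>l - d\<close> stays in the domain of the
    transform.\<close>
  define d where "d = (\<bar>s\<bar> + l) / 2"
  have l: "l > 0" and d: "0 < d" "d < l" "\<bar>s\<bar> < d" using s by (auto simp: d_def)
  have [measurable]: "(\<lambda>x. exp (- l * x) * k x) \<in> borel_measurable borel"
    using int[OF l] by simp
  have intd: "integrable lborel (\<lambda>x. exp (- (l - d) * x) * k x)" using d by (intro int) auto
  have split: "exp (- (l - d) * x) * k x = exp (d * x) * (exp (- l * x) * k x)" for x d
    by (simp add: algebra_simps flip: exp_add)
  have term_int: "integrable lborel (\<lambda>x. (- x) ^ n / fact n * (exp (- l * x) * k x))" for n
  proof (rule Bochner_Integration.integrable_bound)
    show "integrable lborel (\<lambda>x. (exp (- (l - d) * x) * k x) / d ^ n)" using intd by simp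
    have "norm ((- x) ^ n / fact n * (exp (- l * x) * k x)) \<le> norm (exp (- (l - d) * x) * k x / d ^ n)" for x
    proof (cases "x < 0")
      case False
      then have "norm ((- x) ^ n / fact n * (exp (- l * x) * k x)) = (x ^ n / fact n) * \<bar>exp (- l * x) * k x\<bar>"
        by (simp add: abs_mult power_abs)
      also have "\<dots> \<le> (exp (d * x) / d ^ n) * \<bar>exp (- l * x) * k x\<bar>"
        using False d by (intro mult_right_mono power_le_exp) auto
      also have "\<dots> = norm (exp (- (l - d) * x) * k x / d ^ n)" unfolding split
        using d by (simp add: abs_mult)
      finally show ?thesis .
    qed (simp add: supp)
    then show "AE x in lborel. norm ((- x) ^ n / fact n * (exp (- l * x) * k x)) \<le> norm (exp (- (l - d) * x) * k x / d ^ n)"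
      by simp
    show "(\<lambda>x. (- x) ^ n / fact n * (exp (- l * x) * k x)) \<in> borel_measurable lborel"
      by measurable
  qed
  define g where "g n x = (- x) ^ n / fact n * (exp (- l * x) * k x) * s ^ n" for n x
  have g_eq: "g n x = (- s * x) ^ n /\<^sub>R fact n * (exp (- l * x) * k x)" for n x
    by (simp add: g_def power_mult_distrib[symmetric] field_simps)
  have gs: "(\<lambda>n. g n x) sums (exp (- (l + s) * x) * k x)" for x
    using sums_mult2[OF exp_converges[of "- s * x"], of "exp (- l * x) * k x"] split[of "-s" x]
    unfolding g_eq by (simp only: diff_minus_eq_add)
  have gn: "(\<lambda>n. norm (g n x)) sums (exp (- (l - \<bar>s\<bar>) * x) * \<bar>k x\<bar>)" for x
  proof (cases "x < 0")
    case False
    have "norm (g n x) = (\<bar>s\<bar> * x) ^ n /\<^sub>R fact n * \<bar>exp (- l * x) * k x\<bar>" for n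
      using False by (simp add: g_eq abs_mult power_abs)
    moreover have "exp (\<bar>s\<bar> * x) * \<bar>exp (- l * x) * k x\<bar> = exp (- (l - \<bar>s\<bar>) * x) * \<bar>k x\<bar>"
      by (simp add: abs_mult algebra_simps flip: exp_add)
    ultimately show ?thesis
      using sums_mult2[OF exp_converges[of "\<bar>s\<bar> * x"], of "\<bar>exp (- l * x) * k x\<bar>"] by simp
  qed (simp add: supp g_def)
  have gi: "integrable lborel (g n)" for n unfolding g_def by (rule integrable_mult_left[OF term_int])
  have bound_int: "integrable lborel (\<lambda>x. exp (- (l - \<bar>s\<bar>) * x) * \<bar>k x\<bar>)"
    using integrable_abs[OF int[of "l - \<bar>s\<bar>"]] s by (simp add: abs_mult)
  have "summable (\<lambda>n. \<integral>x. norm (g n x) \<partial>lborel)"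
  proof (rule bounded_imp_summable[of _ "\<integral>x. exp (- (l - \<bar>s\<bar>) * x) * \<bar>k x\<bar> \<partial>lborel"])
    fix n
    have "(\<Sum>i\<le>n. \<integral>x. norm (g i x) \<partial>lborel) = (\<integral>x. (\<Sum>i\<le>n. norm (g i x)) \<partial>lborel)"
      using gi by simp
    also have "\<dots> \<le> (\<integral>x. exp (- (l - \<bar>s\<bar>) * x) * \<bar>k x\<bar> \<partial>lborel)"
    proof (rule integral_mono)
      fix x show "(\<Sum>i\<le>n. norm (g i x)) \<le> exp (- (l - \<bar>s\<bar>) * x) * \<bar>k x\<bar>"
        using sum_le_suminf[of "\<lambda>i. norm (g i x)" "{..n}"] gn[of x] by (auto simp: sums_iff)
    qed (use gi bound_int in auto)
    finally show "(\<Sum>i\<le>n. \<integral>x. norm (g i x) \<partial>lborel) \<le> \<dots>" .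
  qed simp
  then have "(\<lambda>n. integral\<^sup>L lborel (g n)) sums (\<integral>x. (\<Sum>n. g n x) \<partial>lborel)"
    using gi gn by (intro sums_integral) (auto simp: sums_iff)
  moreover have "integral\<^sup>L lborel (g n) =
      (\<integral>x. (- x) ^ n / fact n * (exp (- l * x) * k x) \<partial>lborel) * s ^ n" for n
    unfolding g_def by (rule integral_mult_left_zero)
  moreover have "(\<Sum>n. g n x) = exp (- (l + s) * x) * k x" for x
    using gs by (rule sums_unique[symmetric])
  ultimately show ?thesis by simp
qed

text \<open>Analytic continuation along the half-line: discs of convergence are chained, each step
  enlarging the interval of zeros by the factor \<open>3/2\<close>.\<close>

lemma laplace_zero_extend:
  fixes k :: "real \<Rightarrow> real"
  assumes int: "\<And>l. l > 0 \<Longrightarrow> integrable lborel (\<lambda>x. exp (- l * x) * k x)"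
    and supp: "\<And>x. x < 0 \<Longrightarrow> k x = 0" and c: "c > 0"
    and zero: "\<And>l. 0 < l \<Longrightarrow> l < c \<Longrightarrow> laplace k l = 0"
    and l: "l > 0"
  shows "laplace k l = 0"
proof -
  have step: "laplace k l = 0"
    if b: "b > 0" "\<And>l. 0 < l \<Longrightarrow> l < b \<Longrightarrow> laplace k l = 0"
      and l: "0 < l" "l < 3/2 * b" for b l
  proof -
    \<comment> \<open>For \<open>\<bar>s\<bar> < b / 5\<close> the point \<open>m + s\<close> lies
      in \<open>(0, b)\<close>, where the transform vanishes; the radius \<open>m\<close> then
      reaches \<open>8/5 * b\<close>, beyond the required \<open>3/2 * b\<close>.\<close>
    define m where "m = 4/5 * b"
    define a where "a n = (\<integral>x. (- x) ^ n / fact n * (exp (- m * x) * k x) \<partial>lborel)" for n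
    have ser: "(\<lambda>n. a n * s ^ n) sums laplace k (m + s)" if "\<bar>s\<bar> < m" for s
      unfolding a_def by (rule laplace_power_series[OF int supp that])
    have "a n = 0" for n
    proof (rule powser_coeffs_zero[of "b / 5"])
      fix s :: real assume "\<bar>s\<bar> < b / 5"
      then show "(\<lambda>n. a n * s ^ n) sums 0"
        using ser[of s] b(1) b(2)[of "m + s"] by (auto simp: m_def abs_if split: if_splits)
    qed (use b in simp)
    moreover have "\<bar>l - m\<bar> < m" using l b(1) by (simp add: m_def abs_if)
    ultimately show ?thesis using ser[of "l - m"] by (simp add: sums_iff)
  qed
  have "\<forall>l. 0 < l \<and> l < (3/2) ^ n * c \<longrightarrow> laplace k l = 0" for n
  proof (induction n)
    case 0 then show ?case using zero by auto
  next
    case (Suc n)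
    then show ?case using step[of "(3/2) ^ n * c"] c by auto
  qed
  moreover obtain n where n: "l / c < (3/2) ^ n" using real_arch_pow[of "3/2" "l / c"] by auto
  moreover from n have "l < (3/2) ^ n * c" using c by (simp only: pos_divide_less_eq)
  ultimately show ?thesis using l by blast
qed

text \<open>Vanishing at the arguments \<open>1, 2, 3, \<dots>\<close> says that \<open>x \<mapsto> exp (- x) * k x\<close> is orthogonal to
  all polynomials in \<open>exp (- x)\<close>, hence to every continuous function of \<open>exp (- x)\<close>.\<close>

lemma laplace_zero_continuous:
  fixes k v :: "real \<Rightarrow> real"
  assumes int: "\<And>l. l > 0 \<Longrightarrow> integrable lborel (\<lambda>x. exp (- l * x) * k x)"
    and supp: "\<And>x. x < 0 \<Longrightarrow> k x = 0"
    and zero: "\<And>l. 0 < l \<Longrightarrow> laplace k l = 0"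
    and v: "continuous_on UNIV v"
  shows "integrable lborel (\<lambda>x. v (exp (- x)) * (exp (- x) * k x))"
    and "(\<integral>x. v (exp (- x)) * (exp (- x) * k x) \<partial>lborel) = 0"
proof -
  have i1: "integrable lborel (\<lambda>x. exp (- x) * k x)" using int[of 1] by simp
  have [measurable]: "(\<lambda>x. exp (- x) * k x) \<in> borel_measurable borel" using i1 by simp
  have vm[measurable]: "v \<in> borel_measurable borel" using v by (rule borel_measurable_continuous_onI)
  have "bounded (v ` {0..1})"
    using v by (intro compact_imp_bounded compact_continuous_image) (auto intro: continuous_on_subset)
  then obtain B where "\<forall>y\<in>v ` {0..1}. norm y \<le> B" unfolding bounded_iff by blast
  then have B: "\<And>u. u \<in> {0..1} \<Longrightarrow> \<bar>v u\<bar> \<le> B" by auto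
  show iv: "integrable lborel (\<lambda>x. v (exp (- x)) * (exp (- x) * k x))"
  proof (rule Bochner_Integration.integrable_bound)
    show "integrable lborel (\<lambda>x. B * (exp (- x) * k x))" using i1 by simp
    have "norm (v (exp (- x)) * (exp (- x) * k x)) \<le> norm (B * (exp (- x) * k x))" for x
    proof (cases "x < 0")
      case False
      then have "\<bar>v (exp (- x))\<bar> \<le> B" by (intro B) auto
      then have "\<bar>v (exp (- x))\<bar> \<le> \<bar>B\<bar>" by linarith
      then show ?thesis by (auto simp: abs_mult intro!: mult_right_mono)
    qed (simp add: supp)
    then show "AE x in lborel. norm (v (exp (- x)) * (exp (- x) * k x)) \<le> norm (B * (exp (- x) * k x))" by simp
  qed simp
  let ?N = "\<integral>x. \<bar>exp (- x) * k x\<bar> \<partial>lborel"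
  have "\<bar>\<integral>x. v (exp (- x)) * (exp (- x) * k x) \<partial>lborel\<bar> \<le> 0 + e" if e: "e > 0" for e
  proof -
    \<comment> \<open>The \<open>+ 1\<close> covers the case in which the integral in the
      denominator is zero.\<close>
    define \<delta> where "\<delta> = e / (?N + 1)"
    have N0: "?N \<ge> 0" by simp
    have d: "\<delta> > 0" using e N0 unfolding \<delta>_def by (intro divide_pos_pos) linarith+
    obtain g where g: "real_polynomial_function g" "\<And>x. x \<in> {0..1} \<Longrightarrow> \<bar>v x - g x\<bar> < \<delta>"
      using Stone_Weierstrass_real_polynomial_function[of "{0..1::real}" v \<delta>] d v
      by (auto intro: continuous_on_subset)
    obtain a n where ga: "g = (\<lambda>x. \<Sum>i\<le>n. a i * x ^ i)" using g(1) by (auto simp: real_polynomial_function_iff_sum)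
    \<comment> \<open>The spare factor \<open>exp (- x)\<close> shifts the monomial of degree
      \<open>i\<close> to the argument \<open>Suc i\<close>, so that even the constant term meets
      the transform at a positive argument.\<close>
    have eq: "g (exp (- x)) * (exp (- x) * k x) = (\<Sum>i\<le>n. a i * (exp (- real (Suc i) * x) * k x))" for x
      unfolding ga sum_distrib_right
      by (intro sum.cong refl) (simp add: algebra_simps flip: exp_of_nat_mult exp_add)
    have ig: "integrable lborel (\<lambda>x. g (exp (- x)) * (exp (- x) * k x))"
      unfolding eq by (intro Bochner_Integration.integrable_sum integrable_mult_right int) auto
    have zg: "(\<integral>x. g (exp (- x)) * (exp (- x) * k x) \<partial>lborel) = 0"
    proof -
      have "(\<integral>x. g (exp (- x)) * (exp (- x) * k x) \<partial>lborel) =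
          (\<Sum>i\<le>n. \<integral>x. a i * (exp (- real (Suc i) * x) * k x) \<partial>lborel)"
        unfolding eq by (intro Bochner_Integration.integral_sum integrable_mult_right int) auto
      also have "\<dots> = (\<Sum>i\<le>n. a i * (\<integral>x. exp (- real (Suc i) * x) * k x \<partial>lborel))" by simp
      also have "\<dots> = 0" using zero by (intro sum.neutral) (auto simp del: of_nat_Suc)
      finally show ?thesis .
    qed
    have "\<bar>\<integral>x. v (exp (- x)) * (exp (- x) * k x) \<partial>lborel\<bar> =
        \<bar>\<integral>x. v (exp (- x)) * (exp (- x) * k x) - g (exp (- x)) * (exp (- x) * k x) \<partial>lborel\<bar>"
      using iv ig zg by simp
    also have "\<dots> \<le> (\<integral>x. \<bar>v (exp (- x)) * (exp (- x) * k x) - g (exp (- x)) * (exp (- x) * k x)\<bar> \<partial>lborel)"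
      by (rule integral_abs_bound)
    also have "\<dots> \<le> (\<integral>x. \<delta> * \<bar>exp (- x) * k x\<bar> \<partial>lborel)"
    proof (rule integral_mono)
      fix x show "\<bar>v (exp (- x)) * (exp (- x) * k x) - g (exp (- x)) * (exp (- x) * k x)\<bar> \<le> \<delta> * \<bar>exp (- x) * k x\<bar>"
      proof (cases "x < 0")
        case False
        then have "\<bar>v (exp (- x)) - g (exp (- x))\<bar> \<le> \<delta>" by (intro less_imp_le g(2)) auto
        then show ?thesis by (auto simp: abs_mult simp flip: left_diff_distrib intro!: mult_right_mono)
      qed (simp add: supp)
    qed (use iv ig i1 in auto)
    also have "\<dots> = \<delta> * ?N" by simp
    also have "e / (N + 1) * N \<le> e" if "N \<ge> 0" for N using that e by (simp add: field_simps)
    then have "\<delta> * ?N \<le> e" unfolding \<delta>_def using N0 by blast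
    finally show ?thesis by simp
  qed
  then have "\<bar>\<integral>x. v (exp (- x)) * (exp (- x) * k x) \<partial>lborel\<bar> \<le> 0"
    by (rule field_le_epsilon)
  then show "(\<integral>x. v (exp (- x)) * (exp (- x) * k x) \<partial>lborel) = 0" by simp
qed

text \<open>A \<open>k\<close> that is right-continuous and positive at \<open>y\<close> is positive
  on an interval to the right of \<open>y\<close>, and integrates to something positive against a
  bump there. Only one sign is treated, so that \<open>laplace_unique\<close> can use it for
  \<open>k\<close> and for \<open>- k\<close>.\<close>

lemma laplace_unique_nonpos:
  fixes k :: "real \<Rightarrow> real"
  assumes int: "\<And>l. l > 0 \<Longrightarrow> integrable lborel (\<lambda>x. exp (- l * x) * k x)"
    and supp: "\<And>x. x < 0 \<Longrightarrow> k x = 0" and c: "c > 0"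
    and zero: "\<And>l. 0 < l \<Longrightarrow> l < c \<Longrightarrow> laplace k l = 0"
    and cont: "continuous (at_right y) k"
  shows "k y \<le> 0"
proof (rule ccontr)
  assume "\<not> k y \<le> 0"
  then have "eventually (\<lambda>x. k x > 0) (at_right y)"
    using cont by (auto simp: continuous_within order_tendsto_iff)
  then obtain z where z: "z > y" "\<And>x. y < x \<Longrightarrow> x < z \<Longrightarrow> k x > 0"
    by (auto simp: eventually_at_right_field)
  \<comment> \<open>As a function of \<open>u = exp (- x)\<close> this is a bump that is positive
    exactly for \<open>y < x < z\<close>.\<close>
  define v where "v u = max 0 ((u - exp (- z)) * (exp (- y) - u))" for u :: real
  have v: "continuous_on UNIV v" unfolding v_def by (intro continuous_intros)
  note Z = laplace_zero_continuous[OF int supp laplace_zero_extend[OF int supp c zero] v]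
  let ?h = "\<lambda>x. v (exp (- x)) * (exp (- x) * k x)"
  have pos: "?h x > 0" if "y < x" "x < z" for x
    using z(2)[OF that] that by (auto simp: v_def intro!: mult_pos_pos)
  have zero_out: "?h x = 0" if "\<not> (y < x \<and> x < z)" for x
  proof -
    have "(exp (- x) - exp (- z)) * (exp (- y) - exp (- x)) \<le> 0"
      using that z by (auto simp: mult_le_0_iff)
    then show ?thesis by (simp add: v_def)
  qed
  have nonneg: "?h x \<ge> 0" for x using pos[of x] zero_out[of x] by (cases "y < x \<and> x < z") auto
  have "AE x in lborel. ?h x = 0"
    using integral_nonneg_eq_0_iff_AE[OF Z(1)] Z(2) nonneg by auto
  then have "AE x in lborel. x \<notin> {y<..<z}"
    by eventually_elim (use pos in force)
  then have "{y<..<z} \<in> null_sets lborel"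
    by (subst (asm) AE_iff_null_sets[symmetric]) auto
  then show False using z(1) by (auto simp: null_sets_def)
qed

lemma laplace_unique:
  fixes k :: "real \<Rightarrow> real"
  assumes int: "\<And>l. l > 0 \<Longrightarrow> integrable lborel (\<lambda>x. exp (- l * x) * k x)"
    and supp: "\<And>x. x < 0 \<Longrightarrow> k x = 0" and c: "c > 0"
    and zero: "\<And>l. 0 < l \<Longrightarrow> l < c \<Longrightarrow> laplace k l = 0"
    and cont: "continuous (at_right y) k"
  shows "k y = 0"
proof (rule antisym)
  show "k y \<le> 0" by (rule laplace_unique_nonpos[OF assms])
  have "- k y \<le> 0"
    by (rule laplace_unique_nonpos[where c = c]) (use assms in \<open>auto intro: continuous_minus\<close>)
  then show "0 \<le> k y" by simp
qed

section \<open>Paths and the time spent below zero\<close>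

text \<open>The first multiple of \<open>1 / real (Suc n)\<close> strictly after \<open>s\<close>.
  Taking floor plus one, not the ceiling, keeps it strictly to the right even at grid points, the
  side on which a cadlag path is continuous.\<close>

definition grid :: "nat \<Rightarrow> real \<Rightarrow> real" where
  "grid n s = (of_int \<lfloor>s * real (Suc n)\<rfloor> + 1) / real (Suc n)"

lemma grid_gt: "s < grid n s"
  unfolding grid_def pos_less_divide_eq[OF of_nat_0_less_iff[THEN iffD2, OF zero_less_Suc]]
  by (rule real_of_int_floor_add_one_gt)

lemma grid_le: "grid n s \<le> s + 1 / real (Suc n)"
  using of_int_floor_le[of "s * real (Suc n)"]
  by (simp add: grid_def pos_divide_le_eq distrib_right del: of_nat_Suc)

lemma grid_at_right: "filterlim (\<lambda>n. grid n s) (at_right s) sequentially"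
proof (rule filterlim_at_withinI)
  have "(\<lambda>n. s + 1 / real (Suc n)) \<longlonglongrightarrow> s + 0"
    by (intro tendsto_intros LIMSEQ_Suc[OF lim_1_over_n])
  then show "filterlim (\<lambda>n. grid n s) (nhds s) sequentially"
    by (intro tendsto_sandwich[OF _ _ tendsto_const[of s], of "\<lambda>n. grid n s" _ "\<lambda>n. s + 1 / real (Suc n)"]
          always_eventually allI grid_le less_imp_le[OF grid_gt]) simp
  show "\<forall>\<^sub>F n in sequentially. grid n s \<in> {s<..} - {s}" using grid_gt by auto
qed

lemma cadlag_tendsto_right: "cadlag p \<Longrightarrow> s \<ge> 0 \<Longrightarrow> (p \<longlongrightarrow> p s) (at_right s)"
  by (auto simp: cadlag_def continuous_within)

lemma cadlag_grid: "cadlag p \<Longrightarrow> s \<ge> 0 \<Longrightarrow> (\<lambda>n. p (grid n s)) \<longlonglongrightarrow> p s"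
  by (rule filterlim_compose[OF cadlag_tendsto_right grid_at_right])

lemma step_measurable: "(\<lambda>s. p (grid n (max 0 s))) \<in> borel_measurable borel"
proof -
  have "(\<lambda>s. (\<lambda>i::int. p ((of_int i + 1) / real (Suc n))) \<lfloor>max 0 s * real (Suc n)\<rfloor>) \<in> borel_measurable borel"
    by measurable
  then show ?thesis by (simp add: grid_def)
qed

text \<open>The path is a pointwise limit of step functions through grid times, each with countably
  many values. Nothing is assumed about negative times, hence the clamp
  \<open>max 0 s\<close>.\<close>

lemma cadlag_measurable:
  assumes "cadlag p"
  shows "(\<lambda>s. p (max 0 s)) \<in> borel_measurable borel"
  by (rule borel_measurable_LIMSEQ_real[OF cadlag_grid step_measurable]) (use assms in auto)

lemma cadlag_indicator_measurable:
  assumes "cadlag p" "u \<in> borel_measurable borel" "A \<subseteq> {0..}" "A \<in> sets borel"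
  shows "(\<lambda>s. indicator A s * u (p s) :: real) \<in> borel_measurable borel"
proof -
  note [measurable] = cadlag_measurable[OF assms(1)] assms(2,4)
  have "(\<lambda>s. indicator A s * u (p (max 0 s)) :: real) \<in> borel_measurable borel" by measurable
  also have "(\<lambda>s. indicator A s * u (p (max 0 s)) :: real) = (\<lambda>s. indicator A s * u (p s))"
    using assms(3) by (auto simp: fun_eq_iff max_def split: split_indicator)
  finally show ?thesis .
qed

text \<open>On the \<open>i\<close>-th cell of the grid \<open>grid n s\<close> is constant and
  equal to the right endpoint, so a Riemann sum is literally the integral of a function read at
  \<open>grid n s\<close>.\<close>

lemma step_integral:
  "has_bochner_integral lborel (\<lambda>s. indicator {0..<real m / real (Suc n)} s * g (grid n s))
     (\<Sum>i<m. g (real (Suc i) / real (Suc n)) / real (Suc n))"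
proof (induction m)
  case (Suc m)
  have g: "grid n s = real (Suc m) / real (Suc n)"
    if "real m / real (Suc n) \<le> s" "s < real (Suc m) / real (Suc n)" for s
  proof -
    have "\<lfloor>s * real (Suc n)\<rfloor> = int m"
    proof (rule floor_unique)
      show "of_int (int m) \<le> s * real (Suc n)"
        using that(1) by (simp add: pos_divide_le_eq del: of_nat_Suc)
      show "s * real (Suc n) < of_int (int m) + 1"
        using that(2) by (simp add: pos_less_divide_eq add.commute del: of_nat_Suc)
    qed
    then show ?thesis by (simp add: grid_def)
  qed
  have "has_bochner_integral lborel
      (\<lambda>s. indicator {real m / real (Suc n)..<real (Suc m) / real (Suc n)} s * g (real (Suc m) / real (Suc n)))
      (measure lborel {real m / real (Suc n)..<real (Suc m) / real (Suc n)} * g (real (Suc m) / real (Suc n)))"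
    by (intro has_bochner_integral_mult_left has_bochner_integral_real_indicator)
       (simp_all add: divide_right_mono)
  moreover have "measure lborel {real m / real (Suc n)..<real (Suc m) / real (Suc n)} = 1 / real (Suc n)"
    by (simp add: divide_right_mono flip: diff_divide_distrib)
  ultimately have "has_bochner_integral lborel
      (\<lambda>s. indicator {real m / real (Suc n)..<real (Suc m) / real (Suc n)} s * g (real (Suc m) / real (Suc n)))
      (1 / real (Suc n) * g (real (Suc m) / real (Suc n)))" by simp
  from has_bochner_integral_add[OF Suc this]
  moreover have "indicator {0..<real m / real (Suc n)} s * g (grid n s) +
      indicator {real m / real (Suc n)..<real (Suc m) / real (Suc n)} s * g (real (Suc m) / real (Suc n)) =
      indicator {0..<real (Suc m) / real (Suc n)} s * g (grid n s)" for s
  proof -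
    have split: "indicator {0..<a} s * v + indicator {a..<b} s * w = indicator {0..<b} s * v"
      if "0 \<le> a" "a \<le> b" "a \<le> s \<Longrightarrow> s < b \<Longrightarrow> v = w" for a b v w :: real
      using that by (auto split: split_indicator)
    show ?thesis by (rule split) (auto simp: g divide_right_mono simp del: of_nat_Suc)
  qed
  ultimately show ?case by (simp add: mult.commute del: of_nat_Suc)
qed (simp add: has_bochner_integral_zero)

text \<open>With Riemann sums written as integrals over \<open>grid n s\<close>, right-continuity of
  the path gives pointwise convergence and boundedness of \<open>g\<close> gives a majorant; no
  Riemann integrability argument is required.\<close>

lemma riemann_tendsto:
  fixes g :: "real \<Rightarrow> real"
  assumes p: "cadlag p" and g: "continuous_on UNIV g" and B: "\<And>y. \<bar>g y\<bar> \<le> B"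
  shows "(\<lambda>n. \<Sum>i<N * Suc n. g (p (real (Suc i) / real (Suc n))) / real (Suc n))
           \<longlonglongrightarrow> (\<integral>s. indicator {0..<real N} s * g (p s) \<partial>lborel)"
proof -
  have gm[measurable]: "g \<in> borel_measurable borel" using g by (rule borel_measurable_continuous_onI)
  have "(\<lambda>n. \<integral>s. indicator {0..<real N} s * g (p (grid n s)) \<partial>lborel)
          \<longlonglongrightarrow> (\<integral>s. indicator {0..<real N} s * g (p s) \<partial>lborel)"
  proof (rule integral_dominated_convergence)
    show "integrable lborel (\<lambda>s. indicator {0..<real N} s * B)"
      by (intro integrable_mult_left integrable_real_indicator) auto
    show "AE s in lborel. (\<lambda>n. indicator {0..<real N} s * g (p (grid n s))) \<longlonglongrightarrow> indicator {0..<real N} s * g (p s)"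
    proof (intro AE_I2)
      fix s
      show "(\<lambda>n. indicator {0..<real N} s * g (p (grid n s))) \<longlonglongrightarrow> indicator {0..<real N} s * g (p s)"
      proof (cases "s \<ge> 0")
        case True
        have "isCont g (p s)" using g by (simp add: continuous_on_eq_continuous_at)
        from isCont_tendsto_compose[OF this cadlag_grid[OF p True]] show ?thesis by (intro tendsto_intros)
      qed simp
    qed
    fix n
    show "AE s in lborel. norm (indicator {0..<real N} s * g (p (grid n s))) \<le> indicator {0..<real N} s * B"
      using B by (auto split: split_indicator)
    have [measurable]: "(\<lambda>s. g (p (grid n (max 0 s)))) \<in> borel_measurable borel"
      using measurable_compose[OF step_measurable gm] .
    have "(\<lambda>s. indicator {0..<real N} s * g (p (grid n (max 0 s)))) \<in> borel_measurable borel"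
      by measurable
    also have "(\<lambda>s. indicator {0..<real N} s * g (p (grid n (max 0 s)))) = (\<lambda>s. indicator {0..<real N} s * g (p (grid n s)))"
      by (auto simp: fun_eq_iff max_def split: split_indicator)
    finally show "(\<lambda>s. indicator {0..<real N} s * g (p (grid n s))) \<in> borel_measurable lborel" by simp
  next
    show "(\<lambda>s. indicator {0..<real N} s * g (p s)) \<in> borel_measurable lborel"
      using cadlag_indicator_measurable[OF p gm, of "{0..<real N}"] by (simp add: subset_eq)
  qed
  moreover have "(\<integral>s. indicator {0..<real N} s * g (p (grid n s)) \<partial>lborel)
      = (\<Sum>i<N * Suc n. g (p (real (Suc i) / real (Suc n))) / real (Suc n))" for n
  proof -
    have "real (N * Suc n) / real (Suc n) = real N" unfolding of_nat_mult by (simp del: of_nat_Suc)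
    then show ?thesis
      using has_bochner_integral_integral_eq[OF step_integral[of "N * Suc n" n "\<lambda>y. g (p y)"]]
      by (simp del: of_nat_Suc)
  qed
  ultimately show ?thesis by simp
qed

section \<open>Transient paths and their time below zero\<close>

definition transient :: "(real \<Rightarrow> real) \<Rightarrow> bool" where
  "transient p \<longleftrightarrow> cadlag p \<and> filterlim p at_top at_top"

text \<open>A real-valued version of \<open>time_below_zero\<close>. The Bochner integral would
  default to \<open>0\<close> if the duration were infinite; for a \<open>transient\<close> path it
  is finite, since the path is eventually nonnegative.\<close>

definition below :: "(real \<Rightarrow> real) \<Rightarrow> real" where
  "below p = (\<integral>s. indicator {0..} s * indicator {..<0} (p s) \<partial>lborel)"

lemma transient_shift:
  assumes "transient p" "t \<ge> 0"
  shows "transient (\<lambda>s. c + p (t + s))"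
proof -
  have "continuous (at_right s) (\<lambda>s. c + p (t + s))" if "s \<ge> 0" for s
  proof -
    have "(p \<longlongrightarrow> p (t + s)) (at_right (t + s))"
      using assms that by (intro cadlag_tendsto_right) (auto simp: transient_def)
    then have "((\<lambda>s. p (t + s)) \<longlongrightarrow> p (t + s)) (at_right s)"
      by (subst (asm) at_right_to_0, subst at_right_to_0) (simp add: filterlim_filtermap add_ac)
    then show ?thesis unfolding continuous_within by (intro tendsto_intros)
  qed
  moreover have "\<exists>l. ((\<lambda>s. c + p (t + s)) \<longlongrightarrow> l) (at_left s)" if "s > 0" for s
  proof -
    have "t + s > 0" using assms that by simp
    then obtain l where "(p \<longlongrightarrow> l) (at_left (t + s))"
      using assms(1) unfolding transient_def cadlag_def by blast
    then have "((\<lambda>s. p (t + s)) \<longlongrightarrow> l) (at_left s)"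
      unfolding at_left_minus[of "t + s"] at_left_minus[of s] at_right_to_0[of "- (t + s)"] at_right_to_0[of "- s"]
      by (simp add: filterlim_filtermap algebra_simps)
    then have "((\<lambda>s. c + p (t + s)) \<longlongrightarrow> c + l) (at_left s)" by (intro tendsto_intros)
    then show ?thesis ..
  qed
  moreover have "filterlim (\<lambda>s. c + p (t + s)) at_top at_top"
  proof (rule filterlim_tendsto_add_at_top[OF tendsto_const])
    have "filterlim (\<lambda>s::real. t + s) at_top at_top"
      by (rule filterlim_tendsto_add_at_top[OF tendsto_const filterlim_ident])
    then show "filterlim (\<lambda>s. p (t + s)) at_top at_top"
      using assms filterlim_compose unfolding transient_def by blast
  qed
  ultimately show ?thesis by (auto simp: transient_def cadlag_def)
qed

lemma below_integrable:
  assumes "transient p"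
  shows "integrable lborel (\<lambda>s. indicator {0..} s * indicator {..<0} (p s) :: real)"
proof -
  have "eventually (\<lambda>s. p s \<ge> 0) at_top"
    using assms by (auto simp: transient_def filterlim_at_top)
  then obtain T where T: "\<And>s. s \<ge> T \<Longrightarrow> p s \<ge> 0" by (auto simp: eventually_at_top_linorder)
  show ?thesis
  proof (rule Bochner_Integration.integrable_bound)
    show "integrable lborel (\<lambda>s. indicator {0..T} s :: real)"
      by (rule integrable_real_indicator) (auto simp: emeasure_lborel_Icc_eq)
    show "(\<lambda>s. indicator {0..} s * indicator {..<0} (p s) :: real) \<in> borel_measurable lborel"
      using cadlag_indicator_measurable[of p "indicator {..<0}" "{0..}"] assms by (auto simp: transient_def)
    show "AE s in lborel. norm (indicator {0..} s * indicator {..<0} (p s) :: real) \<le> norm (indicator {0..T} s :: real)"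
      using T by (intro AE_I2) (auto split: split_indicator, meson le_cases not_le)
  qed
qed

lemma below_nonneg: "below p \<ge> 0"
  unfolding below_def by (intro integral_nonneg_AE) auto

text \<open>Continuous approximations of the indicator of \<open>{..<0}\<close> from below.
  Continuity makes their Riemann sums along a cadlag path converge, and the indicator itself is the
  majorant as \<open>k\<close> grows.\<close>

definition ramp :: "nat \<Rightarrow> real \<Rightarrow> real" where
  "ramp k y = min 1 (max 0 (- real k * y))"

lemma ramp_bounds: "0 \<le> ramp k y" "ramp k y \<le> indicator {..<0} y"
  by (auto simp: ramp_def split: split_indicator intro!: mult_nonneg_nonneg)

lemma ramp_tendsto: "(\<lambda>k. ramp k y) \<longlonglongrightarrow> indicator {..<0} y"
proof (cases "y < 0")
  case True
  obtain n where n: "real n * (- y) > 1" using reals_Archimedean3[of "-y"] True by (metis neg_0_less_iff_less)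
  have "eventually (\<lambda>k. ramp k y = 1) sequentially"
    using eventually_ge_at_top[of n]
  proof eventually_elim
    case (elim k)
    have "real n * (- y) \<le> real k * (- y)" using elim True by (intro mult_right_mono) auto
    then show ?case using n by (simp add: ramp_def)
  qed
  then show ?thesis using True by (simp add: tendsto_eventually)
next
  case False
  then have "ramp k y = 0" for k using ramp_bounds[of k y] by simp
  then show ?thesis using False by simp
qed

lemma below_ramp_tendsto:
  assumes "transient p"
  shows "(\<lambda>k. \<integral>s. indicator {0..<real k} s * ramp k (p s) \<partial>lborel) \<longlonglongrightarrow> below p"
  unfolding below_def
proof (rule integral_dominated_convergence[OF _ _ below_integrable[OF assms]])
  have c: "cadlag p" using assms by (simp add: transient_def)
  show "(\<lambda>s. indicator {0..} s * indicator {..<0} (p s) :: real) \<in> borel_measurable lborel"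
    using below_integrable[OF assms] by simp
  show "AE s in lborel. (\<lambda>k. indicator {0..<real k} s * ramp k (p s)) \<longlonglongrightarrow> indicator {0..} s * indicator {..<0} (p s)"
  proof (intro AE_I2 tendsto_mult ramp_tendsto)
    fix s :: real
    obtain n where "s < real n" using reals_Archimedean2 by blast
    then have "eventually (\<lambda>k. indicator {0..<real k} s = (indicator {0..} s :: real)) sequentially"
      by (intro eventually_sequentiallyI[of n]) (auto split: split_indicator)
    then show "(\<lambda>k. indicator {0..<real k} s) \<longlonglongrightarrow> (indicator {0..} s :: real)" by (rule tendsto_eventually)
  qed
  fix k
  have "continuous_on UNIV (ramp k)" unfolding ramp_def by (intro continuous_intros)
  then have "ramp k \<in> borel_measurable borel" by (rule borel_measurable_continuous_onI)
  then show "(\<lambda>s. indicator {0..<real k} s * ramp k (p s)) \<in> borel_measurable lborel"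
    using cadlag_indicator_measurable[OF c, of "ramp k" "{0..<real k}"] by (simp add: subset_eq)
  show "AE s in lborel. norm (indicator {0..<real k} s * ramp k (p s)) \<le> indicator {0..} s * indicator {..<0} (p s)"
  proof (intro AE_I2)
    fix s
    show "norm (indicator {0..<real k} s * ramp k (p s)) \<le> indicator {0..} s * indicator {..<0} (p s)"
      using ramp_bounds[of k "p s"] by (auto simp: abs_mult split: split_indicator)
  qed
qed

section \<open>The Markov property\<close>

text \<open>The process with all path properties holding for every \<omega>, the drift packed into
  \<open>transient\<close>, and independence and stationarity of increments merged into one product
  formula. \<open>regular_modification\<close> supplies such a process.\<close>

locale regular_levy = prob_space M
  for M :: "'a measure" and F :: "real \<Rightarrow> 'a measure" and X :: "real \<Rightarrow> 'a \<Rightarrow> real"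
    and \<phi> :: "real \<Rightarrow> real" +
  assumes subalgebra_F: "\<And>t. t \<ge> 0 \<Longrightarrow> subalgebra M (F t)"
    and F_mono: "\<And>s t. s \<le> t \<Longrightarrow> sets (F s) \<subseteq> sets (F t)"
    and adapted: "\<And>t. t \<ge> 0 \<Longrightarrow> X t \<in> borel_measurable (F t)"
    and increments: "\<And>s h A B. s \<ge> 0 \<Longrightarrow> h \<ge> 0 \<Longrightarrow> A \<in> sets (F s) \<Longrightarrow> B \<in> sets borel \<Longrightarrow>
      prob (A \<inter> {\<omega> \<in> space M. X (s + h) \<omega> - X s \<omega> \<in> B}) = prob A * prob {\<omega> \<in> space M. X h \<omega> \<in> B}"
    and X_0: "\<And>\<omega>. \<omega> \<in> space M \<Longrightarrow> X 0 \<omega> = 0"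
    and paths: "\<And>\<omega>. \<omega> \<in> space M \<Longrightarrow> transient (\<lambda>t. X t \<omega>)"
    and no_jumps: "\<And>\<omega>. \<omega> \<in> space M \<Longrightarrow> no_positive_jumps (\<lambda>t. X t \<omega>)"
    and exp_integrable: "\<And>t \<alpha>. t \<ge> 0 \<Longrightarrow> \<alpha> \<ge> 0 \<Longrightarrow> integrable M (\<lambda>\<omega>. exp (\<alpha> * X t \<omega>))"
    and exp_integral: "\<And>t \<alpha>. t \<ge> 0 \<Longrightarrow> \<alpha> \<ge> 0 \<Longrightarrow> (\<integral>\<omega>. exp (\<alpha> * X t \<omega>) \<partial>M) = exp (t * \<phi> \<alpha>)"
begin

lemma space_F: "t \<ge> 0 \<Longrightarrow> space (F t) = space M"
  using subalgebra_F by (simp add: subalgebra_def)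

lemma measurable_F_M: "t \<ge> 0 \<Longrightarrow> f \<in> measurable (F t) N \<Longrightarrow> f \<in> measurable M N"
  using subalgebra_F measurable_from_subalg by blast

lemma measurable_F_mono:
  "0 \<le> s \<Longrightarrow> s \<le> t \<Longrightarrow> f \<in> measurable (F s) N \<Longrightarrow> f \<in> measurable (F t) N"
  by (rule measurable_from_subalg[of "F t" "F s"]) (use space_F F_mono in \<open>auto simp: subalgebra_def\<close>)

lemma X_measurable: "t \<ge> 0 \<Longrightarrow> X t \<in> borel_measurable M"
  using adapted measurable_F_M by blast

lemma integrable_bounded:
  fixes g :: "'a \<Rightarrow> real"
  assumes "g \<in> borel_measurable M" "\<And>\<omega>. \<omega> \<in> space M \<Longrightarrow> \<bar>g \<omega>\<bar> \<le> B"
  shows "integrable M g"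
  by (rule integrable_const_bound[where B = B]) (use assms in auto)

lemma increment_distr:
  assumes "t \<ge> 0" "h \<ge> 0"
  shows "distr M borel (\<lambda>\<omega>. X (t + h) \<omega> - X t \<omega>) = distr M borel (X h)"
proof (rule measure_eqI)
  note [measurable] = X_measurable[OF assms(1)] X_measurable[OF assms(2)] X_measurable[OF add_nonneg_nonneg[OF assms]]
  fix B assume "B \<in> sets (distr M borel (\<lambda>\<omega>. X (t + h) \<omega> - X t \<omega>))"
  then have [measurable]: "B \<in> sets borel" by simp
  have "space M \<in> sets (F t)" using space_F[OF assms(1)] sets.top[of "F t"] by simp
  from increments[OF assms this \<open>B \<in> sets borel\<close>]
  have "prob {\<omega> \<in> space M. X (t + h) \<omega> - X t \<omega> \<in> B} = prob {\<omega> \<in> space M. X h \<omega> \<in> B}"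
    by (simp add: prob_space Int_absorb1 subset_eq)
  then show "emeasure (distr M borel (\<lambda>\<omega>. X (t + h) \<omega> - X t \<omega>)) B = emeasure (distr M borel (X h)) B"
    by (simp add: emeasure_distr emeasure_eq_measure vimage_def Int_def conj_commute)
qed simp

lemma increment_indep:
  assumes "t \<ge> 0" "h \<ge> 0" and V: "V \<in> measurable (F t) N" and c: "c \<in> measurable borel N"
  shows "indep_var N V N (\<lambda>\<omega>. c (X (t + h) \<omega> - X t \<omega>))"
proof -
  note [measurable] = X_measurable[OF assms(1)] X_measurable[OF assms(2)] X_measurable[OF add_nonneg_nonneg[OF assms(1,2)]]
  have VM: "V \<in> measurable M N" by (rule measurable_F_M[OF assms(1) V])
  let ?D = "\<lambda>\<omega>. X (t + h) \<omega> - X t \<omega>"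
  let ?W = "\<lambda>\<omega>. c (?D \<omega>)"
  have WM: "?W \<in> measurable M N" by (rule measurable_compose[OF _ c]) measurable
  \<comment> \<open>The preimages under one map already form a sigma-algebra, so independence
    reduces to the product formula of \<open>increments\<close>.\<close>
  have s1: "sigma_sets (space M) {V -` A \<inter> space M |A. A \<in> sets N} = {V -` A \<inter> space M |A. A \<in> sets N}"
    using sets_vimage_algebra2[of V "space M" N] measurable_space[OF VM] by (auto simp: sets_vimage_algebra)
  have s2: "sigma_sets (space M) {?W -` A \<inter> space M |A. A \<in> sets N} = {?W -` A \<inter> space M |A. A \<in> sets N}"
    using sets_vimage_algebra2[of ?W "space M" N] measurable_space[OF WM] by (auto simp: sets_vimage_algebra)
  have "prob ((V -` A \<inter> space M) \<inter> (?W -` B \<inter> space M)) = prob (V -` A \<inter> space M) * prob (?W -` B \<inter> space M)"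
    if "A \<in> sets N" "B \<in> sets N" for A B
  proof -
    have a: "V -` A \<inter> space M \<in> sets (F t)"
      using measurable_sets[OF V that(1)] space_F[OF assms(1)] by simp
    have "space M \<in> sets (F t)" using space_F[OF assms(1)] sets.top[of "F t"] by simp
    have e: "?W -` B \<inter> space M = {\<omega> \<in> space M. ?D \<omega> \<in> c -` B}" by auto
    have b: "c -` B \<in> sets borel" using measurable_sets[OF c that(2)] by simp
    have "prob (?W -` B \<inter> space M) = prob {\<omega> \<in> space M. X h \<omega> \<in> c -` B}"
      using increments[OF assms(1,2) \<open>space M \<in> sets (F t)\<close> b] unfolding e
      by (simp add: prob_space Int_absorb1 subset_eq)
    then show ?thesis using increments[OF assms(1,2) a b] by (simp add: e)
  qed
  then show ?thesis
    unfolding indep_var_eq s1 s2 indep_sets2_eq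
    using VM WM by (auto simp: measurable_sets)
qed

text \<open>Freezing: the pair of \<open>Y\<close> and \<open>Z\<close> is independent of the
  increment, so their joint law is a product and Fubini integrates the increment out with
  \<open>Z\<close> held fixed.\<close>

lemma increment_integral:
  fixes Y Z :: "'a \<Rightarrow> real" and u :: "real \<Rightarrow> real"
  assumes t: "t \<ge> 0" and h: "h \<ge> 0"
    and Y: "Y \<in> borel_measurable (F t)" "\<And>\<omega>. 0 \<le> Y \<omega> \<and> Y \<omega> \<le> 1" and Z: "Z \<in> borel_measurable (F t)"
    and u: "u \<in> borel_measurable borel" "\<And>y. 0 \<le> u y \<and> u y \<le> 1"
  shows "(\<lambda>z. \<integral>\<omega>. u (z + X h \<omega>) \<partial>M) \<in> borel_measurable borel"
    and "(\<integral>\<omega>. Y \<omega> * u (Z \<omega> + (X (t + h) \<omega> - X t \<omega>)) \<partial>M) = (\<integral>\<omega>. Y \<omega> * (\<integral>\<omega>'. u (Z \<omega> + X h \<omega>') \<partial>M) \<partial>M)"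
proof -
  note [measurable] = X_measurable[OF t] X_measurable[OF h] X_measurable[OF add_nonneg_nonneg[OF t h]] Y(1) Z(1) u(1)
    measurable_F_M[OF t Y(1)] measurable_F_M[OF t Z(1)]
  have "(\<lambda>x. u (fst x + X h (snd x))) \<in> borel_measurable (borel \<Otimes>\<^sub>M M)"
    by (intro measurable_compose[OF _ u(1)] borel_measurable_add measurable_fst
          measurable_compose[OF measurable_snd X_measurable[OF h]])
  then show [measurable]: "(\<lambda>z. \<integral>\<omega>. u (z + X h \<omega>) \<partial>M) \<in> borel_measurable borel"
    by (intro borel_measurable_lebesgue_integral) (simp add: split_beta')
  let ?D = "\<lambda>\<omega>. X (t + h) \<omega> - X t \<omega>"
  let ?N = "borel \<Otimes>\<^sub>M borel :: (real \<times> real) measure"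
  let ?V = "\<lambda>\<omega>. (Y \<omega>, Z \<omega>)"
  \<comment> \<open>\<open>indep_var\<close> wants both variables in the same type, so the increment is padded to a pair.\<close>
  let ?W = "\<lambda>\<omega>. (?D \<omega>, 0 :: real)"
  \<comment> \<open>The clamp leaves \<open>Y\<close> unchanged but bounds \<open>k\<close> on the
    whole product space, which gives integrability under the product law.\<close>
  define k where "k v w = max 0 (min 1 (fst v)) * u (snd v + fst w)" for v w :: "real \<times> real"
  have km[measurable]: "(\<lambda>(v, w). k v w) \<in> borel_measurable (?N \<Otimes>\<^sub>M ?N)"
    unfolding k_def by measurable
  have clamp: "max 0 (min 1 (Y \<omega>)) = Y \<omega>" for \<omega> using Y(2)[of \<omega>] by simp
  have k01: "\<bar>k v w\<bar> \<le> 1" for v w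
    using u(2)[of "snd v + fst w"] by (auto simp: k_def abs_mult intro!: mult_le_one)
  have Vm: "?V \<in> measurable (F t) ?N" by measurable
  have VM[measurable]: "?V \<in> measurable M ?N" by measurable
  have WM[measurable]: "?W \<in> measurable M ?N" by measurable
  have D: "distr M ?N ?V \<Otimes>\<^sub>M distr M ?N ?W = distr M (?N \<Otimes>\<^sub>M ?N) (\<lambda>\<omega>. (?V \<omega>, ?W \<omega>))"
    using increment_indep[OF t h Vm, of "\<lambda>w. (w, 0)"] by (simp add: indep_var_distribution_eq)
  interpret DV: prob_space "distr M ?N ?V" by (rule prob_space_distr) measurable
  interpret DW: prob_space "distr M ?N ?W" by (rule prob_space_distr) measurable
  interpret P: pair_prob_space "distr M ?N ?V" "distr M ?N ?W" ..
  have DX: "distr M ?N ?W = distr M ?N (\<lambda>\<omega>. (X h \<omega>, 0))"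
  proof -
    have "distr M ?N ?W = distr (distr M borel ?D) ?N (\<lambda>w. (w, 0))"
      by (subst distr_distr) (auto simp: comp_def)
    also have "\<dots> = distr M ?N (\<lambda>\<omega>. (X h \<omega>, 0))"
      unfolding increment_distr[OF t h] by (subst distr_distr) (auto simp: comp_def)
    finally show ?thesis .
  qed
  have "(\<integral>\<omega>. Y \<omega> * u (Z \<omega> + ?D \<omega>) \<partial>M) = (\<integral>\<omega>. (\<lambda>(v, w). k v w) (?V \<omega>, ?W \<omega>) \<partial>M)"
    by (simp add: k_def clamp)
  also have "\<dots> = (\<integral>x. (\<lambda>(v, w). k v w) x \<partial>distr M (?N \<Otimes>\<^sub>M ?N) (\<lambda>\<omega>. (?V \<omega>, ?W \<omega>)))"
    by (intro integral_distr[symmetric]) measurable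
  also have "\<dots> = (\<integral>v. \<integral>w. k v w \<partial>distr M ?N ?W \<partial>distr M ?N ?V)"
    unfolding D[symmetric]
    by (subst P.integral_fst'[symmetric]) (use k01 in \<open>auto intro!: P.integrable_const_bound[where B = 1]\<close>)
  also have "\<dots> = (\<integral>v. \<integral>\<omega>'. k v (X h \<omega>', 0) \<partial>M \<partial>distr M ?N ?V)"
    unfolding DX by (intro Bochner_Integration.integral_cong refl integral_distr) measurable
  also have "\<dots> = (\<integral>\<omega>. \<integral>\<omega>'. k (?V \<omega>) (X h \<omega>', 0) \<partial>M \<partial>M)"
    by (intro integral_distr) measurable
  also have "\<dots> = (\<integral>\<omega>. Y \<omega> * (\<integral>\<omega>'. u (Z \<omega> + X h \<omega>') \<partial>M) \<partial>M)"
    by (simp add: k_def clamp)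
  finally show "(\<integral>\<omega>. Y \<omega> * u (Z \<omega> + ?D \<omega>) \<partial>M) = (\<integral>\<omega>. Y \<omega> * (\<integral>\<omega>'. u (Z \<omega> + X h \<omega>') \<partial>M) \<partial>M)" .
qed

abbreviation restart :: "real \<Rightarrow> real \<Rightarrow> 'a \<Rightarrow> real \<Rightarrow> real" where
  "restart t z \<omega> \<equiv> \<lambda>s. z + (X (t + s) \<omega> - X t \<omega>)"

text \<open>The Markov property at fixed times, tested against a weight \<open>Y\<close>. The
  starting point is any \<open>F t\<close>-measurable \<open>Z\<close> rather than
  \<open>X t\<close>: an induction over time points has to restart from \<open>Z\<close> plus an
  increment. Measurability in \<open>z\<close> is included so that the inner expectation can be
  integrated.\<close>

definition markov_functional :: "((real \<Rightarrow> real) \<Rightarrow> real) \<Rightarrow> bool" where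
  "markov_functional G \<longleftrightarrow>
     (\<lambda>z. \<integral>\<omega>. G (\<lambda>s. z + X s \<omega>) \<partial>M) \<in> borel_measurable borel \<and>
     (\<forall>t\<ge>0. \<forall>Y \<in> borel_measurable (F t). \<forall>Z \<in> borel_measurable (F t). (\<forall>\<omega>. 0 \<le> Y \<omega> \<and> Y \<omega> \<le> 1) \<longrightarrow>
        (\<lambda>\<omega>. G (restart t (Z \<omega>) \<omega>)) \<in> borel_measurable M \<and>
        (\<integral>\<omega>. Y \<omega> * G (restart t (Z \<omega>) \<omega>) \<partial>M) =
        (\<integral>\<omega>. Y \<omega> * (\<integral>\<omega>'. G (\<lambda>s. Z \<omega> + X s \<omega>') \<partial>M) \<partial>M))"

text \<open>Induction on the number of time points. The first factor is absorbed into the weight,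
  which is measurable at \<open>t + h\<close>; the induction hypothesis applies there, and
  \<open>increment_integral\<close> then averages over the first increment. The kernel \<kappa> is
  only claimed to exist, which keeps the induction free of its formula.\<close>

lemma markov_functional_prod:
  fixes g :: "real \<Rightarrow> real"
  assumes g: "g \<in> borel_measurable borel" "\<And>y. 0 \<le> g y \<and> g y \<le> 1" and h: "h \<ge> 0"
  shows "markov_functional (\<lambda>p. \<Prod>i<m. g (p (real (Suc i) * h)))"
proof -
  let ?P = "\<lambda>m p. \<Prod>i<m. g (p (real (Suc i) * h))"
  have P01: "0 \<le> ?P m p \<and> ?P m p \<le> 1" for m p
    using g(2) by (auto intro!: prod_nonneg prod_le_1)
  have "\<exists>\<kappa>\<in>borel_measurable borel. (\<forall>z. 0 \<le> \<kappa> z \<and> \<kappa> z \<le> 1) \<and>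
     (\<forall>t\<ge>0. \<forall>Y \<in> borel_measurable (F t). \<forall>Z \<in> borel_measurable (F t). (\<forall>\<omega>. 0 \<le> Y \<omega> \<and> Y \<omega> \<le> 1) \<longrightarrow>
        (\<integral>\<omega>. Y \<omega> * ?P m (restart t (Z \<omega>) \<omega>) \<partial>M) = (\<integral>\<omega>. Y \<omega> * \<kappa> (Z \<omega>) \<partial>M))"
  proof (induction m)
    case 0
    show ?case by (rule bexI[of _ "\<lambda>_. 1"]) auto
  next
    case (Suc m)
    then obtain \<kappa> where \<kappa>[measurable]: "\<kappa> \<in> borel_measurable borel" and \<kappa>01: "\<And>z. 0 \<le> \<kappa> z \<and> \<kappa> z \<le> 1"
      and \<kappa>_eq: "\<And>t Y Z. t \<ge> 0 \<Longrightarrow> Y \<in> borel_measurable (F t) \<Longrightarrow> Z \<in> borel_measurable (F t) \<Longrightarrow>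
        (\<And>\<omega>. 0 \<le> Y \<omega> \<and> Y \<omega> \<le> 1) \<Longrightarrow>
        (\<integral>\<omega>. Y \<omega> * ?P m (restart t (Z \<omega>) \<omega>) \<partial>M) = (\<integral>\<omega>. Y \<omega> * \<kappa> (Z \<omega>) \<partial>M)"
      by blast
    let ?u = "\<lambda>y. g y * \<kappa> y"
    have u01: "0 \<le> ?u y \<and> ?u y \<le> 1" for y using g(2)[of y] \<kappa>01[of y] by (auto intro: mult_le_one)
    have um[measurable]: "?u \<in> borel_measurable borel" using g(1) by measurable
    show ?case
    proof (intro bexI conjI allI ballI impI)
      show "(\<lambda>z. \<integral>\<omega>. ?u (z + X h \<omega>) \<partial>M) \<in> borel_measurable borel"
        by (rule increment_integral(1)[of 0 h "\<lambda>_. 0" "\<lambda>_. 0"]) (use h u01 um in auto)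
      fix z
      note [measurable] = X_measurable[OF h]
      show "0 \<le> (\<integral>\<omega>. ?u (z + X h \<omega>) \<partial>M)" using u01 by (intro integral_nonneg_AE) auto
      have "(\<integral>\<omega>. ?u (z + X h \<omega>) \<partial>M) \<le> (\<integral>\<omega>. 1 \<partial>M)"
      proof (intro integral_mono integrable_bounded[where B = 1])
        show "\<bar>?u (z + X h \<omega>)\<bar> \<le> 1" for \<omega> using u01[of "z + X h \<omega>"] by linarith
      qed (use u01 in auto)
      then show "(\<integral>\<omega>. ?u (z + X h \<omega>) \<partial>M) \<le> 1" by (simp add: prob_space)
    next
      fix t :: real and Y Z :: "'a \<Rightarrow> real"
      assume t: "t \<ge> 0" and Y: "Y \<in> borel_measurable (F t)" and Z: "Z \<in> borel_measurable (F t)"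
        and Y01: "\<forall>\<omega>. 0 \<le> Y \<omega> \<and> Y \<omega> \<le> 1"
      have th: "t + h \<ge> 0" "t \<le> t + h" using t h by auto
      note [measurable] = measurable_F_mono[OF t th(2) Y] measurable_F_mono[OF t th(2) Z] adapted[OF th(1)]
        measurable_F_mono[OF t th(2) adapted[OF t]] g(1)
      let ?Z = "\<lambda>\<omega>. Z \<omega> + (X (t + h) \<omega> - X t \<omega>)"
      have "?P (Suc m) (restart t (Z \<omega>) \<omega>) =
          g (?Z \<omega>) * ?P m (restart (t + h) (?Z \<omega>) \<omega>)" for \<omega>
        by (subst prod.lessThan_Suc_shift) (simp add: algebra_simps)
      then have "(\<integral>\<omega>. Y \<omega> * ?P (Suc m) (restart t (Z \<omega>) \<omega>) \<partial>M) =
          (\<integral>\<omega>. (Y \<omega> * g (?Z \<omega>)) * ?P m (restart (t + h) (?Z \<omega>) \<omega>) \<partial>M)"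
        by (simp add: mult.assoc)
      also have "\<dots> = (\<integral>\<omega>. (Y \<omega> * g (?Z \<omega>)) * \<kappa> (?Z \<omega>) \<partial>M)"
        by (rule \<kappa>_eq[OF th(1)]) (use Y01 g(2) in \<open>auto intro!: mult_le_one\<close>)
      also have "\<dots> = (\<integral>\<omega>. Y \<omega> * ?u (?Z \<omega>) \<partial>M)" by (simp add: mult.assoc)
      also have "\<dots> = (\<integral>\<omega>. Y \<omega> * (\<integral>\<omega>'. ?u (Z \<omega> + X h \<omega>') \<partial>M) \<partial>M)"
        by (rule increment_integral(2)[OF t h Y _ Z um]) (use u01 Y01 in auto)
      finally show "(\<integral>\<omega>. Y \<omega> * ?P (Suc m) (restart t (Z \<omega>) \<omega>) \<partial>M) =
        (\<integral>\<omega>. Y \<omega> * (\<integral>\<omega>'. ?u (Z \<omega> + X h \<omega>') \<partial>M) \<partial>M)" .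
    qed
  qed
  then obtain \<kappa> where \<kappa>[measurable]: "\<kappa> \<in> borel_measurable borel"
    and \<kappa>_eq: "\<And>t Y Z. t \<ge> 0 \<Longrightarrow> Y \<in> borel_measurable (F t) \<Longrightarrow> Z \<in> borel_measurable (F t) \<Longrightarrow>
        (\<And>\<omega>. 0 \<le> Y \<omega> \<and> Y \<omega> \<le> 1) \<Longrightarrow>
        (\<integral>\<omega>. Y \<omega> * ?P m (restart t (Z \<omega>) \<omega>) \<partial>M) = (\<integral>\<omega>. Y \<omega> * \<kappa> (Z \<omega>) \<partial>M)"
    by blast
  \<comment> \<open>Time \<open>0\<close>, weight \<open>1\<close> and a constant starting point
    identify the kernel with the expectation from \<open>z\<close>.\<close>
  have \<kappa>_id: "(\<integral>\<omega>. ?P m (\<lambda>s. z + X s \<omega>) \<partial>M) = \<kappa> z" for z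
  proof -
    have "(\<integral>\<omega>. ?P m (\<lambda>s. z + X s \<omega>) \<partial>M) = (\<integral>\<omega>. 1 * ?P m (restart 0 z \<omega>) \<partial>M)"
      by (intro Bochner_Integration.integral_cong) (auto simp: X_0)
    also have "\<dots> = (\<integral>\<omega>. 1 * \<kappa> z \<partial>M)" by (rule \<kappa>_eq) auto
    finally show ?thesis by (simp add: prob_space)
  qed
  show ?thesis
    unfolding markov_functional_def \<kappa>_id
  proof (intro conjI allI impI ballI)
    show "(\<lambda>z. \<kappa> z) \<in> borel_measurable borel" by simp
    fix t :: real and Y Z :: "'a \<Rightarrow> real"
    assume t: "t \<ge> 0" and Y: "Y \<in> borel_measurable (F t)" and Z: "Z \<in> borel_measurable (F t)"
      and Y01: "\<forall>\<omega>. 0 \<le> Y \<omega> \<and> Y \<omega> \<le> 1"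
    show "(\<integral>\<omega>. Y \<omega> * ?P m (restart t (Z \<omega>) \<omega>) \<partial>M) = (\<integral>\<omega>. Y \<omega> * \<kappa> (Z \<omega>) \<partial>M)"
      by (rule \<kappa>_eq[OF t Y Z]) (use Y01 in auto)
    have [measurable]: "X (t + real (Suc i) * h) \<in> borel_measurable M" for i
      using t h by (intro X_measurable) auto
    note [measurable] = measurable_F_M[OF t Z] X_measurable[OF t] g(1)
    show "(\<lambda>\<omega>. ?P m (restart t (Z \<omega>) \<omega>)) \<in> borel_measurable M" by measurable
  qed
qed

text \<open>Dominated convergence with majorant \<open>1\<close>, applied to the inner and to the
  outer expectation. Convergence on \<open>transient\<close> paths is enough, since restarted paths
  are again transient.\<close>

lemma markov_functional_limit:
  assumes G: "\<And>n. markov_functional (G n)" and G01: "\<And>n p. 0 \<le> G n p \<and> G n p \<le> 1"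
    and lim: "\<And>p. transient p \<Longrightarrow> (\<lambda>n. G n p) \<longlonglongrightarrow> H p"
  shows "markov_functional H"
proof -
  have mG: "(\<lambda>z. \<integral>\<omega>. G n (\<lambda>s. z + X s \<omega>) \<partial>M) \<in> borel_measurable borel"
    and mG2: "\<And>t Y Z. t \<ge> 0 \<Longrightarrow> Y \<in> borel_measurable (F t) \<Longrightarrow> Z \<in> borel_measurable (F t) \<Longrightarrow>
        (\<And>\<omega>. 0 \<le> Y \<omega> \<and> Y \<omega> \<le> 1) \<Longrightarrow>
        (\<lambda>\<omega>. G n (restart t (Z \<omega>) \<omega>)) \<in> borel_measurable M \<and>
        (\<integral>\<omega>. Y \<omega> * G n (restart t (Z \<omega>) \<omega>) \<partial>M) =
        (\<integral>\<omega>. Y \<omega> * (\<integral>\<omega>'. G n (\<lambda>s. Z \<omega> + X s \<omega>') \<partial>M) \<partial>M)" for n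
    using G[of n] unfolding markov_functional_def by blast+
  have path_t: "transient (restart t z \<omega>)" if "t \<ge> 0" "\<omega> \<in> space M" for z t \<omega>
    using transient_shift[OF paths[OF that(2)] that(1), of "z - X t \<omega>"] by (simp add: algebra_simps)
  have path_0: "transient (\<lambda>s. z + X s \<omega>)" if "\<omega> \<in> space M" for z \<omega>
    using transient_shift[OF paths[OF that], of 0 z] by simp
  have m0: "(\<lambda>\<omega>. G n (\<lambda>s. z + X s \<omega>)) \<in> borel_measurable M" for n z
  proof -
    have "(\<lambda>\<omega>. G n (restart 0 z \<omega>)) \<in> borel_measurable M"
      using mG2[of 0 "\<lambda>_. 0" "\<lambda>_. z" n] by auto
    then show ?thesis by (rule measurable_cong[THEN iffD1, rotated]) (auto simp: X_0)
  qed
  have absG: "\<bar>G n p\<bar> \<le> 1" for n p using G01[of n p] by simp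
  have mH0: "(\<lambda>\<omega>. H (\<lambda>s. z + X s \<omega>)) \<in> borel_measurable M" for z
    by (rule borel_measurable_LIMSEQ_real[OF lim[OF path_0] m0])
  have lim0: "(\<lambda>n. \<integral>\<omega>. G n (\<lambda>s. z + X s \<omega>) \<partial>M) \<longlonglongrightarrow> (\<integral>\<omega>. H (\<lambda>s. z + X s \<omega>) \<partial>M)" for z
    by (rule integral_dominated_convergence[where w = "\<lambda>_. 1"])
       (use absG m0 mH0 lim path_0 in auto)
  have mH: "(\<lambda>z. \<integral>\<omega>. H (\<lambda>s. z + X s \<omega>) \<partial>M) \<in> borel_measurable borel"
    by (rule borel_measurable_LIMSEQ_real[OF lim0 mG])
  show ?thesis
    unfolding markov_functional_def
  proof (intro conjI allI impI ballI mH)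
    fix t :: real and Y Z :: "'a \<Rightarrow> real"
    assume t: "t \<ge> 0" and Y: "Y \<in> borel_measurable (F t)" and Z: "Z \<in> borel_measurable (F t)"
      and Y01: "\<forall>\<omega>. 0 \<le> Y \<omega> \<and> Y \<omega> \<le> 1"
    note YM[measurable] = measurable_F_M[OF t Y] and ZM[measurable] = measurable_F_M[OF t Z]
    have mGt[measurable]: "(\<lambda>\<omega>. G n (restart t (Z \<omega>) \<omega>)) \<in> borel_measurable M" for n
      using mG2[OF t Y Z] Y01 by blast
    show mHt[measurable]: "(\<lambda>\<omega>. H (restart t (Z \<omega>) \<omega>)) \<in> borel_measurable M"
      by (rule borel_measurable_LIMSEQ_real[OF lim[OF path_t[OF t]] mGt])
    have le: "\<bar>Y \<omega> * v\<bar> \<le> 1" if "0 \<le> v" "v \<le> 1" for v \<omega>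
      using Y01 that by (auto simp: abs_mult intro!: mult_le_one)
    have "(\<lambda>n. \<integral>\<omega>. Y \<omega> * G n (restart t (Z \<omega>) \<omega>) \<partial>M) \<longlonglongrightarrow>
        (\<integral>\<omega>. Y \<omega> * H (restart t (Z \<omega>) \<omega>) \<partial>M)"
      by (rule integral_dominated_convergence[where w = "\<lambda>_. 1"])
         (use le G01 in \<open>auto intro!: tendsto_mult lim path_t t\<close>)
    moreover have "(\<lambda>n. \<integral>\<omega>. Y \<omega> * (\<integral>\<omega>'. G n (\<lambda>s. Z \<omega> + X s \<omega>') \<partial>M) \<partial>M) \<longlonglongrightarrow>
        (\<integral>\<omega>. Y \<omega> * (\<integral>\<omega>'. H (\<lambda>s. Z \<omega> + X s \<omega>') \<partial>M) \<partial>M)"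
    proof (rule integral_dominated_convergence[where w = "\<lambda>_. 1"])
      have b: "0 \<le> (\<integral>\<omega>'. G n (\<lambda>s. z + X s \<omega>') \<partial>M)" "(\<integral>\<omega>'. G n (\<lambda>s. z + X s \<omega>') \<partial>M) \<le> 1" for n z
      proof -
        show "0 \<le> (\<integral>\<omega>'. G n (\<lambda>s. z + X s \<omega>') \<partial>M)" using G01 by (intro integral_nonneg_AE) auto
        have "(\<integral>\<omega>'. G n (\<lambda>s. z + X s \<omega>') \<partial>M) \<le> (\<integral>\<omega>'. 1 \<partial>M)"
          using G01 m0 absG by (intro integral_mono integrable_bounded[where B = 1]) auto
        then show "(\<integral>\<omega>'. G n (\<lambda>s. z + X s \<omega>') \<partial>M) \<le> 1" by (simp add: prob_space)
      qed
      show "AE \<omega> in M. norm (Y \<omega> * (\<integral>\<omega>'. G n (\<lambda>s. Z \<omega> + X s \<omega>') \<partial>M)) \<le> 1" for n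
        using le b by auto
      note [measurable] = mG mH
      show "(\<lambda>\<omega>. Y \<omega> * (\<integral>\<omega>'. G n (\<lambda>s. Z \<omega> + X s \<omega>') \<partial>M)) \<in> borel_measurable M" for n
        using measurable_compose[OF ZM mG[of n]] by measurable
      show "(\<lambda>\<omega>. Y \<omega> * (\<integral>\<omega>'. H (\<lambda>s. Z \<omega> + X s \<omega>') \<partial>M)) \<in> borel_measurable M"
        using measurable_compose[OF ZM mH] by measurable
    qed (use lim0 in \<open>auto intro!: tendsto_mult\<close>)
    ultimately show "(\<integral>\<omega>. Y \<omega> * H (restart t (Z \<omega>) \<omega>) \<partial>M) =
        (\<integral>\<omega>. Y \<omega> * (\<integral>\<omega>'. H (\<lambda>s. Z \<omega> + X s \<omega>') \<partial>M) \<partial>M)"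
      using mG2[OF t Y Z] Y01 LIMSEQ_unique by fastforce
  qed
qed

text \<open>The exponential turns a Riemann sum into a product over grid times. The mesh is refined
  with the ramp fixed and only then is the ramp sharpened together with the horizon: for the
  discontinuous indicator the Riemann sums themselves need not converge.\<close>

lemma markov_functional_exp_below:
  assumes \<beta>: "\<beta> \<ge> 0"
  shows "markov_functional (\<lambda>p. exp (- \<beta> * below p))"
proof (rule markov_functional_limit)
  let ?A = "\<lambda>k p. \<integral>s. indicator {0..<real k} s * ramp k (p s) \<partial>lborel"
  fix k
  show "markov_functional (\<lambda>p. exp (- \<beta> * ?A k p))"
  proof (rule markov_functional_limit)
    let ?S = "\<lambda>n p. \<Sum>i<k * Suc n. ramp k (p (real (Suc i) / real (Suc n))) / real (Suc n)"
    have cr: "continuous_on UNIV (ramp k)" unfolding ramp_def by (intro continuous_intros)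
    have rm[measurable]: "ramp k \<in> borel_measurable borel" using cr by (rule borel_measurable_continuous_onI)
    fix n
    let ?g = "\<lambda>y. exp (- \<beta> * (ramp k y / real (Suc n)))"
    have "markov_functional (\<lambda>p. \<Prod>i<k * Suc n. ?g (p (real (Suc i) * (1 / real (Suc n)))))"
      using ramp_bounds[of k] \<beta> by (intro markov_functional_prod) (auto simp: mult_nonneg_nonneg)
    also have "(\<lambda>p. \<Prod>i<k * Suc n. ?g (p (real (Suc i) * (1 / real (Suc n))))) = (\<lambda>p. exp (- \<beta> * ?S n p))"
      by (simp add: exp_sum sum_distrib_left fun_eq_iff del: of_nat_Suc)
    finally show "markov_functional (\<lambda>p. exp (- \<beta> * ?S n p))" .
    show "0 \<le> exp (- \<beta> * ?S n p) \<and> exp (- \<beta> * ?S n p) \<le> 1" for p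
      using ramp_bounds[of k] \<beta> by (auto intro!: mult_nonneg_nonneg sum_nonneg divide_nonneg_nonneg)
  next
    fix p assume "transient p"
    then have p: "cadlag p" by (simp add: transient_def)
    have "continuous_on UNIV (ramp k)" unfolding ramp_def by (intro continuous_intros)
    moreover have "\<bar>ramp k y\<bar> \<le> 1" for y by (auto simp: ramp_def)
    ultimately show "(\<lambda>n. exp (- \<beta> * (\<Sum>i<k * Suc n. ramp k (p (real (Suc i) / real (Suc n))) / real (Suc n))))
        \<longlonglongrightarrow> exp (- \<beta> * ?A k p)"
      by (intro tendsto_intros riemann_tendsto[OF p])
  qed
  show "0 \<le> exp (- \<beta> * ?A k p) \<and> exp (- \<beta> * ?A k p) \<le> 1" for p
    using ramp_bounds[of k] \<beta> by (auto intro!: mult_nonneg_nonneg integral_nonneg_AE)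
next
  fix p assume "transient p"
  then show "(\<lambda>k. exp (- \<beta> * (\<integral>s. indicator {0..<real k} s * ramp k (p s) \<partial>lborel))) \<longlonglongrightarrow> exp (- \<beta> * below p)"
    by (intro tendsto_intros below_ramp_tendsto)
qed

end

section \<open>Kac's equation\<close>

abbreviation below_between :: "real \<Rightarrow> real \<Rightarrow> (real \<Rightarrow> real) \<Rightarrow> real" where
  "below_between a b p \<equiv> \<integral>s. indicator {a..<b} s * indicator {..<0} (p s) \<partial>lborel"

lemma below_split:
  assumes p: "transient p" and t: "t \<ge> 0"
  shows "integrable lborel (\<lambda>s. indicator {0..<t} s * indicator {..<0} (p s) :: real)"
    and "below p = below_between 0 t p + below (\<lambda>s. p (t + s))"
proof -
  note I = below_integrable[OF p]
  have c: "cadlag p" using p by (simp add: transient_def)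
  have m: "(\<lambda>s. indicator A s * indicator {..<0} (p s) :: real) \<in> borel_measurable lborel"
    if "A \<subseteq> {0..}" "A \<in> sets borel" for A
    using cadlag_indicator_measurable[OF c, of "indicator {..<0}" A] that by auto
  show i1: "integrable lborel (\<lambda>s. indicator {0..<t} s * indicator {..<0} (p s) :: real)"
    by (rule Bochner_Integration.integrable_bound[OF I m]) (auto split: split_indicator)
  have i2: "integrable lborel (\<lambda>s. indicator {t..} s * indicator {..<0} (p s) :: real)"
    using t by (intro Bochner_Integration.integrable_bound[OF I m]) (auto split: split_indicator)
  have "below p = (\<integral>s. indicator {0..<t} s * indicator {..<0} (p s) + indicator {t..} s * indicator {..<0} (p s) \<partial>lborel)"
    unfolding below_def using t by (intro Bochner_Integration.integral_cong) (auto split: split_indicator)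
  also have "\<dots> = below_between 0 t p +
      (\<integral>s. indicator {t..} s * indicator {..<0} (p s) \<partial>lborel)"
    using i1 i2 by simp
  also have "(\<integral>s. indicator {t..} s * indicator {..<0} (p s) \<partial>lborel) = below (\<lambda>s. p (t + s))"
    unfolding below_def
    by (subst lborel_integral_real_affine[where c = 1 and t = t])
       (auto intro!: Bochner_Integration.integral_cong split: split_indicator)
  finally show "below p = below_between 0 t p + below (\<lambda>s. p (t + s))" .
qed

text \<open>Additivity in time together with the bound \<open>t - s\<close>; the continuity and
  integral equations in time draw on these facts.\<close>

lemma below_tail:
  assumes p: "transient p" and s: "0 \<le> s" "s \<le> t"
  shows "integrable lborel (\<lambda>r. indicator {s..<t} r * indicator {..<0} (p r) :: real)"
    and "below (\<lambda>r. p (s + r)) = below_between s t p + below (\<lambda>r. p (t + r))"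
    and "(0 :: real) \<le> below_between s t p"
    and "below_between s t p \<le> t - s"
proof -
  have c: "cadlag p" using p by (simp add: transient_def)
  have t: "0 \<le> t" using s by simp
  have m: "(\<lambda>r. indicator {s..<t} r * indicator {..<0} (p r) :: real) \<in> borel_measurable lborel"
    using cadlag_indicator_measurable[OF c, of "indicator {..<0}" "{s..<t}"] s by (auto simp: subset_eq)
  show i: "integrable lborel (\<lambda>r. indicator {s..<t} r * indicator {..<0} (p r) :: real)"
    using s by (intro Bochner_Integration.integrable_bound[OF below_integrable[OF p] m]) (auto split: split_indicator)
  show "(0 :: real) \<le> below_between s t p"
    by (intro integral_nonneg_AE) auto
  have "below_between s t p \<le> (\<integral>r. (indicator {s..<t} r :: real) \<partial>lborel)"
    using s by (intro integral_mono i integrable_real_indicator) (auto split: split_indicator)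
  then show "below_between s t p \<le> t - s" using s by simp
  have "(\<integral>r. (indicator {0..<t} r :: real) * indicator {..<0} (p r) \<partial>lborel) =
      (\<integral>r. indicator {0..<s} r * indicator {..<0} (p r) + indicator {s..<t} r * indicator {..<0} (p r) \<partial>lborel)"
    using s by (intro Bochner_Integration.integral_cong) (auto split: split_indicator)
  also have "\<dots> = below_between 0 s p + below_between s t p"
    using below_split(1)[OF p s(1)] i by simp
  finally show "below (\<lambda>r. p (s + r)) = below_between s t p + below (\<lambda>r. p (t + r))"
    using below_split(2)[OF p s(1)] below_split(2)[OF p t] by simp
qed

text \<open>Cutting \<open>[0, t]\<close> into \<open>Suc n\<close> equal pieces gives a total
  change of at most \<open>C * t\<^sup>2 / Suc n\<close>. This replaces a derivative that need not
  exist everywhere.\<close>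

lemma quadratic_bound_imp_const:
  fixes q :: "real \<Rightarrow> real"
  assumes q: "\<And>s t. 0 \<le> s \<Longrightarrow> s \<le> t \<Longrightarrow> \<bar>q t - q s\<bar> \<le> C * (t - s)\<^sup>2" and t: "t \<ge> 0"
  shows "q t = q 0"
proof -
  have bound: "\<bar>q t - q 0\<bar> \<le> C * t\<^sup>2 * (1 / real (Suc n))" for n
  proof -
    let ?a = "\<lambda>i. real i * (t / real (Suc n))"
    have "q t - q 0 = (\<Sum>i<Suc n. q (?a (Suc i)) - q (?a i))"
      by (subst sum_lessThan_telescope) (simp del: of_nat_Suc)
    then have "\<bar>q t - q 0\<bar> \<le> (\<Sum>i<Suc n. \<bar>q (?a (Suc i)) - q (?a i)\<bar>)"
      by (simp only: sum_abs)
    also have "\<dots> \<le> (\<Sum>i<Suc n. C * (t / real (Suc n))\<^sup>2)"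
    proof (rule sum_mono)
      fix i
      have step: "real (Suc i) * c - real i * c = c" for c by (simp add: distrib_right)
      have "0 \<le> t / real (Suc n)" "0 \<le> ?a i" using t by simp_all
      then have "0 \<le> ?a i" "?a i \<le> ?a (Suc i)" using step[of "t / real (Suc n)"] by linarith+
      from q[OF this] show "\<bar>q (?a (Suc i)) - q (?a i)\<bar> \<le> C * (t / real (Suc n))\<^sup>2"
        unfolding step .
    qed
    also have "\<dots> = C * t\<^sup>2 * (1 / real (Suc n))"
      by (simp add: power2_eq_square del: of_nat_Suc)
    finally show ?thesis .
  qed
  have "(\<lambda>n. C * t\<^sup>2 * (1 / real (Suc n))) \<longlonglongrightarrow> C * t\<^sup>2 * 0"
    by (intro tendsto_intros LIMSEQ_Suc[OF lim_1_over_n])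
  then have "\<bar>q t - q 0\<bar> \<le> 0"
    using bound by (intro LIMSEQ_le_const) auto
  then show ?thesis by simp
qed

lemma below_time_right_cont:
  assumes p: "transient p" and s: "0 \<le> s" and y: "\<And>n. s \<le> y n" "y \<longlonglongrightarrow> s"
  shows "(\<lambda>n. below (\<lambda>r. p (y n + r))) \<longlonglongrightarrow> below (\<lambda>r. p (s + r))"
proof (rule tendsto_sandwich[OF _ _ _ tendsto_const])
  have "below (\<lambda>r. p (s + r)) - (y n - s) \<le> below (\<lambda>r. p (y n + r))"
    and "below (\<lambda>r. p (y n + r)) \<le> below (\<lambda>r. p (s + r))" for n
    using below_tail(2-4)[OF p s y(1)[of n]] by linarith+
  then show "eventually (\<lambda>n. below (\<lambda>r. p (s + r)) - (y n - s) \<le> below (\<lambda>r. p (y n + r))) sequentially"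
    and "eventually (\<lambda>n. below (\<lambda>r. p (y n + r)) \<le> below (\<lambda>r. p (s + r))) sequentially"
    by simp_all
  have "(\<lambda>n. below (\<lambda>r. p (s + r)) - (y n - s)) \<longlonglongrightarrow> below (\<lambda>r. p (s + r)) - (s - s)"
    using y(2) by (intro tendsto_intros)
  then show "(\<lambda>n. below (\<lambda>r. p (s + r)) - (y n - s)) \<longlonglongrightarrow> below (\<lambda>r. p (s + r))" by simp
qed

lemma exp_below_mono:
  assumes p: "transient p" and \<beta>: "\<beta> \<ge> 0" and s: "0 \<le> s" "s \<le> t"
  shows "exp (- \<beta> * below (\<lambda>r. p (s + r))) \<le> exp (- \<beta> * below (\<lambda>r. p (t + r)))"
  using below_tail(2,3)[OF p s] \<beta> by (simp add: mult_left_mono)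

text \<open>The fundamental theorem of calculus for the Lipschitz function
  \<open>s \<mapsto> exp (- \<beta> * below (\<lambda>r. p (s + r)))\<close>, whose derivative need not exist everywhere.\<close>

lemma exp_below_ftc:
  assumes p: "transient p" and \<beta>: "\<beta> \<ge> 0" and t: "t \<ge> 0"
  shows "exp (- \<beta> * below (\<lambda>r. p (t + r))) = exp (- \<beta> * below p) +
    \<beta> * (\<integral>s. indicator {0..<t} s * (indicator {..<0} (p s) * exp (- \<beta> * below (\<lambda>r. p (s + r)))) \<partial>lborel)"
proof -
  define e where "e s = exp (- \<beta> * below (\<lambda>r. p (s + r)))" for s
  define v :: "real \<Rightarrow> real" where "v s = indicator {..<0} (p s)" for s
  define q where "q t = e t - \<beta> * (\<integral>s. indicator {0..<t} s * (v s * e s) \<partial>lborel)" for t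
  have c: "cadlag p" using p by (simp add: transient_def)
  have e_mono: "e s \<le> e t" if "0 \<le> s" "s \<le> t" for s t
    unfolding e_def by (rule exp_below_mono[OF p \<beta> that])
  have e01: "0 \<le> e s" "e s \<le> 1" for s
    using below_nonneg \<beta> by (auto simp: e_def)
  have em: "(\<lambda>s. e (max 0 s)) \<in> borel_measurable borel"
    by (rule borel_measurable_mono) (auto simp: mono_def intro!: e_mono)
  have vem: "(\<lambda>s. indicator {a..<b} s * (v s * e s)) \<in> borel_measurable lborel" if "0 \<le> a" for a b
  proof -
    have [measurable]: "(\<lambda>s. indicator {a..<b} s * v s) \<in> borel_measurable borel"
      unfolding v_def using that c by (intro cadlag_indicator_measurable) auto
    note em[measurable]
    have "(\<lambda>s. (indicator {a..<b} s * v s) * e (max 0 s)) \<in> borel_measurable borel" by measurable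
    also have "(\<lambda>s. (indicator {a..<b} s * v s) * e (max 0 s)) = (\<lambda>s. indicator {a..<b} s * (v s * e s))"
      using that by (auto simp: fun_eq_iff max_def split: split_indicator)
    finally show ?thesis by simp
  qed
  have vei: "integrable lborel (\<lambda>s. indicator {a..<b} s * (v s * e s))" if "0 \<le> a" "a \<le> b" for a b
    by (rule Bochner_Integration.integrable_bound[OF below_tail(1)[OF p that] vem[OF that(1)]])
       (use e01 in \<open>auto simp: v_def abs_mult split: split_indicator\<close>)
  \<comment> \<open>Both the increment of \<open>e\<close> and \<beta> times the integral lie
    between \<open>e s * (\<beta> * U)\<close> and \<open>e t * (\<beta> * U)\<close>. Their
    difference is therefore at most \<open>(\<beta> * U) * (e t - e s)\<close>, and
    \<open>e t - e s\<close> is itself at most \<open>\<beta> * U\<close>.\<close>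
  have "\<bar>q t - q s\<bar> \<le> \<beta>\<^sup>2 * (t - s)\<^sup>2" if st: "0 \<le> s" "s \<le> t" for s t
  proof -
    define U where "U = (\<integral>r. indicator {s..<t} r * v r \<partial>lborel)"
    note U = below_tail[OF p st, folded v_def, folded U_def]
    have et: "e s = e t * exp (- \<beta> * U)" unfolding e_def U(2) by (simp add: algebra_simps flip: exp_add)
    have U1: "0 \<le> \<beta> * U" using U(3) \<beta> by simp
    have inc1: "e t - e s \<le> e t * (\<beta> * U)"
    proof -
      have "1 - exp (- \<beta> * U) \<le> \<beta> * U" using exp_ge_add_one_self[of "- \<beta> * U"] by linarith
      from mult_left_mono[OF this e01(1)[of t]] show ?thesis by (simp add: et right_diff_distrib)
    qed
    have et': "e t = e s * exp (\<beta> * U)" unfolding et by (simp add: mult.assoc flip: exp_add)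
    have inc2: "e t - e s \<ge> e s * (\<beta> * U)"
    proof -
      have "\<beta> * U \<le> exp (\<beta> * U) - 1" using exp_ge_add_one_self[of "\<beta> * U"] by linarith
      from mult_left_mono[OF this e01(1)[of s]] show ?thesis by (simp add: et' right_diff_distrib)
    qed
    let ?J = "\<integral>r. indicator {s..<t} r * (v r * e r) \<partial>lborel"
    have J1: "?J \<le> e t * U"
    proof -
      have "?J \<le> (\<integral>r. e t * (indicator {s..<t} r * v r) \<partial>lborel)"
        using vei[OF st] U(1) e_mono st
        by (intro integral_mono) (auto simp: v_def split: split_indicator)
      then show ?thesis by (simp add: U_def)
    qed
    have J2: "e s * U \<le> ?J"
    proof -
      have "(\<integral>r. e s * (indicator {s..<t} r * v r) \<partial>lborel) \<le> ?J"
        using vei[OF st] U(1) e_mono st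
        by (intro integral_mono) (auto simp: v_def split: split_indicator)
      then show ?thesis by (simp add: U_def)
    qed
    have "(\<integral>r. indicator {0..<t} r * (v r * e r) \<partial>lborel) =
        (\<integral>r. indicator {0..<s} r * (v r * e r) + indicator {s..<t} r * (v r * e r) \<partial>lborel)"
      using st by (intro Bochner_Integration.integral_cong) (auto split: split_indicator)
    also have "\<dots> = (\<integral>r. indicator {0..<s} r * (v r * e r) \<partial>lborel) + ?J"
      using vei[of 0 s] vei[OF st] st by simp
    finally have qq: "q t - q s = (e t - e s) - \<beta> * ?J" by (simp add: q_def algebra_simps)
    have "\<beta> * ?J \<le> \<beta> * (e t * U)" "\<beta> * (e s * U) \<le> \<beta> * ?J"
      using J1 J2 \<beta> by (auto intro: mult_left_mono)
    then have "\<bar>q t - q s\<bar> \<le> (\<beta> * U) * (e t - e s)"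
      unfolding qq using inc1 inc2 by (simp add: algebra_simps abs_le_iff)
    also have "\<dots> \<le> (\<beta> * U) * (\<beta> * U)"
      using inc1 e01[of t] U1 mult_right_mono[of "e t" 1 "\<beta> * U"] by (intro mult_left_mono) auto
    also have "\<dots> = (\<beta> * U)\<^sup>2" by (simp add: power2_eq_square)
    also have "\<dots> \<le> (\<beta> * (t - s))\<^sup>2" using U1 U(4) \<beta> by (intro power_mono mult_left_mono) auto
    finally show ?thesis by (simp add: power_mult_distrib)
  qed
  then have "q t = q 0" using t by (rule quadratic_bound_imp_const)
  then show ?thesis by (simp add: q_def e_def v_def)
qed

section \<open>Dependence of the time below zero on the starting level\<close>

lemma below_antimono:
  assumes "transient p" "x \<le> y"
  shows "below (\<lambda>s. y + p s) \<le> below (\<lambda>s. x + p s)"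
  unfolding below_def
  using below_integrable[OF transient_shift[OF assms(1), of 0 x]] below_integrable[OF transient_shift[OF assms(1), of 0 y]] assms(2)
  by (intro integral_mono) (auto split: split_indicator)

text \<open>The indicator of \<open>{..<0}\<close> is right-continuous. From the left, convergence
  fails at times with \<open>x + p s = 0\<close>, which is why everything later is only
  right-continuous in the starting point.\<close>

lemma below_right_cont:
  assumes p: "transient p" and y: "\<And>n. y n > x" "y \<longlonglongrightarrow> x"
  shows "(\<lambda>n. below (\<lambda>s. y n + p s)) \<longlonglongrightarrow> below (\<lambda>s. x + p s)"
  unfolding below_def
proof (rule integral_dominated_convergence)
  have I: "integrable lborel (\<lambda>s. indicator {0..} s * indicator {..<0} (x + p s) :: real)" for x
    using below_integrable[OF transient_shift[OF p, of 0 x]] by simp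
  show "integrable lborel (\<lambda>s. indicator {0..} s * indicator {..<0} (x + p s) :: real)" by (rule I)
  show "(\<lambda>s. indicator {0..} s * indicator {..<0} (x + p s) :: real) \<in> borel_measurable lborel"
    "(\<lambda>s. indicator {0..} s * indicator {..<0} (y n + p s) :: real) \<in> borel_measurable lborel" for n
    using I by (auto intro: borel_measurable_integrable)
  show "AE s in lborel. norm (indicator {0..} s * indicator {..<0} (y n + p s) :: real) \<le> indicator {0..} s * indicator {..<0} (x + p s)" for n
    using y(1)[of n] by (intro AE_I2) (auto split: split_indicator)
  show "AE s in lborel. (\<lambda>n. indicator {0..} s * indicator {..<0} (y n + p s)) \<longlonglongrightarrow> (indicator {0..} s * indicator {..<0} (x + p s) :: real)"
  proof (intro AE_I2 tendsto_mult tendsto_const tendsto_eventually)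
    fix s
    show "eventually (\<lambda>n. indicator {..<0} (y n + p s) = (indicator {..<0} (x + p s) :: real)) sequentially"
    proof (cases "x + p s < 0")
      case True
      then have "eventually (\<lambda>n. y n < - p s) sequentially" using y(2) by (intro order_tendstoD(2)) auto
      then show ?thesis by eventually_elim (use True in auto)
    next
      case False
      then have "\<not> y n + p s < 0" for n using y(1)[of n] by linarith
      then show ?thesis using False by simp
    qed
  qed
qed

lemma below_at_infinity:
  assumes p: "transient p"
  shows "(\<lambda>n. below (\<lambda>s. real n + p s)) \<longlonglongrightarrow> 0"
proof -
  have I: "integrable lborel (\<lambda>s. indicator {0..} s * indicator {..<0} (x + p s) :: real)" for x
    using below_integrable[OF transient_shift[OF p, of 0 x]] by simp
  have "(\<lambda>n. below (\<lambda>s. real n + p s)) \<longlonglongrightarrow> (\<integral>s. 0 \<partial>(lborel :: real measure))"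
    unfolding below_def
  proof (rule integral_dominated_convergence)
    show "integrable lborel (\<lambda>s. indicator {0..} s * indicator {..<0} (0 + p s) :: real)" by (rule I)
    show "(\<lambda>s. indicator {0..} s * indicator {..<0} (real n + p s) :: real) \<in> borel_measurable lborel" for n
      using I by (auto intro: borel_measurable_integrable)
    show "AE s in lborel. norm (indicator {0..} s * indicator {..<0} (real n + p s) :: real) \<le> indicator {0..} s * indicator {..<0} (0 + p s)" for n
      by (intro AE_I2) (auto split: split_indicator)
    show "AE s in lborel. (\<lambda>n. indicator {0..} s * indicator {..<0} (real n + p s)) \<longlonglongrightarrow> (0 :: real)"
    proof (intro AE_I2 tendsto_eventually)
      fix s
      obtain N where "- p s < real N" using reals_Archimedean2 by blast
      then show "eventually (\<lambda>n. indicator {0..} s * indicator {..<0} (real n + p s) = (0 :: real)) sequentially"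
        by (intro eventually_sequentiallyI[of N]) auto
    qed
  qed simp
  then show ?thesis by simp
qed

context regular_levy
begin

text \<open>With time replaced by its grid point only countably many random variables are involved;
  the joint map is the limit of these approximations.\<close>

lemma joint_measurable:
  fixes h :: "real \<Rightarrow> 'a \<Rightarrow> real"
  assumes h: "\<And>s. s \<ge> 0 \<Longrightarrow> h s \<in> borel_measurable M"
    and lim: "\<And>s \<omega>. s \<ge> 0 \<Longrightarrow> \<omega> \<in> space M \<Longrightarrow> (\<lambda>n. h (grid n s) \<omega>) \<longlonglongrightarrow> h s \<omega>"
  shows "(\<lambda>(s, \<omega>). h (max 0 s) \<omega>) \<in> borel_measurable (borel \<Otimes>\<^sub>M M)"
proof (rule borel_measurable_LIMSEQ_real)
  fix n
  let ?u = "\<lambda>i::int. max 0 ((of_int i + 1) / real (Suc n))"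
  have "(\<lambda>x. h (?u i) (snd x)) \<in> borel_measurable (borel \<Otimes>\<^sub>M M)" for i
    by (rule measurable_compose[OF measurable_snd h]) simp
  moreover have "(\<lambda>x. \<lfloor>max 0 (fst x) * real (Suc n)\<rfloor>) \<in> measurable (borel \<Otimes>\<^sub>M M) (count_space UNIV)"
    by measurable
  ultimately have "(\<lambda>x. h (?u \<lfloor>max 0 (fst x) * real (Suc n)\<rfloor>) (snd x)) \<in> borel_measurable (borel \<Otimes>\<^sub>M M)"
    by (rule measurable_compose_countable)
  moreover have "?u \<lfloor>max 0 s * real (Suc n)\<rfloor> = grid n (max 0 s)" for s
    using grid_gt[of "max 0 s" n] by (simp add: grid_def)
  ultimately show "(\<lambda>(s, \<omega>). h (grid n (max 0 s)) \<omega>) \<in> borel_measurable (borel \<Otimes>\<^sub>M M)"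
    by (simp add: split_beta')
next
  fix x :: "real \<times> 'a" assume "x \<in> space (borel \<Otimes>\<^sub>M M)"
  then show "(\<lambda>n. case x of (s, \<omega>) \<Rightarrow> h (grid n (max 0 s)) \<omega>) \<longlonglongrightarrow> (case x of (s, \<omega>) \<Rightarrow> h (max 0 s) \<omega>)"
    by (auto simp: space_pair_measure intro!: lim)
qed

lemma path_shift: "t \<ge> 0 \<Longrightarrow> \<omega> \<in> space M \<Longrightarrow> transient (\<lambda>s. x + X (t + s) \<omega>)"
  by (rule transient_shift[OF paths])

lemma path_shift_0: "\<omega> \<in> space M \<Longrightarrow> transient (\<lambda>s. x + X s \<omega>)"
  using path_shift[of 0 \<omega> x] by simp

lemma X_joint: "(\<lambda>(s, \<omega>). X (max 0 s) \<omega>) \<in> borel_measurable (borel \<Otimes>\<^sub>M M)"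
  by (rule joint_measurable[OF X_measurable]) (use paths in \<open>auto intro!: cadlag_grid simp: transient_def\<close>)

text \<open>Discounting only the part of the path after time \<open>t\<close>. Its conditional
  expectation given \<open>F t\<close> is \<open>transform \<beta> (x + X t \<omega>)\<close>, where
  \<open>transform \<beta>\<close> is the function \<open>f\<close> of the overview.\<close>

definition future :: "real \<Rightarrow> real \<Rightarrow> real \<Rightarrow> 'a \<Rightarrow> real" where
  "future \<beta> t x \<omega> = exp (- \<beta> * below (\<lambda>s. x + X (t + s) \<omega>))"

definition transform :: "real \<Rightarrow> real \<Rightarrow> real" where
  "transform \<beta> x = (\<integral>\<omega>. exp (- \<beta> * below (\<lambda>s. x + X s \<omega>)) \<partial>M)"

lemma future_bounds: "\<beta> \<ge> 0 \<Longrightarrow> 0 < future \<beta> t x \<omega>" "\<beta> \<ge> 0 \<Longrightarrow> future \<beta> t x \<omega> \<le> 1"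
  using below_nonneg by (auto simp: future_def)

lemma future_right_cont:
  assumes "s \<ge> 0" "\<omega> \<in> space M" "\<And>n. s \<le> y n" "y \<longlonglongrightarrow> s"
  shows "(\<lambda>n. future \<beta> (y n) x \<omega>) \<longlonglongrightarrow> future \<beta> s x \<omega>"
  unfolding future_def
  by (intro tendsto_intros below_time_right_cont[OF path_shift_0[OF assms(2)] assms(1,3,4)])

lemma markov_functionalD:
  assumes "markov_functional G" "t \<ge> 0" "Y \<in> borel_measurable (F t)" "Z \<in> borel_measurable (F t)"
    and "\<And>\<omega>. 0 \<le> Y \<omega> \<and> Y \<omega> \<le> 1"
  shows "(\<lambda>\<omega>. G (restart t (Z \<omega>) \<omega>)) \<in> borel_measurable M"
    and "(\<integral>\<omega>. Y \<omega> * G (restart t (Z \<omega>) \<omega>) \<partial>M) =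
      (\<integral>\<omega>. Y \<omega> * (\<integral>\<omega>'. G (\<lambda>s. Z \<omega> + X s \<omega>') \<partial>M) \<partial>M)"
  using assms unfolding markov_functional_def by blast+

lemma future_measurable:
  assumes "\<beta> \<ge> 0" "t \<ge> 0"
  shows "future \<beta> t x \<in> borel_measurable M"
proof -
  have "(\<lambda>\<omega>. x + X t \<omega>) \<in> borel_measurable (F t)" using adapted[OF assms(2)] by measurable
  from markov_functionalD(1)[OF markov_functional_exp_below[OF assms(1)] assms(2) _ this, of "\<lambda>_. 0"]
  show ?thesis by (simp add: future_def[abs_def])
qed

lemma transform_measurable: "\<beta> \<ge> 0 \<Longrightarrow> transform \<beta> \<in> borel_measurable borel"
  using markov_functional_exp_below unfolding markov_functional_def transform_def[abs_def] by blast

lemma future_markov: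
  assumes \<beta>: "\<beta> \<ge> 0" and t: "t \<ge> 0" and Y: "Y \<in> borel_measurable (F t)" "\<And>\<omega>. 0 \<le> Y \<omega> \<and> Y \<omega> \<le> 1"
  shows "(\<integral>\<omega>. Y \<omega> * future \<beta> t x \<omega> \<partial>M) = (\<integral>\<omega>. Y \<omega> * transform \<beta> (x + X t \<omega>) \<partial>M)"
proof -
  have "(\<lambda>\<omega>. x + X t \<omega>) \<in> borel_measurable (F t)" using adapted[OF t] by measurable
  then have "(\<integral>\<omega>. Y \<omega> * exp (- \<beta> * below (restart t (x + X t \<omega>) \<omega>)) \<partial>M) =
      (\<integral>\<omega>. Y \<omega> * (\<integral>\<omega>'. exp (- \<beta> * below (\<lambda>s. (x + X t \<omega>) + X s \<omega>')) \<partial>M) \<partial>M)"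
    by (intro markov_functionalD(2)[OF markov_functional_exp_below[OF \<beta>] t Y(1)] Y(2))
  then show ?thesis by (simp add: future_def transform_def)
qed

lemma future_0: "future \<beta> 0 x \<omega> = exp (- \<beta> * below (\<lambda>s. x + X s \<omega>))"
  by (simp add: future_def)

lemma transform_eq_future: "transform \<beta> x = (\<integral>\<omega>. future \<beta> 0 x \<omega> \<partial>M)"
  by (simp add: transform_def future_0)

lemma future_integrable: "\<beta> \<ge> 0 \<Longrightarrow> t \<ge> 0 \<Longrightarrow> integrable M (future \<beta> t x)"
  by (rule integrable_bounded[where B = 1]) (use future_measurable future_bounds[of \<beta> t x] in \<open>auto simp: abs_of_pos\<close>)

lemma transform_pos:
  assumes "\<beta> \<ge> 0"
  shows "0 < transform \<beta> x"
proof -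
  have "0 \<le> transform \<beta> x" unfolding transform_def by (intro integral_nonneg_AE) auto
  moreover have "transform \<beta> x \<noteq> 0"
  proof
    assume "transform \<beta> x = 0"
    then have "AE \<omega> in M. future \<beta> 0 x \<omega> = 0"
      using integral_nonneg_eq_0_iff_AE[OF future_integrable[OF assms, of 0 x]] future_bounds(1)[OF assms]
      by (simp add: transform_eq_future less_imp_le)
    then have "AE \<omega> in M. False" by eventually_elim (simp add: future_def)
    then show False by simp
  qed
  ultimately show ?thesis by simp
qed

lemma transform_le_1: "\<beta> \<ge> 0 \<Longrightarrow> transform \<beta> x \<le> 1"
  using integral_mono[OF future_integrable integrable_const, of \<beta> 0 x 1] future_bounds(2)[of \<beta> 0 x]
  by (simp add: transform_eq_future prob_space)

lemma transform_mono:
  assumes "\<beta> \<ge> 0" "x \<le> y"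
  shows "transform \<beta> x \<le> transform \<beta> y"
  unfolding transform_eq_future
  using assms below_antimono[OF paths assms(2)]
  by (intro integral_mono future_integrable) (auto simp: future_0 intro!: mult_left_mono)

lemma transform_right_cont_seq:
  assumes \<beta>: "\<beta> \<ge> 0" and y: "\<And>n. y n > x" "y \<longlonglongrightarrow> x"
  shows "(\<lambda>n. transform \<beta> (y n)) \<longlonglongrightarrow> transform \<beta> x"
  unfolding transform_eq_future
proof (rule integral_dominated_convergence[where w = "\<lambda>_. 1"])
  show "AE \<omega> in M. (\<lambda>n. future \<beta> 0 (y n) \<omega>) \<longlonglongrightarrow> future \<beta> 0 x \<omega>"
    unfolding future_0 by (intro AE_I2 tendsto_intros below_right_cont paths y)
  show "AE \<omega> in M. norm (future \<beta> 0 (y n) \<omega>) \<le> 1" for n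
    using future_bounds[OF \<beta>, of 0 "y n"] by (auto simp: abs_of_pos)
qed (use \<beta> future_measurable in auto)

lemma transform_right_cont:
  assumes "\<beta> \<ge> 0"
  shows "(transform \<beta> \<longlongrightarrow> transform \<beta> x) (at_right x)"
  by (rule tendsto_at_right_sequentially[of x "x + 1"]) (use assms transform_right_cont_seq in auto)

lemma transform_at_infinity:
  assumes \<beta>: "\<beta> \<ge> 0"
  shows "(\<lambda>n. transform \<beta> (real n)) \<longlonglongrightarrow> 1"
proof -
  have "(\<lambda>n. transform \<beta> (real n)) \<longlonglongrightarrow> (\<integral>\<omega>. 1 \<partial>M)"
    unfolding transform_eq_future
  proof (rule integral_dominated_convergence[where w = "\<lambda>_. 1"])
    have "(\<lambda>n. future \<beta> 0 (real n) \<omega>) \<longlonglongrightarrow> exp (- \<beta> * 0)" if "\<omega> \<in> space M" for \<omega>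
      unfolding future_0 by (intro tendsto_intros below_at_infinity paths that)
    then show "AE \<omega> in M. (\<lambda>n. future \<beta> 0 (real n) \<omega>) \<longlonglongrightarrow> 1" by auto
    show "AE \<omega> in M. norm (future \<beta> 0 (real n) \<omega>) \<le> 1" for n
      using future_bounds[OF \<beta>, of 0 "real n"] by (auto simp: abs_of_pos)
  qed (use \<beta> future_measurable in auto)
  then show ?thesis by (simp add: prob_space)
qed

text \<open>The expectation of \<open>exp_below_ftc\<close>. Inside the time integral the indicator
  of \<open>x + X s < 0\<close> is \<open>F s\<close>-measurable, so it serves as the weight in the
  Markov property at time \<open>s\<close>, after Fubini has exchanged time and expectation.\<close>

lemma transform_kac:
  assumes \<beta>: "\<beta> \<ge> 0" and t: "t \<ge> 0"
  shows "integrable lborel (\<lambda>s. indicator {0..<t} s * (\<integral>\<omega>. indicator {..<0} (x + X s \<omega>) * transform \<beta> (x + X s \<omega>) \<partial>M))"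
    and "(\<integral>\<omega>. transform \<beta> (x + X t \<omega>) \<partial>M) = transform \<beta> x +
    \<beta> * (\<integral>s. indicator {0..<t} s * (\<integral>\<omega>. indicator {..<0} (x + X s \<omega>) * transform \<beta> (x + X s \<omega>) \<partial>M) \<partial>lborel)"
proof -
  let ?e = "\<lambda>s \<omega>. future \<beta> s x \<omega>"
  let ?v = "\<lambda>s \<omega>. indicator {..<0} (x + X s \<omega>) :: real"
  have e_joint: "(\<lambda>(s, \<omega>). ?e (max 0 s) \<omega>) \<in> borel_measurable (borel \<Otimes>\<^sub>M M)"
  proof (rule joint_measurable[OF future_measurable[OF \<beta>]])
    fix s :: real and \<omega> assume s: "s \<ge> 0" and \<omega>: "\<omega> \<in> space M"
    have "(\<lambda>n. grid n s) \<longlonglongrightarrow> s" using grid_at_right by (rule filterlim_mono) (auto simp: at_within_le_nhds)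
    then show "(\<lambda>n. ?e (grid n s) \<omega>) \<longlonglongrightarrow> ?e s \<omega>"
      by (rule future_right_cont[OF s \<omega> less_imp_le[OF grid_gt]])
  qed
  interpret P: pair_sigma_finite lborel M ..
  let ?k = "\<lambda>s \<omega>. indicator {0..<t} s * (?v s \<omega> * ?e s \<omega>)"
  note [measurable] = X_joint e_joint
  \<comment> \<open>Joint measurability is available for clamped times; the indicator of
    \<open>{0..<t}\<close> makes the clamp invisible.\<close>
  have "(\<lambda>(s, \<omega>). indicator {0..<t} s * (?v (max 0 s) \<omega> * ?e (max 0 s) \<omega>)) \<in> borel_measurable (lborel \<Otimes>\<^sub>M M)"
    by measurable
  also have "(\<lambda>(s, \<omega>). indicator {0..<t} s * (?v (max 0 s) \<omega> * ?e (max 0 s) \<omega>)) = (\<lambda>(s, \<omega>). ?k s \<omega>)"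
    by (auto simp: fun_eq_iff max_def split: split_indicator)
  finally have km: "(\<lambda>(s, \<omega>). ?k s \<omega>) \<in> borel_measurable (lborel \<Otimes>\<^sub>M M)" .
  have k_int: "integrable (lborel \<Otimes>\<^sub>M M) (\<lambda>(s, \<omega>). ?k s \<omega>)"
  proof (rule Bochner_Integration.integrable_bound[OF _ km])
    have "integrable (lborel \<Otimes>\<^sub>M M) (indicator ({0..<t} \<times> space M) :: _ \<Rightarrow> real)"
    proof (rule integrable_real_indicator)
      show "{0..<t} \<times> space M \<in> sets (lborel \<Otimes>\<^sub>M M)" by (intro pair_measureI) auto
      show "emeasure (lborel \<Otimes>\<^sub>M M) ({0..<t} \<times> space M) < \<infinity>"
        using t by (subst emeasure_pair_measure_Times) (auto simp: emeasure_space_1)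
    qed
    then show "integrable (lborel \<Otimes>\<^sub>M M) (indicator ({0..<t} \<times> space M) :: _ \<Rightarrow> real)" .
    show "AE z in lborel \<Otimes>\<^sub>M M. norm (case z of (s, \<omega>) \<Rightarrow> ?k s \<omega>) \<le> norm (indicator ({0..<t} \<times> space M) z :: real)"
      using future_bounds[OF \<beta>, of _ x] by (intro AE_I2) (auto simp: space_pair_measure indicator_def abs_of_pos)
  qed
  have markov: "(\<integral>\<omega>. ?k s \<omega> \<partial>M) = indicator {0..<t} s * (\<integral>\<omega>. ?v s \<omega> * transform \<beta> (x + X s \<omega>) \<partial>M)" for s
  proof (cases "s \<in> {0..<t}")
    case True
    then have s: "s \<ge> 0" by simp
    note [measurable] = adapted[OF s]
    have "(\<integral>\<omega>. ?v s \<omega> * ?e s \<omega> \<partial>M) = (\<integral>\<omega>. ?v s \<omega> * transform \<beta> (x + X s \<omega>) \<partial>M)"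
    proof (rule future_markov[OF \<beta> s])
      show "?v s \<in> borel_measurable (F s)" by measurable
    qed (auto split: split_indicator)
    then show ?thesis using True by simp
  qed simp
  show "integrable lborel (\<lambda>s. indicator {0..<t} s * (\<integral>\<omega>. ?v s \<omega> * transform \<beta> (x + X s \<omega>) \<partial>M))"
    using P.integrable_fst[OF k_int] by (simp only: prod.case markov)
  have "(\<integral>\<omega>. transform \<beta> (x + X t \<omega>) \<partial>M) = (\<integral>\<omega>. ?e t \<omega> \<partial>M)"
    using future_markov[OF \<beta> t, of "\<lambda>_. 1" x] by simp
  also have "\<dots> = (\<integral>\<omega>. ?e 0 \<omega> + \<beta> * (\<integral>s. ?k s \<omega> \<partial>lborel) \<partial>M)"
    using exp_below_ftc[OF path_shift_0 \<beta> t]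
    by (intro Bochner_Integration.integral_cong) (auto simp: future_def)
  also have "\<dots> = (\<integral>\<omega>. ?e 0 \<omega> \<partial>M) + \<beta> * (\<integral>\<omega>. \<integral>s. ?k s \<omega> \<partial>lborel \<partial>M)"
    using future_integrable[OF \<beta>, of 0 x] P.integrable_snd[OF k_int] by simp
  also have "(\<integral>\<omega>. \<integral>s. ?k s \<omega> \<partial>lborel \<partial>M) = (\<integral>s. \<integral>\<omega>. ?k s \<omega> \<partial>M \<partial>lborel)"
    by (rule P.Fubini_integral[OF k_int])
  finally show "(\<integral>\<omega>. transform \<beta> (x + X t \<omega>) \<partial>M) = transform \<beta> x +
    \<beta> * (\<integral>s. indicator {0..<t} s * (\<integral>\<omega>. ?v s \<omega> * transform \<beta> (x + X s \<omega>) \<partial>M) \<partial>lborel)"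
    by (simp only: markov transform_eq_future)
qed

end

section \<open>First passage upwards\<close>

text \<open>Cauchy's functional equation under monotonicity: \<open>a\<close> is enclosed between
  neighbouring multiples of \<open>1 / real (Suc n)\<close>, where additivity already determines the
  value.\<close>

lemma additive_mono_linear:
  fixes G :: "real \<Rightarrow> real"
  assumes add: "\<And>a b. a > 0 \<Longrightarrow> b > 0 \<Longrightarrow> G (a + b) = G a + G b"
    and mono: "\<And>a b. 0 < a \<Longrightarrow> a \<le> b \<Longrightarrow> G a \<le> G b" and a: "a > 0"
  shows "G a = a * G 1"
proof -
  have mult: "G (real (Suc n) * b) = real (Suc n) * G b" if b: "b > 0" for n b
  proof (induction n)
    case (Suc n)
    have "G (real (Suc (Suc n)) * b) = G (real (Suc n) * b + b)" by (simp add: algebra_simps)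
    also have "\<dots> = G (real (Suc n) * b) + G b" using b by (intro add) auto
    finally show ?case using Suc by (simp add: algebra_simps)
  qed simp
  have G1: "G 1 \<ge> 0" using add[of 1 1] mono[of 1 2] by simp
  have bound: "\<bar>G a - a * G 1\<bar> \<le> G 1 * (1 / real (Suc n))" if n: "real (Suc n) * a \<ge> 1" for n
  proof -
    \<comment> \<open>\<open>Suc m\<close> is the integer part of \<open>real (Suc n) * a\<close>,
      positive by the assumption on \<open>n\<close>. Multiples are indexed by \<open>Suc\<close>
      because \<open>G\<close> is controlled at positive arguments only.\<close>
    define m where "m = nat \<lfloor>real (Suc n) * a\<rfloor> - 1"
    have m: "real (Suc m) = of_int \<lfloor>real (Suc n) * a\<rfloor>"
      using n by (simp add: m_def of_nat_diff le_nat_iff del: of_nat_Suc)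
    have m1: "real (Suc m) \<le> real (Suc n) * a" "real (Suc n) * a \<le> real (Suc (Suc m))"
      unfolding of_nat_Suc[of "Suc m"] m by linarith+
    have "real (Suc m) * G 1 \<le> real (Suc n) * G a"
      using mono[OF _ m1(1)] mult[of 1 m] mult[OF a, of n] by simp
    moreover have "real (Suc n) * G a \<le> real (Suc (Suc m)) * G 1"
      using mono[OF _ m1(2)] mult[of 1 "Suc m"] mult[OF a, of n] a by simp
    moreover have "real (Suc m) * G 1 \<le> real (Suc n) * a * G 1" "real (Suc n) * a * G 1 \<le> real (Suc (Suc m)) * G 1"
      using m1 G1 by (auto intro: mult_right_mono)
    moreover have "real (Suc (Suc m)) * G 1 = real (Suc m) * G 1 + G 1" by (simp add: algebra_simps)
    ultimately have "\<bar>real (Suc n) * G a - real (Suc n) * a * G 1\<bar> \<le> G 1" by linarith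
    then have "real (Suc n) * \<bar>G a - a * G 1\<bar> \<le> G 1"
      by (simp only: mult.assoc right_diff_distrib[symmetric] abs_mult abs_of_nat)
    then show ?thesis by (simp add: field_simps)
  qed
  obtain N where N: "1 < real N * a" using reals_Archimedean3[OF a] by blast
  have "(\<lambda>n. G 1 * (1 / real (Suc n))) \<longlonglongrightarrow> G 1 * 0"
    by (intro tendsto_intros LIMSEQ_Suc[OF lim_1_over_n])
  moreover have "\<exists>N. \<forall>n\<ge>N. \<bar>G a - a * G 1\<bar> \<le> G 1 * (1 / real (Suc n))"
  proof (intro exI allI impI bound)
    fix n assume "n \<ge> N"
    then have "real N * a \<le> real (Suc n) * a" using a by (intro mult_right_mono) auto
    then show "1 \<le> real (Suc n) * a" using N by linarith
  qed
  ultimately have "\<bar>G a - a * G 1\<bar> \<le> G 1 * 0" by (rule LIMSEQ_le_const)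
  then show ?thesis by simp
qed

lemma cadlag_tendsto_seq:
  assumes "cadlag p" "s \<ge> 0" "\<And>n. y n \<ge> s" "y \<longlonglongrightarrow> s"
  shows "(\<lambda>n. p (y n)) \<longlonglongrightarrow> p s"
proof (rule continuous_within_tendsto_compose[of s "{s..}"])
  show "continuous (at s within {s..}) p"
    using cadlag_tendsto_right[OF assms(1,2)] by (simp add: continuous_within at_within_Ici_at_right)
qed (use assms in auto)

section \<open>First passage times and their grid approximation\<close>

context regular_levy
begin

text \<open>Strict exceedance is an open condition on the value, so by right-continuity it persists
  at grid times just after an exceedance.\<close>

definition passage :: "real \<Rightarrow> 'a \<Rightarrow> real" where
  "passage a \<omega> = Inf {t. t \<ge> 0 \<and> X t \<omega> > a}"

definition passage_index :: "nat \<Rightarrow> real \<Rightarrow> 'a \<Rightarrow> nat" where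
  "passage_index n a \<omega> = (LEAST k. X (real k / real (Suc n)) \<omega> > a)"

lemma passage_hit:
  assumes "\<omega> \<in> space M"
  shows "\<exists>t\<ge>0. X t \<omega> > a"
proof -
  have "eventually (\<lambda>t. X t \<omega> > a) at_top"
    using paths[OF assms] by (auto simp: transient_def filterlim_at_top_dense)
  then obtain T where "\<And>t. t \<ge> T \<Longrightarrow> X t \<omega> > a" by (auto simp: eventually_at_top_linorder)
  then show ?thesis by (intro exI[of _ "max 0 T"]) auto
qed

lemma passage_le: "t \<ge> 0 \<Longrightarrow> X t \<omega> > a \<Longrightarrow> passage a \<omega> \<le> t"
  unfolding passage_def by (rule cInf_lower) (auto intro: bdd_belowI[of _ 0])

lemma before_passage: "0 \<le> t \<Longrightarrow> t < passage a \<omega> \<Longrightarrow> X t \<omega> \<le> a"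
  using passage_le[of t a \<omega>] by linarith

lemma passage_nonneg: "\<omega> \<in> space M \<Longrightarrow> passage a \<omega> \<ge> 0"
  unfolding passage_def using passage_hit[of \<omega> a] by (intro cInf_greatest) auto

lemma passage_dense:
  assumes "\<omega> \<in> space M" "e > 0"
  shows "\<exists>t. passage a \<omega> \<le> t \<and> t < passage a \<omega> + e \<and> X t \<omega> > a"
proof -
  have "\<exists>t\<in>{t. t \<ge> 0 \<and> X t \<omega> > a}. t < passage a \<omega> + e"
    unfolding passage_def using assms passage_hit[of \<omega> a] by (intro cInf_lessD) auto
  then show ?thesis using passage_le by blast
qed

abbreviation passage_grid :: "nat \<Rightarrow> real \<Rightarrow> 'a \<Rightarrow> real" where
  "passage_grid n a \<omega> \<equiv> real (passage_index n a \<omega>) / real (Suc n)"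

text \<open>Upward passage is continuous because there are no positive jumps.\<close>

lemma passage_value:
  assumes \<omega>: "\<omega> \<in> space M" and a: "a \<ge> 0"
  shows "X (passage a \<omega>) \<omega> = a"
proof (rule antisym)
  let ?\<tau> = "passage a \<omega>"
  have c: "cadlag (\<lambda>t. X t \<omega>)" using paths[OF \<omega>] by (simp add: transient_def)
  note \<tau>0 = passage_nonneg[OF \<omega>, of a]
  show "X ?\<tau> \<omega> \<le> a"
  proof (cases "?\<tau> = 0")
    case False
    then have \<tau>: "?\<tau> > 0" using \<tau>0 by simp
    then obtain l where l: "((\<lambda>t. X t \<omega>) \<longlongrightarrow> l) (at_left ?\<tau>)" using c unfolding cadlag_def by blast
    have "eventually (\<lambda>t. t \<in> {0<..<?\<tau>}) (at_left ?\<tau>)" using \<tau> by (rule eventually_at_left_real)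
    then have "eventually (\<lambda>t. X t \<omega> \<le> a) (at_left ?\<tau>)"
      by eventually_elim (auto intro: before_passage)
    then have "l \<le> a" using l by (intro tendsto_upperbound[OF l]) (auto simp: trivial_limit_at_left_real)
    moreover have "Lim (at_left ?\<tau>) (\<lambda>t. X t \<omega>) = l" using l by (intro tendsto_Lim) (auto simp: trivial_limit_at_left_real)
    ultimately show ?thesis using no_jumps[OF \<omega>] \<tau> by (force simp: no_positive_jumps_def)
  qed (use X_0[OF \<omega>] a in simp)
  show "a \<le> X ?\<tau> \<omega>"
  proof (rule ccontr)
    assume "\<not> a \<le> X ?\<tau> \<omega>"
    then have lt: "X ?\<tau> \<omega> < a" by simp
    have "eventually (\<lambda>t. X t \<omega> < a) (at_right ?\<tau>)"
      using cadlag_tendsto_right[OF c \<tau>0] lt by (rule order_tendstoD(2))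
    then obtain b where b: "b > ?\<tau>" "\<And>t. ?\<tau> < t \<Longrightarrow> t < b \<Longrightarrow> X t \<omega> < a"
      by (auto simp: eventually_at_right_field)
    obtain t where t: "?\<tau> \<le> t" "t < ?\<tau> + (b - ?\<tau>)" "X t \<omega> > a"
      using passage_dense[OF \<omega>, of "b - ?\<tau>" a] b by auto
    then show False using b(2)[of t] lt by (cases "t = ?\<tau>") auto
  qed
qed

lemma passage_pos: "\<omega> \<in> space M \<Longrightarrow> a > 0 \<Longrightarrow> passage a \<omega> > 0"
  using passage_value[of \<omega> a] passage_nonneg[of \<omega> a] X_0[of \<omega>] by (cases "passage a \<omega> = 0") auto

lemma grid_index: "s \<ge> 0 \<Longrightarrow> \<exists>k::nat. grid n s = real k / real (Suc n)"
  by (rule exI[of _ "nat (\<lfloor>s * real (Suc n)\<rfloor> + 1)"]) (auto simp: grid_def simp del: of_nat_Suc)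

text \<open>Arbitrarily soon after the passage time the path is strictly above \<open>a\<close>, and
  by right-continuity so is the path at a nearby later grid point.\<close>

lemma passage_index_bound:
  assumes \<omega>: "\<omega> \<in> space M" and e: "e > 0"
  shows "eventually (\<lambda>n. X (passage_grid n a \<omega>) \<omega> > a \<and>
    passage_grid n a \<omega> < passage a \<omega> + e) sequentially"
proof -
  have c: "cadlag (\<lambda>t. X t \<omega>)" using paths[OF \<omega>] by (simp add: transient_def)
  obtain t where t: "passage a \<omega> \<le> t" "t < passage a \<omega> + e" "X t \<omega> > a"
    using passage_dense[OF \<omega> e] by blast
  have t0: "t \<ge> 0" using t(1) passage_nonneg[OF \<omega>, of a] by linarith
  have "eventually (\<lambda>r. X r \<omega> > a) (at_right t)"
    using cadlag_tendsto_right[OF c t0] t(3) by (rule order_tendstoD(1))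
  moreover have "eventually (\<lambda>r. r < passage a \<omega> + e) (at_right t)"
    using t(2) by (auto simp: eventually_at_right_field)
  ultimately have "eventually (\<lambda>r. X r \<omega> > a \<and> r < passage a \<omega> + e) (at_right t)" by eventually_elim auto
  then have "eventually (\<lambda>n. X (grid n t) \<omega> > a \<and> grid n t < passage a \<omega> + e) sequentially"
    using grid_at_right[of t] by (rule eventually_compose_filterlim)
  then show ?thesis
  proof eventually_elim
    case (elim n)
    obtain k where k: "grid n t = real k / real (Suc n)" using grid_index[OF t0] by blast
    have 1: "X (real k / real (Suc n)) \<omega> > a" using elim k by simp
    have "passage_index n a \<omega> \<le> k" unfolding passage_index_def using 1 by (rule Least_le)
    then have "passage_grid n a \<omega> \<le> real k / real (Suc n)"
      by (intro divide_right_mono) auto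
    moreover have "X (passage_grid n a \<omega>) \<omega> > a"
      unfolding passage_index_def using 1 by (rule LeastI)
    ultimately show ?case using elim k by simp
  qed
qed

text \<open>The drift puts every sufficiently late grid point above \<open>a\<close>, so the least
  index exists on every grid and not merely on fine ones.\<close>

lemma passage_index_gt:
  assumes "\<omega> \<in> space M"
  shows "X (passage_grid n a \<omega>) \<omega> > a"
proof -
  have "eventually (\<lambda>t. X t \<omega> > a) at_top"
    using paths[OF assms] by (auto simp: transient_def filterlim_at_top_dense)
  then obtain T where T: "\<And>t. t \<ge> T \<Longrightarrow> X t \<omega> > a" by (auto simp: eventually_at_top_linorder)
  obtain k where "T * real (Suc n) \<le> real k" using real_arch_simple by blast
  then have "X (real k / real (Suc n)) \<omega> > a" by (intro T) (simp add: pos_le_divide_eq del: of_nat_Suc)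
  then show ?thesis unfolding passage_index_def by (rule LeastI)
qed

lemma passage_index_ge:
  "\<omega> \<in> space M \<Longrightarrow> passage a \<omega> \<le> passage_grid n a \<omega>"
  by (intro passage_le passage_index_gt) auto

lemma passage_index_tendsto:
  assumes \<omega>: "\<omega> \<in> space M"
  shows "(\<lambda>n. passage_grid n a \<omega>) \<longlonglongrightarrow> passage a \<omega>"
proof (rule order_tendstoI)
  fix y assume "y < passage a \<omega>"
  then have "y < passage_grid n a \<omega>" for n using passage_index_ge[OF \<omega>, of a n] by linarith
  then show "eventually (\<lambda>n. y < passage_grid n a \<omega>) sequentially" by simp
next
  fix y assume "passage a \<omega> < y"
  then show "eventually (\<lambda>n. passage_grid n a \<omega> < y) sequentially"
    using passage_index_bound[OF \<omega>, of "y - passage a \<omega>" a] by (auto elim: eventually_mono)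
qed

lemma passage_index_measurable: "passage_index n a \<in> measurable M (count_space UNIV)"
proof -
  have [measurable]: "X (real k / real (Suc n)) \<in> borel_measurable M" for k by (intro X_measurable) simp
  show ?thesis unfolding passage_index_def[abs_def] by measurable
qed

lemma passage_measurable: "passage a \<in> borel_measurable M"
proof (rule borel_measurable_LIMSEQ_real[OF passage_index_tendsto])
  note passage_index_measurable[measurable]
  show "(\<lambda>\<omega>. passage_grid n a \<omega>) \<in> borel_measurable M" for n by measurable
qed

section \<open>The strong Markov property at first passage\<close>

lemma integral_countable_cases:
  fixes u v :: "'a \<Rightarrow> real" and K :: "'a \<Rightarrow> nat"
  assumes K: "K \<in> measurable M (count_space UNIV)"
    and u: "integrable M u" and v: "integrable M v"
    and eq: "\<And>k. (\<integral>\<omega>. indicator {k} (K \<omega>) * u \<omega> \<partial>M) = (\<integral>\<omega>. indicator {k} (K \<omega>) * v \<omega> \<partial>M)"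
  shows "(\<integral>\<omega>. u \<omega> \<partial>M) = (\<integral>\<omega>. v \<omega> \<partial>M)"
proof -
  note [measurable] = K
  have part: "(\<lambda>N. \<Sum>k<N. \<integral>\<omega>. indicator {k} (K \<omega>) * w \<omega> \<partial>M) \<longlonglongrightarrow> (\<integral>\<omega>. w \<omega> \<partial>M)" if w: "integrable M w" for w :: "'a \<Rightarrow> real"
  proof -
    have [measurable]: "w \<in> borel_measurable M" using w by simp
    have int: "integrable M (\<lambda>\<omega>. indicator A (K \<omega>) * w \<omega>)" for A
      by (rule Bochner_Integration.integrable_bound[OF w]) (measurable, auto split: split_indicator)
    have "(\<Sum>k<N. \<integral>\<omega>. indicator {k} (K \<omega>) * w \<omega> \<partial>M) = (\<integral>\<omega>. indicator {..<N} (K \<omega>) * w \<omega> \<partial>M)" for N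
    proof -
      have ind: "(\<Sum>k<N. indicator {k} (K \<omega>) * w \<omega>) = indicator {..<N} (K \<omega>) * w \<omega>" for \<omega>
        by (simp add: indicator_def sum.delta' if_distrib cong: if_cong flip: sum_distrib_right)
      show ?thesis using int by (subst Bochner_Integration.integral_sum[symmetric]) (auto simp: ind)
    qed
    moreover have "(\<lambda>N. \<integral>\<omega>. indicator {..<N} (K \<omega>) * w \<omega> \<partial>M) \<longlonglongrightarrow> (\<integral>\<omega>. w \<omega> \<partial>M)"
    proof (rule integral_dominated_convergence[where w = "\<lambda>\<omega>. \<bar>w \<omega>\<bar>"])
      show "AE \<omega> in M. (\<lambda>N. indicator {..<N} (K \<omega>) * w \<omega>) \<longlonglongrightarrow> w \<omega>"
      proof (intro AE_I2 tendsto_eventually)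
        fix \<omega> show "eventually (\<lambda>N. indicator {..<N} (K \<omega>) * w \<omega> = w \<omega>) sequentially"
          by (intro eventually_sequentiallyI[of "Suc (K \<omega>)"]) auto
      qed
    qed (use int w in \<open>auto split: split_indicator\<close>)
    ultimately show ?thesis by simp
  qed
  show ?thesis using part[OF u] part[OF v] unfolding eq by (rule LIMSEQ_unique)
qed

text \<open>This makes the first grid exceedance a stopping time: whether it occurs at the
  \<open>k\<close>-th time is decided by the path up to that time.\<close>

lemma first_exceedance_measurable:
  fixes a c :: real and t :: "nat \<Rightarrow> real"
  assumes t0: "\<And>k. t k \<ge> 0" and t_mono: "\<And>j k. j \<le> k \<Longrightarrow> t j \<le> t k"
  shows "(\<lambda>\<omega>. if X (t k) \<omega> > a \<and> (\<forall>j\<in>{..<k}. X (t j) \<omega> \<le> a) then c else 0) \<in> borel_measurable (F (t k))"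
proof -
  have X: "X (t j) \<in> borel_measurable (F (t k))" if "j \<le> k" for j
    using that by (intro measurable_F_mono[OF t0 _ adapted[OF t0]]) (auto intro: t_mono)
  have "Measurable.pred (F (t k)) (\<lambda>\<omega>. X (t j) \<omega> \<le> a)" if "j \<in> {..<k}" for j
  proof -
    have [measurable]: "X (t j) \<in> borel_measurable (F (t k))" using that by (intro X) auto
    show ?thesis by measurable
  qed
  then have [measurable]: "Measurable.pred (F (t k)) (\<lambda>\<omega>. \<forall>j\<in>{..<k}. X (t j) \<omega> \<le> a)"
    by (intro pred_intros_finite) auto
  note X[OF order_refl, measurable]
  show ?thesis by measurable
qed

text \<open>The grid passage time has countably many values, so the strong Markov property at it
  splits into \<open>future_markov\<close> at each fixed time.\<close>

lemma passage_index_markov: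
  assumes \<beta>: "\<beta> \<ge> 0"
  defines "T \<equiv> (\<lambda>n a \<omega>. passage_grid n a \<omega>)"
  shows "(\<lambda>\<omega>. exp (- \<beta> * T n a \<omega>) * future \<beta> (T n a \<omega>) x \<omega>) \<in> borel_measurable M"
    and "(\<lambda>\<omega>. exp (- \<beta> * T n a \<omega>) * transform \<beta> (x + X (T n a \<omega>) \<omega>)) \<in> borel_measurable M"
    and "(\<integral>\<omega>. exp (- \<beta> * T n a \<omega>) * future \<beta> (T n a \<omega>) x \<omega> \<partial>M) =
      (\<integral>\<omega>. exp (- \<beta> * T n a \<omega>) * transform \<beta> (x + X (T n a \<omega>) \<omega>) \<partial>M)"
proof -
  let ?t = "\<lambda>k. real k / real (Suc n)"
  have t0: "?t k \<ge> 0" for k by simp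
  note [measurable] = passage_index_measurable[of n a] transform_measurable[OF \<beta>]
  have [measurable]: "X (?t k) \<in> borel_measurable M" "future \<beta> (?t k) x \<in> borel_measurable M" for k
    using X_measurable[OF t0] future_measurable[OF \<beta> t0] by auto
  have "(\<lambda>\<omega>. (\<lambda>k \<omega>. exp (- \<beta> * ?t k) * future \<beta> (?t k) x \<omega>) (passage_index n a \<omega>) \<omega>) \<in> borel_measurable M"
    by (rule measurable_compose_countable) measurable
  then show m1: "(\<lambda>\<omega>. exp (- \<beta> * T n a \<omega>) * future \<beta> (T n a \<omega>) x \<omega>) \<in> borel_measurable M"
    by (simp add: T_def)
  have "(\<lambda>\<omega>. (\<lambda>k \<omega>. exp (- \<beta> * ?t k) * transform \<beta> (x + X (?t k) \<omega>)) (passage_index n a \<omega>) \<omega>) \<in> borel_measurable M"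
    by (rule measurable_compose_countable) measurable
  then show m2: "(\<lambda>\<omega>. exp (- \<beta> * T n a \<omega>) * transform \<beta> (x + X (T n a \<omega>) \<omega>)) \<in> borel_measurable M"
    by (simp add: T_def)
  have e01: "0 \<le> exp (- \<beta> * ?t k) \<and> exp (- \<beta> * ?t k) \<le> 1" for k using \<beta> by simp
  have le: "\<bar>exp (- \<beta> * T n a \<omega>) * v\<bar> \<le> 1" if "0 < v" "v \<le> 1" for v \<omega>
    using e01[of "passage_index n a \<omega>"] that unfolding abs_mult T_def by (intro mult_le_one) auto
  show "(\<integral>\<omega>. exp (- \<beta> * T n a \<omega>) * future \<beta> (T n a \<omega>) x \<omega> \<partial>M) =
      (\<integral>\<omega>. exp (- \<beta> * T n a \<omega>) * transform \<beta> (x + X (T n a \<omega>) \<omega>) \<partial>M)"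
  proof (rule integral_countable_cases[OF passage_index_measurable[of n a]])
    show "integrable M (\<lambda>\<omega>. exp (- \<beta> * T n a \<omega>) * future \<beta> (T n a \<omega>) x \<omega>)"
      by (intro integrable_bounded[OF m1, of 1] le future_bounds \<beta>)
    show "integrable M (\<lambda>\<omega>. exp (- \<beta> * T n a \<omega>) * transform \<beta> (x + X (T n a \<omega>) \<omega>))"
      by (intro integrable_bounded[OF m2, of 1] le transform_pos transform_le_1 \<beta>)
    fix k
    \<comment> \<open>The discount on the event \<open>passage_index n a \<omega> = k\<close>,
      expressed by the path up to the \<open>k\<close>-th grid time so that it is an admissible
      weight.\<close>
    define Y where "Y \<omega> = (if X (?t k) \<omega> > a \<and> (\<forall>j\<in>{..<k}. X (?t j) \<omega> \<le> a) then exp (- \<beta> * ?t k) else 0)" for \<omega>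
    have Y01: "0 \<le> Y \<omega> \<and> Y \<omega> \<le> 1" for \<omega> using e01[of k] by (auto simp: Y_def)
    have idx: "indicator {k} (passage_index n a \<omega>) * (exp (- \<beta> * T n a \<omega>) * g (T n a \<omega>)) = Y \<omega> * g (?t k)"
      if \<omega>: "\<omega> \<in> space M" for \<omega> and g :: "real \<Rightarrow> real"
    proof -
      have "passage_index n a \<omega> = k \<longleftrightarrow> X (?t k) \<omega> > a \<and> (\<forall>j\<in>{..<k}. X (?t j) \<omega> \<le> a)"
      proof
        assume k: "passage_index n a \<omega> = k"
        then show "X (?t k) \<omega> > a \<and> (\<forall>j\<in>{..<k}. X (?t j) \<omega> \<le> a)"
          using passage_index_gt[OF \<omega>, of a n] not_less_Least[of _ "\<lambda>k. X (?t k) \<omega> > a"]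
          unfolding passage_index_def by (auto simp: not_less[symmetric] simp del: of_nat_Suc)
      next
        assume "X (?t k) \<omega> > a \<and> (\<forall>j\<in>{..<k}. X (?t j) \<omega> \<le> a)"
        then show "passage_index n a \<omega> = k"
          unfolding passage_index_def by (intro Least_equality) (auto simp: not_less[symmetric] simp del: of_nat_Suc)
      qed
      then show ?thesis by (auto simp: Y_def T_def split: split_indicator)
    qed
    have Ym: "Y \<in> borel_measurable (F (?t k))"
      unfolding Y_def[abs_def] by (rule first_exceedance_measurable) (auto simp: divide_right_mono)
    have "(\<integral>\<omega>. indicator {k} (passage_index n a \<omega>) * (exp (- \<beta> * T n a \<omega>) * future \<beta> (T n a \<omega>) x \<omega>) \<partial>M) =
        (\<integral>\<omega>. Y \<omega> * future \<beta> (?t k) x \<omega> \<partial>M)"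
    proof (intro Bochner_Integration.integral_cong refl)
      fix \<omega> assume "\<omega> \<in> space M"
      from idx[OF this, of "\<lambda>t. future \<beta> t x \<omega>"]
      show "indicator {k} (passage_index n a \<omega>) * (exp (- \<beta> * T n a \<omega>) * future \<beta> (T n a \<omega>) x \<omega>) =
          Y \<omega> * future \<beta> (?t k) x \<omega>" .
    qed
    also have "\<dots> = (\<integral>\<omega>. Y \<omega> * transform \<beta> (x + X (?t k) \<omega>) \<partial>M)"
      by (rule future_markov[OF \<beta> t0 Ym Y01])
    also have "\<dots> = (\<integral>\<omega>. indicator {k} (passage_index n a \<omega>) * (exp (- \<beta> * T n a \<omega>) * transform \<beta> (x + X (T n a \<omega>) \<omega>)) \<partial>M)"
    proof (intro Bochner_Integration.integral_cong refl)
      fix \<omega> assume "\<omega> \<in> space M"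
      from idx[OF this, of "\<lambda>t. transform \<beta> (x + X t \<omega>)"]
      show "Y \<omega> * transform \<beta> (x + X (?t k) \<omega>) =
          indicator {k} (passage_index n a \<omega>) * (exp (- \<beta> * T n a \<omega>) * transform \<beta> (x + X (T n a \<omega>) \<omega>))" by simp
    qed
    finally show "(\<integral>\<omega>. indicator {k} (passage_index n a \<omega>) * (exp (- \<beta> * T n a \<omega>) * future \<beta> (T n a \<omega>) x \<omega>) \<partial>M) =
        (\<integral>\<omega>. indicator {k} (passage_index n a \<omega>) * (exp (- \<beta> * T n a \<omega>) * transform \<beta> (x + X (T n a \<omega>) \<omega>)) \<partial>M)" .
  qed
qed

definition passage_transform :: "real \<Rightarrow> real \<Rightarrow> real" where
  "passage_transform \<beta> a = (\<integral>\<omega>. exp (- \<beta> * passage a \<omega>) \<partial>M)"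

lemma exp_passage_integrable:
  assumes "\<beta> \<ge> 0"
  shows "integrable M (\<lambda>\<omega>. exp (- \<beta> * passage a \<omega>))"
proof (rule integrable_bounded[where B = 1])
  note passage_measurable[measurable]
  show "(\<lambda>\<omega>. exp (- \<beta> * passage a \<omega>)) \<in> borel_measurable M" by measurable
  show "\<bar>exp (- \<beta> * passage a \<omega>)\<bar> \<le> 1" if "\<omega> \<in> space M" for \<omega>
    using assms passage_nonneg[OF that, of a] by simp
qed

text \<open>The limit of \<open>passage_index_markov\<close> under refinement of the grid. At
  passage the path has value exactly \<open>a\<close>, so the post-passage factor becomes the
  constant \<open>transform \<beta> (x + a)\<close> and leaves the expectation.\<close>

lemma passage_markov:
  assumes \<beta>: "\<beta> \<ge> 0" and a: "a \<ge> 0"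
  shows "integrable M (\<lambda>\<omega>. exp (- \<beta> * passage a \<omega>) * future \<beta> (passage a \<omega>) x \<omega>)"
    and "(\<integral>\<omega>. exp (- \<beta> * passage a \<omega>) * future \<beta> (passage a \<omega>) x \<omega> \<partial>M) =
      passage_transform \<beta> a * transform \<beta> (x + a)"
proof -
  let ?T = "\<lambda>n \<omega>. passage_grid n a \<omega>"
  have e01: "\<bar>exp (- \<beta> * t)\<bar> \<le> 1" if "t \<ge> 0" for t using \<beta> that by simp
  have le: "\<bar>exp (- \<beta> * t) * v\<bar> \<le> 1" if "t \<ge> 0" "0 < v" "v \<le> 1" for t v
    using e01[OF that(1)] that unfolding abs_mult by (intro mult_le_one) auto
  have lim1: "(\<lambda>n. exp (- \<beta> * ?T n \<omega>) * future \<beta> (?T n \<omega>) x \<omega>) \<longlonglongrightarrow> exp (- \<beta> * passage a \<omega>) * future \<beta> (passage a \<omega>) x \<omega>"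
    if \<omega>: "\<omega> \<in> space M" for \<omega>
    by (intro tendsto_intros passage_index_tendsto future_right_cont passage_nonneg passage_index_ge \<omega>)
  have lim2: "(\<lambda>n. exp (- \<beta> * ?T n \<omega>) * transform \<beta> (x + X (?T n \<omega>) \<omega>)) \<longlonglongrightarrow> exp (- \<beta> * passage a \<omega>) * transform \<beta> (x + a)"
    if \<omega>: "\<omega> \<in> space M" for \<omega>
  proof (intro tendsto_intros passage_index_tendsto[OF \<omega>] transform_right_cont_seq[OF \<beta>])
    \<comment> \<open>The values at grid passage approach \<open>a\<close> from strictly above, the
      side on which \<open>transform\<close> is continuous.\<close>
    show "x + a < x + X (?T n \<omega>) \<omega>" for n using passage_index_gt[OF \<omega>, of a n] by simp
    have "(\<lambda>n. X (?T n \<omega>) \<omega>) \<longlonglongrightarrow> X (passage a \<omega>) \<omega>"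
      using paths[OF \<omega>] unfolding transient_def
      by (intro cadlag_tendsto_seq[of "\<lambda>t. X t \<omega>"] passage_nonneg passage_index_ge passage_index_tendsto \<omega>) auto
    then show "(\<lambda>n. X (?T n \<omega>) \<omega>) \<longlonglongrightarrow> a" by (simp add: passage_value[OF \<omega> a])
  qed
  note m = passage_index_markov[OF \<beta>, where n = n and a = a and x = x for n]
  have mf: "(\<lambda>\<omega>. exp (- \<beta> * passage a \<omega>) * future \<beta> (passage a \<omega>) x \<omega>) \<in> borel_measurable M"
    by (rule borel_measurable_LIMSEQ_real[OF lim1 m(1)])
  show "integrable M (\<lambda>\<omega>. exp (- \<beta> * passage a \<omega>) * future \<beta> (passage a \<omega>) x \<omega>)"
    using le[OF passage_nonneg future_bounds[OF \<beta>]] by (intro integrable_bounded[OF mf, of 1]) auto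
  have "(\<lambda>n. \<integral>\<omega>. exp (- \<beta> * ?T n \<omega>) * future \<beta> (?T n \<omega>) x \<omega> \<partial>M) \<longlonglongrightarrow>
      (\<integral>\<omega>. exp (- \<beta> * passage a \<omega>) * future \<beta> (passage a \<omega>) x \<omega> \<partial>M)"
  proof (rule integral_dominated_convergence[where w = "\<lambda>_. 1"])
    show "AE \<omega> in M. norm (exp (- \<beta> * ?T n \<omega>) * future \<beta> (?T n \<omega>) x \<omega>) \<le> 1" for n
      unfolding real_norm_def by (intro AE_I2 le future_bounds \<beta>) simp
    show "AE \<omega> in M. (\<lambda>n. exp (- \<beta> * ?T n \<omega>) * future \<beta> (?T n \<omega>) x \<omega>) \<longlonglongrightarrow>
        exp (- \<beta> * passage a \<omega>) * future \<beta> (passage a \<omega>) x \<omega>"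
      using lim1 by (intro AE_I2)
  qed (use m(1) mf in auto)
  moreover have "(\<lambda>n. \<integral>\<omega>. exp (- \<beta> * ?T n \<omega>) * transform \<beta> (x + X (?T n \<omega>) \<omega>) \<partial>M) \<longlonglongrightarrow>
      (\<integral>\<omega>. exp (- \<beta> * passage a \<omega>) * transform \<beta> (x + a) \<partial>M)"
  proof (rule integral_dominated_convergence[where w = "\<lambda>_. 1"])
    show "(\<lambda>\<omega>. exp (- \<beta> * passage a \<omega>) * transform \<beta> (x + a)) \<in> borel_measurable M"
      using passage_measurable[of a, measurable] by measurable
    show "AE \<omega> in M. norm (exp (- \<beta> * ?T n \<omega>) * transform \<beta> (x + X (?T n \<omega>) \<omega>)) \<le> 1" for n
      unfolding real_norm_def by (intro AE_I2 le transform_pos transform_le_1 \<beta>) simp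
    show "AE \<omega> in M. (\<lambda>n. exp (- \<beta> * ?T n \<omega>) * transform \<beta> (x + X (?T n \<omega>) \<omega>)) \<longlonglongrightarrow>
        exp (- \<beta> * passage a \<omega>) * transform \<beta> (x + a)"
      using lim2 by (intro AE_I2)
  qed (use m(2) in auto)
  ultimately show "(\<integral>\<omega>. exp (- \<beta> * passage a \<omega>) * future \<beta> (passage a \<omega>) x \<omega> \<partial>M) =
      passage_transform \<beta> a * transform \<beta> (x + a)"
    unfolding m(3) passage_transform_def by (simp add: LIMSEQ_unique)
qed

text \<open>The time below zero before passage is at most the passage time. Unlike the equality that
  follows, this is available up to \<open>x + a = 0\<close>.\<close>

lemma transform_passage_le:
  assumes \<beta>: "\<beta> \<ge> 0" and a: "a \<ge> 0"
  shows "passage_transform \<beta> a * transform \<beta> (x + a) \<le> transform \<beta> x"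
  unfolding passage_markov(2)[OF assms, symmetric] transform_eq_future[of \<beta> x]
proof (intro integral_mono passage_markov(1)[OF assms] future_integrable \<beta> order_refl)
  fix \<omega> assume \<omega>: "\<omega> \<in> space M"
  note T = below_tail(2-4)[OF path_shift_0[OF \<omega>, of x] order_refl passage_nonneg[OF \<omega>, of a]]
  have "below (\<lambda>r. x + X r \<omega>) \<le> passage a \<omega> + below (\<lambda>r. x + X (passage a \<omega> + r) \<omega>)" using T by simp
  from mult_left_mono[OF this \<beta>]
  show "exp (- \<beta> * passage a \<omega>) * future \<beta> (passage a \<omega>) x \<omega> \<le> future \<beta> 0 x \<omega>"
    by (simp add: future_def algebra_simps flip: exp_add)
qed

text \<open>Before passage the shifted path stays at or below \<open>x + a < 0\<close>, so the whole
  passage time is spent below zero. For \<open>x + a = 0\<close> only \<open>\<le> 0\<close> would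
  be known.\<close>

lemma transform_passage_eq:
  assumes \<beta>: "\<beta> \<ge> 0" and a: "a \<ge> 0" and x: "x + a < 0"
  shows "transform \<beta> x = passage_transform \<beta> a * transform \<beta> (x + a)"
  unfolding passage_markov(2)[OF assms(1,2), symmetric] transform_eq_future[of \<beta> x]
proof (intro Bochner_Integration.integral_cong refl)
  fix \<omega> assume \<omega>: "\<omega> \<in> space M"
  note \<tau>0 = passage_nonneg[OF \<omega>, of a]
  note T = below_tail(2)[OF path_shift_0[OF \<omega>, of x] order_refl \<tau>0]
  have "below_between 0 (passage a \<omega>) (\<lambda>r. x + X r \<omega>) =
      (\<integral>r. (indicator {0..<passage a \<omega>} r :: real) \<partial>lborel)"
    using before_passage[of _ a \<omega>] x by (intro Bochner_Integration.integral_cong) (force split: split_indicator)+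
  also have "\<dots> = passage a \<omega>" using \<tau>0 by simp
  finally show "future \<beta> 0 x \<omega> = exp (- \<beta> * passage a \<omega>) * future \<beta> (passage a \<omega>) x \<omega>"
    using T by (simp add: future_def algebra_simps flip: exp_add)
qed

text \<open>Positive because passage happens at a finite time, and below \<open>1\<close> because a
  positive level is not passed immediately. The second bound makes the exponential rate
  positive.\<close>

lemma passage_transform_bounds:
  assumes \<beta>: "\<beta> > 0" and a: "a > 0"
  shows "0 < passage_transform \<beta> a" "passage_transform \<beta> a < 1"
proof -
  have b: "\<beta> \<ge> 0" using \<beta> by simp
  note I = exp_passage_integrable[OF b, of a]
  have "passage_transform \<beta> a \<noteq> 0"
  proof
    assume "passage_transform \<beta> a = 0"
    then have "AE \<omega> in M. exp (- \<beta> * passage a \<omega>) = 0"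
      using integral_nonneg_eq_0_iff_AE[OF I] by (simp add: passage_transform_def)
    then have "AE \<omega> in M. False" by eventually_elim simp
    then show False by simp
  qed
  moreover have "0 \<le> passage_transform \<beta> a" unfolding passage_transform_def by (intro integral_nonneg_AE) auto
  ultimately show "0 < passage_transform \<beta> a" by simp
  have I1: "integrable M (\<lambda>\<omega>. 1 - exp (- \<beta> * passage a \<omega>))" using I by simp
  have lt: "exp (- \<beta> * passage a \<omega>) < 1" if "\<omega> \<in> space M" for \<omega>
    using passage_pos[OF that a] \<beta> by (simp add: mult_pos_pos)
  have nn: "AE \<omega> in M. 0 \<le> 1 - exp (- \<beta> * passage a \<omega>)" using lt by (intro AE_I2) (simp add: less_imp_le)
  have eq: "(\<integral>\<omega>. 1 - exp (- \<beta> * passage a \<omega>) \<partial>M) = 1 - passage_transform \<beta> a"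
    using I by (simp add: passage_transform_def prob_space)
  have "1 - passage_transform \<beta> a \<noteq> 0"
  proof
    assume "1 - passage_transform \<beta> a = 0"
    then have "AE \<omega> in M. 1 - exp (- \<beta> * passage a \<omega>) = 0"
      using integral_nonneg_eq_0_iff_AE[OF I1 nn] eq by simp
    then have "AE \<omega> in M. False" using AE_space by eventually_elim (use lt in force)
    then show False by simp
  qed
  moreover have "0 \<le> 1 - passage_transform \<beta> a" unfolding eq[symmetric] using nn by (rule integral_nonneg_AE)
  ultimately show "passage_transform \<beta> a < 1" by simp
qed

text \<open>The rate is \<open>- ln (passage_transform \<beta> 1)\<close>: successive passages make
  \<open>passage_transform\<close> multiplicative, so its negative logarithm is additive and
  monotone.\<close>

lemma transform_negative:
  assumes \<beta>: "\<beta> > 0"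
  obtains \<theta> where "\<theta> > 0" "\<And>x. x < 0 \<Longrightarrow> transform \<beta> x = transform \<beta> 0 * exp (\<theta> * x)"
proof -
  have b: "\<beta> \<ge> 0" using \<beta> by simp
  let ?f = "transform \<beta>" and ?\<rho> = "passage_transform \<beta>"
  define G where "G a = - ln (?\<rho> a)" for a
  note f0 = transform_pos[OF b]
  have rel: "?f x = ?\<rho> a * ?f (x + a)" if "a > 0" "x + a < 0" for x a
    using transform_passage_eq[OF b, of a x] that by simp
  \<comment> \<open>\<open>-1\<close> is merely a negative reference level, at which the positive
    value of \<open>transform\<close> can be cancelled.\<close>
  have mult: "?\<rho> (a + c) = ?\<rho> a * ?\<rho> c" if "a > 0" "c > 0" for a c
  proof -
    have "?\<rho> (a + c) * ?f (-1) = ?f (- 1 - a - c)" using rel[of "a + c" "- 1 - a - c"] that by simp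
    also have "\<dots> = ?\<rho> a * ?f (- 1 - c)" using rel[of a "- 1 - a - c"] that by simp
    also have "?f (- 1 - c) = ?\<rho> c * ?f (-1)" using rel[of c "- 1 - c"] that by simp
    finally show ?thesis using f0[of "-1"] by simp
  qed
  have anti: "?\<rho> c \<le> ?\<rho> a" if "0 < a" "a \<le> c" for a c
  proof -
    have "?\<rho> c * ?f (-1) = ?f (- 1 - c)" using rel[of c "- 1 - c"] that by simp
    also have "\<dots> \<le> ?f (- 1 - a)" using that by (intro transform_mono[OF b]) auto
    also have "\<dots> = ?\<rho> a * ?f (-1)" using rel[of a "- 1 - a"] that by simp
    finally show ?thesis using f0[of "-1"] by simp
  qed
  note \<rho> = passage_transform_bounds[OF \<beta>]
  have lin: "G a = a * G 1" if "a > 0" for a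
  proof (rule additive_mono_linear[OF _ _ that])
    show "G (a + c) = G a + G c" if "a > 0" "c > 0" for a c
      using that \<rho>(1)[OF that(1)] \<rho>(1)[OF that(2)] by (simp add: G_def mult ln_mult)
    show "G a \<le> G c" if "0 < a" "a \<le> c" for a c
      using that \<rho>(1)[of a] \<rho>(1)[of c] anti[OF that] by (simp add: G_def)
  qed
  have G1: "G 1 > 0" using \<rho>[of 1] by (simp add: G_def)
  have \<rho>_exp: "?\<rho> a = exp (- G 1 * a)" if "a > 0" for a
  proof -
    have "ln (?\<rho> a) = - G 1 * a" using lin[OF that] unfolding G_def[of a] by (simp add: mult.commute)
    then show ?thesis using exp_ln[OF \<rho>(1)[OF that]] by simp
  qed
  \<comment> \<open>The relation \<open>rel\<close> stops short of level \<open>0\<close>. The lower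
    bound comes from \<open>transform_passage_le\<close> with \<open>a = - x\<close>; the upper
    bound stops at level \<open>- 1 / real (Suc n)\<close>, uses monotonicity there and lets
    \<open>n\<close> grow.\<close>
  have "?f x = ?f 0 * exp (G 1 * x)" if x: "x < 0" for x
  proof (rule antisym)
    have "exp (G 1 * x) * ?f 0 \<le> ?f x"
      using transform_passage_le[OF b, of "- x" x] x \<rho>_exp[of "- x"] by simp
    then show "?f 0 * exp (G 1 * x) \<le> ?f x" by (simp add: mult.commute)
    have L: "(\<lambda>n. - x - 1 / real (Suc n)) \<longlonglongrightarrow> - x - 0"
      by (intro tendsto_intros LIMSEQ_Suc[OF lim_1_over_n])
    have "(\<lambda>n. exp (- G 1 * (- x - 1 / real (Suc n))) * ?f 0) \<longlonglongrightarrow> exp (- G 1 * (- x - 0)) * ?f 0"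
      by (intro tendsto_mult tendsto_exp tendsto_const L)
    moreover have "\<exists>N. \<forall>n\<ge>N. ?f x \<le> exp (- G 1 * (- x - 1 / real (Suc n))) * ?f 0"
    proof -
      obtain N where N: "inverse (real (Suc N)) < - x" using reals_Archimedean[of "- x"] x by auto
      show ?thesis
      proof (intro exI allI impI)
        fix n assume "N \<le> n"
        then have "1 / real (Suc n) \<le> inverse (real (Suc N))" by (simp add: field_simps)
        then have a: "- x - 1 / real (Suc n) > 0" using N by linarith
        have "?f x = ?\<rho> (- x - 1 / real (Suc n)) * ?f (- 1 / real (Suc n))"
          using rel[OF a, of x] by simp
        also have "\<dots> \<le> ?\<rho> (- x - 1 / real (Suc n)) * ?f 0"
          using \<rho>(1)[OF a] by (intro mult_left_mono transform_mono[OF b]) auto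
        finally show "?f x \<le> exp (- G 1 * (- x - 1 / real (Suc n))) * ?f 0" using \<rho>_exp[OF a] by simp
      qed
    qed
    ultimately have "?f x \<le> exp (- G 1 * (- x - 0)) * ?f 0" by (rule LIMSEQ_le_const)
    then show "?f x \<le> ?f 0 * exp (G 1 * x)" by (simp add: mult.commute)
  qed
  with G1 show ?thesis using that by blast
qed

end

section \<open>The Laplace exponent\<close>

text \<open>A majorant for differentiating under the expectation. One \<open>d\<close> covers the
  exponent of the difference quotient and the other absorbs the factor \<open>\<bar>y\<bar>\<close>;
  two exponentials handle the two signs of \<open>y\<close>.\<close>

lemma exp_diff_quotient_bound:
  fixes l h d y :: real
  assumes d: "d > 0" and h: "h \<noteq> 0" "\<bar>h\<bar> \<le> d"
  shows "\<bar>(exp ((l + h) * y) - exp (l * y)) / h\<bar> \<le> (exp ((l + 2 * d) * y) + exp ((l - 2 * d) * y)) / d"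
proof -
  have e1: "\<bar>exp u - 1\<bar> \<le> \<bar>u\<bar> * exp \<bar>u\<bar>" for u :: real
  proof (cases "u \<ge> 0")
    case True
    have "1 - u \<le> exp (- u)" using exp_ge_add_one_self[of "- u"] by simp
    from mult_right_mono[OF this, of "exp u"] have "exp u - u * exp u \<le> 1"
      by (simp add: algebra_simps flip: exp_add)
    then show ?thesis using True by simp
  next
    case False
    have "1 - exp u \<le> - u" using exp_ge_add_one_self[of u] by linarith
    also have "\<dots> \<le> (- u) * exp (- u)" using False by (simp add: mult_le_cancel_left1)
    finally show ?thesis using False by (simp add: abs_if)
  qed
  have y: "\<bar>y\<bar> * exp (d * \<bar>y\<bar>) \<le> exp (2 * d * \<bar>y\<bar>) / d"
  proof -
    have "d * \<bar>y\<bar> \<le> exp (d * \<bar>y\<bar>)" using exp_ge_add_one_self[of "d * \<bar>y\<bar>"] by linarith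
    then have "\<bar>y\<bar> \<le> exp (d * \<bar>y\<bar>) / d" using d by (simp add: field_simps)
    from mult_right_mono[OF this, of "exp (d * \<bar>y\<bar>)"] show ?thesis
      by (simp add: algebra_simps flip: exp_add)
  qed
  have "\<bar>(exp ((l + h) * y) - exp (l * y)) / h\<bar> = exp (l * y) * (\<bar>exp (h * y) - 1\<bar> / \<bar>h\<bar>)"
  proof -
    have "exp ((l + h) * y) - exp (l * y) = exp (l * y) * (exp (h * y) - 1)"
      by (simp add: algebra_simps flip: exp_add)
    then show ?thesis by (simp add: abs_mult)
  qed
  also have "\<dots> \<le> exp (l * y) * (\<bar>y\<bar> * exp (d * \<bar>y\<bar>))"
  proof (intro mult_left_mono)
    have "\<bar>exp (h * y) - 1\<bar> / \<bar>h\<bar> \<le> (\<bar>h * y\<bar> * exp \<bar>h * y\<bar>) / \<bar>h\<bar>" by (intro divide_right_mono e1) simp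
    also have "\<dots> = \<bar>y\<bar> * exp (\<bar>h\<bar> * \<bar>y\<bar>)" using h by (simp add: abs_mult)
    also have "\<dots> \<le> \<bar>y\<bar> * exp (d * \<bar>y\<bar>)" using h by (intro mult_left_mono) (auto intro: mult_right_mono)
    finally show "\<bar>exp (h * y) - 1\<bar> / \<bar>h\<bar> \<le> \<bar>y\<bar> * exp (d * \<bar>y\<bar>)" .
  qed simp
  also have "\<dots> \<le> exp (l * y) * (exp (2 * d * \<bar>y\<bar>) / d)" using y by (intro mult_left_mono) auto
  also have "\<dots> \<le> (exp ((l + 2 * d) * y) + exp ((l - 2 * d) * y)) / d"
    using d by (cases "y \<ge> 0") (auto simp: algebra_simps divide_right_mono simp flip: exp_add)
  finally show ?thesis .
qed

lemma nn_integral_exp_tail: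
  fixes k a :: real
  assumes k: "k > 0"
  shows "(\<integral>\<^sup>+x. ennreal (exp (- k * x)) * indicator {a..} x \<partial>lborel) = ennreal (exp (- k * a) / k)"
proof -
  have "(\<integral>\<^sup>+x. ennreal (exp (- k * x)) * indicator {a..} x \<partial>lborel) = ennreal (0 - (- exp (- k * a) / k))"
  proof (rule nn_integral_FTC_atLeast)
    show "((\<lambda>x. - exp (- k * x) / k) has_real_derivative exp (- k * x)) (at x)" for x
      using k by (auto intro!: derivative_eq_intros)
    have "filterlim (\<lambda>x. k * x) at_top at_top"
      using k by (intro filterlim_tendsto_pos_mult_at_top[OF tendsto_const _ filterlim_ident])
    then have "((\<lambda>x. exp (- (k * x))) \<longlongrightarrow> 0) at_top"
      by (intro filterlim_compose[OF exp_at_bot] filterlim_compose[OF filterlim_uminus_at_bot_at_top])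
    then have "((\<lambda>x. - exp (- (k * x)) / k) \<longlongrightarrow> - 0 / k) at_top"
      using k by (intro tendsto_intros) auto
    then show "((\<lambda>x. - exp (- k * x) / k) \<longlongrightarrow> 0) at_top" by simp
  qed auto
  then show ?thesis by simp
qed

lemma nn_integral_exp_negative:
  fixes k :: real
  assumes k: "k > 0"
  shows "(\<integral>\<^sup>+x. ennreal (exp (k * x)) * indicator {..<0} x \<partial>lborel) = ennreal (1 / k)"
proof -
  have "(\<integral>\<^sup>+x. ennreal (exp (k * x)) * indicator {..<0} x \<partial>lborel) =
      (\<integral>\<^sup>+x. ennreal (exp (- k * x)) * indicator {..<0} (- x) \<partial>lborel)"
    by (subst nn_integral_real_affine[where c = "-1" and t = 0]) auto
  also have "\<dots> = (\<integral>\<^sup>+x. ennreal (exp (- k * x)) * indicator {0..} x \<partial>lborel)"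
    using AE_lborel_singleton[of "0::real"] by (intro nn_integral_cong_AE) (auto split: split_indicator)
  finally show ?thesis using nn_integral_exp_tail[OF k, of 0] by simp
qed

context regular_levy
begin

lemma phi_0: "\<phi> 0 = 0"
  using exp_integral[of 1 0] by (simp add: prob_space)

text \<open>Markov's inequality: if \<open>\<phi> l \<le> 0\<close> then \<open>exp l\<close> times
  the probability of \<open>X (real n) \<omega> \<ge> 1\<close> never exceeds \<open>1\<close>, yet
  the drift sends this probability to \<open>1\<close>.\<close>

lemma phi_pos:
  assumes l: "l > 0"
  shows "\<phi> l > 0"
proof (rule ccontr)
  assume neg: "\<not> \<phi> l > 0"
  have "(\<lambda>n. \<integral>\<omega>. indicator {1..} (X (real n) \<omega>) \<partial>M) \<longlonglongrightarrow> (\<integral>\<omega>. (1::real) \<partial>M)"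
  proof (rule integral_dominated_convergence[where w = "\<lambda>_. 1"])
    have [measurable]: "X (real n) \<in> borel_measurable M" for n by (intro X_measurable) simp
    show "(\<lambda>\<omega>. indicator {1..} (X (real n) \<omega>) :: real) \<in> borel_measurable M" for n by measurable
    show "AE \<omega> in M. (\<lambda>n. indicator {1..} (X (real n) \<omega>)) \<longlonglongrightarrow> (1 :: real)"
    proof (intro AE_I2 tendsto_eventually)
      fix \<omega> assume "\<omega> \<in> space M"
      then have "filterlim (\<lambda>n. X (real n) \<omega>) at_top sequentially"
        using paths filterlim_compose[OF _ filterlim_real_sequentially] unfolding transient_def by blast
      then have "eventually (\<lambda>n. X (real n) \<omega> \<ge> 1) sequentially" by (simp add: filterlim_at_top)
      then show "eventually (\<lambda>n. indicator {1..} (X (real n) \<omega>) = (1 :: real)) sequentially"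
        by eventually_elim simp
    qed
  qed (auto split: split_indicator)
  then have "(\<lambda>n. exp l * (\<integral>\<omega>. indicator {1..} (X (real n) \<omega>) \<partial>M)) \<longlonglongrightarrow> exp l * 1"
    by (intro tendsto_intros) (simp add: prob_space)
  moreover have "exp l * (\<integral>\<omega>. indicator {1..} (X (real n) \<omega>) \<partial>M) \<le> 1" for n
  proof -
    have [measurable]: "X (real n) \<in> borel_measurable M" by (intro X_measurable) simp
    have "(\<integral>\<omega>. exp l * indicator {1..} (X (real n) \<omega>) \<partial>M) \<le> (\<integral>\<omega>. exp (l * X (real n) \<omega>) \<partial>M)"
    proof (intro integral_mono exp_integrable)
      show "integrable M (\<lambda>\<omega>. exp l * indicator {1..} (X (real n) \<omega>))"
        by (rule integrable_bounded[where B = "exp l"]) (auto split: split_indicator)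
      show "exp l * indicator {1..} (X (real n) \<omega>) \<le> exp (l * X (real n) \<omega>)" for \<omega>
        using l by (auto split: split_indicator)
    qed (use l in auto)
    also have "\<dots> = exp (real n * \<phi> l)" using l by (intro exp_integral) auto
    also have "\<dots> \<le> 1" using neg by (simp add: mult_nonneg_nonpos)
    finally show ?thesis by simp
  qed
  ultimately have "exp l * 1 \<le> 1" by (intro LIMSEQ_le_const2) auto
  then show False using l by simp
qed

lemma phi_eq_ln: "l \<ge> 0 \<Longrightarrow> \<phi> l = ln (\<integral>\<omega>. exp (l * X 1 \<omega>) \<partial>M)"
  using exp_integral[of 1 l] by simp

text \<open>\<open>\<phi>\<close> is the limit of the convex functions \<open>(exp (t * \<phi> \<alpha>) - 1) / t\<close> as \<open>t\<close> decreases to \<open>0\<close>.\<close>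

lemma phi_convex: "convex_on {0..} \<phi>"
proof (rule convex_onI)
  fix u x y :: real
  assume u: "0 < u" "u < 1" and x: "x \<in> {0..}" and y: "y \<in> {0..}"
  let ?z = "(1 - u) * x + u * y"
  have z: "?z \<ge> 0" using u x y by auto
  have ineq: "(exp (t * \<phi> ?z) - 1) / t \<le> (1 - u) * ((exp (t * \<phi> x) - 1) / t) + u * ((exp (t * \<phi> y) - 1) / t)"
    if t: "t > 0" for t
  proof -
    have t0: "t \<ge> 0" using t by simp
    have "(\<integral>\<omega>. exp (?z * X t \<omega>) \<partial>M) \<le> (\<integral>\<omega>. (1 - u) * exp (x * X t \<omega>) + u * exp (y * X t \<omega>) \<partial>M)"
    proof (intro integral_mono exp_integrable t0 z)
      show "integrable M (\<lambda>\<omega>. (1 - u) * exp (x * X t \<omega>) + u * exp (y * X t \<omega>))"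
        using exp_integrable[OF t0] x y by simp
      fix \<omega>
      have "exp ((1 - u) *\<^sub>R (x * X t \<omega>) + u *\<^sub>R (y * X t \<omega>)) \<le> (1 - u) * exp (x * X t \<omega>) + u * exp (y * X t \<omega>)"
        using exp_convex u by (intro convex_onD[where A = UNIV]) auto
      then show "exp (?z * X t \<omega>) \<le> (1 - u) * exp (x * X t \<omega>) + u * exp (y * X t \<omega>)"
        by (simp add: algebra_simps)
    qed
    also have "\<dots> = (1 - u) * exp (t * \<phi> x) + u * exp (t * \<phi> y)"
      using exp_integrable[OF t0] exp_integral[OF t0] x y by simp
    finally have "exp (t * \<phi> ?z) \<le> (1 - u) * exp (t * \<phi> x) + u * exp (t * \<phi> y)"
      using exp_integral[OF t0 z] by simp
    then have "(exp (t * \<phi> ?z) - 1) / t \<le> ((1 - u) * exp (t * \<phi> x) + u * exp (t * \<phi> y) - 1) / t"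
      using t by (intro divide_right_mono) auto
    also have "(1 - u) * exp (t * \<phi> x) + u * exp (t * \<phi> y) - 1 = (1 - u) * (exp (t * \<phi> x) - 1) + u * (exp (t * \<phi> y) - 1)"
      by (simp add: algebra_simps)
    finally show ?thesis by (simp add: add_divide_distrib)
  qed
  have lim: "((\<lambda>t. (exp (t * c) - 1) / t) \<longlongrightarrow> c) (at_right 0)" for c :: real
  proof -
    have "((\<lambda>t. exp (t * c)) has_real_derivative c) (at 0)"
      by (auto intro!: derivative_eq_intros)
    then have "((\<lambda>h. (exp ((0 + h) * c) - exp (0 * c)) / h) \<longlongrightarrow> c) (at 0)" by (rule DERIV_D)
    then have "((\<lambda>t. (exp (t * c) - 1) / t) \<longlongrightarrow> c) (at 0)" by simp
    then show ?thesis by (rule tendsto_mono[OF at_le[OF subset_UNIV]])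
  qed
  have "\<phi> ?z \<le> (1 - u) * \<phi> x + u * \<phi> y"
  proof (rule tendsto_le)
    show "((\<lambda>t. (1 - u) * ((exp (t * \<phi> x) - 1) / t) + u * ((exp (t * \<phi> y) - 1) / t)) \<longlongrightarrow> (1 - u) * \<phi> x + u * \<phi> y) (at_right 0)"
      by (intro tendsto_intros lim)
    show "((\<lambda>t. (exp (t * \<phi> ?z) - 1) / t) \<longlongrightarrow> \<phi> ?z) (at_right 0)" by (rule lim)
    show "\<forall>\<^sub>F t in at_right 0. (exp (t * \<phi> ?z) - 1) / t \<le>
        (1 - u) * ((exp (t * \<phi> x) - 1) / t) + u * ((exp (t * \<phi> y) - 1) / t)"
      using ineq by (auto simp: eventually_at_right_field intro: exI[of _ 1])
  qed simp
  then show "\<phi> ((1 - u) *\<^sub>R x + u *\<^sub>R y) \<le> (1 - u) * \<phi> x + u * \<phi> y" by simp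
qed simp

text \<open>The exponential moment at time \<open>1\<close> is differentiated under the integral,
  along sequences so that dominated convergence applies; \<phi> is its logarithm.\<close>

lemma phi_differentiable:
  assumes l: "l > 0"
  shows "(\<phi> has_real_derivative deriv \<phi> l) (at l)"
proof -
  have [measurable]: "X 1 \<in> borel_measurable M" by (intro X_measurable) simp
  let ?m = "\<lambda>l. \<integral>\<omega>. exp (l * X 1 \<omega>) \<partial>M"
  \<comment> \<open>Then \<open>l - 2 * d = l / 2\<close> is still nonnegative, where exponential
    moments are available.\<close>
  define d where "d = l / 4"
  have d: "d > 0" using l by (simp add: d_def)
  have "(?m has_real_derivative (\<integral>\<omega>. X 1 \<omega> * exp (l * X 1 \<omega>) \<partial>M)) (at l)"
    unfolding DERIV_def tendsto_at_iff_sequentially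
  proof (intro allI impI)
    fix s :: "nat \<Rightarrow> real" assume s: "\<forall>i. s i \<in> UNIV - {0}" and s0: "s \<longlonglongrightarrow> 0"
    have "eventually (\<lambda>n. dist (s n) 0 < d) sequentially" using s0 d by (rule tendstoD)
    then obtain N where N: "\<And>n. n \<ge> N \<Longrightarrow> \<bar>s n\<bar> \<le> d"
      by (auto simp: eventually_sequentially dist_real_def intro: less_imp_le)
    let ?q = "\<lambda>n \<omega>. (exp ((l + s n) * X 1 \<omega>) - exp (l * X 1 \<omega>)) / s n"
    have "(\<lambda>n. \<integral>\<omega>. ?q (n + N) \<omega> \<partial>M) \<longlonglongrightarrow> (\<integral>\<omega>. X 1 \<omega> * exp (l * X 1 \<omega>) \<partial>M)"
    proof (rule integral_dominated_convergence[where w = "\<lambda>\<omega>. (exp ((l + 2 * d) * X 1 \<omega>) + exp ((l - 2 * d) * X 1 \<omega>)) / d"])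
      show "integrable M (\<lambda>\<omega>. (exp ((l + 2 * d) * X 1 \<omega>) + exp ((l - 2 * d) * X 1 \<omega>)) / d)"
        using l d exp_integrable[of 1 "l + 2 * d"] exp_integrable[of 1 "l - 2 * d"] by (simp add: d_def)
      show "AE \<omega> in M. (\<lambda>n. ?q (n + N) \<omega>) \<longlonglongrightarrow> X 1 \<omega> * exp (l * X 1 \<omega>)"
      proof (intro AE_I2)
        fix \<omega>
        have "((\<lambda>l. exp (l * X 1 \<omega>)) has_real_derivative X 1 \<omega> * exp (l * X 1 \<omega>)) (at l)"
          by (auto intro!: derivative_eq_intros)
        then have "(\<lambda>n. ?q n \<omega>) \<longlonglongrightarrow> X 1 \<omega> * exp (l * X 1 \<omega>)"
          using s s0 unfolding DERIV_def tendsto_at_iff_sequentially comp_def by blast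
        then show "(\<lambda>n. ?q (n + N) \<omega>) \<longlonglongrightarrow> X 1 \<omega> * exp (l * X 1 \<omega>)" by (rule LIMSEQ_ignore_initial_segment)
      qed
      show "AE \<omega> in M. norm (?q (n + N) \<omega>) \<le> (exp ((l + 2 * d) * X 1 \<omega>) + exp ((l - 2 * d) * X 1 \<omega>)) / d" for n
        unfolding real_norm_def by (intro AE_I2 exp_diff_quotient_bound d) (use s N in auto)
    qed measurable
    then have "(\<lambda>n. \<integral>\<omega>. ?q n \<omega> \<partial>M) \<longlonglongrightarrow> (\<integral>\<omega>. X 1 \<omega> * exp (l * X 1 \<omega>) \<partial>M)" by (rule LIMSEQ_offset)
    moreover have "eventually (\<lambda>n. (\<integral>\<omega>. ?q n \<omega> \<partial>M) = (?m (l + s n) - ?m l) / s n) sequentially"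
    proof (intro eventually_sequentiallyI[of N])
      fix n assume "N \<le> n"
      then have "l + s n \<ge> 0" using N[of n] l by (auto simp: d_def)
      then show "(\<integral>\<omega>. ?q n \<omega> \<partial>M) = (?m (l + s n) - ?m l) / s n"
        using exp_integrable[of 1 "l + s n"] exp_integrable[of 1 l] l by simp
    qed
    ultimately show "((\<lambda>h. (?m (l + h) - ?m l) / h) \<circ> s) \<longlonglongrightarrow> (\<integral>\<omega>. X 1 \<omega> * exp (l * X 1 \<omega>) \<partial>M)"
      unfolding comp_def by (rule Lim_transform_eventually)
  qed
  moreover have "?m l > 0" using exp_integral[of 1 l] l by simp
  ultimately have "((\<lambda>l. ln (?m l)) has_real_derivative (\<integral>\<omega>. X 1 \<omega> * exp (l * X 1 \<omega>) \<partial>M) / ?m l) (at l)"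
    by (auto intro!: derivative_eq_intros)
  moreover have "eventually (\<lambda>l. ln (?m l) = \<phi> l) (nhds l)"
    using eventually_nhds_in_open[of "{0<..}" l] l by (auto elim!: eventually_mono simp: phi_eq_ln)
  ultimately have "(\<phi> has_real_derivative (\<integral>\<omega>. X 1 \<omega> * exp (l * X 1 \<omega>) \<partial>M) / ?m l) (at l)"
    by (subst (asm) DERIV_cong_ev) auto
  then show ?thesis using DERIV_imp_deriv by metis
qed

text \<open>Convexity with \<open>\<phi> 0 = 0\<close>. Increasing chord slopes together with
  \<open>phi_pos\<close> yield strict monotonicity.\<close>

lemma phi_chord_mono:
  assumes "0 < x" "x \<le> y"
  shows "\<phi> x / x \<le> \<phi> y / y"
proof -
  have "\<phi> ((1 - x / y) *\<^sub>R 0 + (x / y) *\<^sub>R y) \<le> (1 - x / y) * \<phi> 0 + (x / y) * \<phi> y"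
    using assms by (intro convex_onD[OF phi_convex]) auto
  then show ?thesis using assms by (simp add: phi_0 field_simps)
qed

lemma phi_strict_mono:
  assumes "0 < x" "x < y"
  shows "\<phi> x < \<phi> y"
proof -
  have "\<phi> x < \<phi> x / x * y" using phi_pos[OF assms(1)] assms by (simp add: field_simps)
  also have "\<dots> \<le> \<phi> y / y * y" using phi_chord_mono[of x y] assms by (intro mult_right_mono) auto
  finally show ?thesis using assms by simp
qed

lemma right_inverse_exponent_0: "right_inverse_exponent \<phi> 0 = 0"
proof -
  have "{\<alpha>. \<alpha> \<ge> 0 \<and> \<phi> \<alpha> = 0} = {0}"
  proof (intro equalityI subsetI)
    fix \<alpha> assume "\<alpha> \<in> {\<alpha>. \<alpha> \<ge> 0 \<and> \<phi> \<alpha> = 0}"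
    then show "\<alpha> \<in> {0}" using phi_pos[of \<alpha>] by (cases "\<alpha> = 0") auto
  qed (simp add: phi_0)
  then show ?thesis by (simp add: right_inverse_exponent_def)
qed

text \<open>By strict monotonicity the set under the supremum is a singleton.\<close>

lemma right_inverse_exponent_eqI:
  assumes "a > 0" "\<phi> a = q"
  shows "right_inverse_exponent \<phi> q = a"
proof -
  have "q > 0" using phi_pos assms by blast
  have "{\<alpha>. \<alpha> \<ge> 0 \<and> \<phi> \<alpha> = q} = {a}"
  proof (intro equalityI subsetI)
    fix \<alpha> assume "\<alpha> \<in> {\<alpha>. \<alpha> \<ge> 0 \<and> \<phi> \<alpha> = q}"
    then have "\<alpha> \<ge> 0" "\<phi> \<alpha> = q" by auto
    then have "\<alpha> > 0" using phi_0 \<open>q > 0\<close> by (cases "\<alpha> = 0") auto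
    then show "\<alpha> \<in> {a}"
      using phi_strict_mono[of \<alpha> a] phi_strict_mono[of a \<alpha>] assms \<open>\<phi> \<alpha> = q\<close> by (cases \<alpha> a rule: linorder_cases) auto
  qed (use assms in auto)
  then show ?thesis by (simp add: right_inverse_exponent_def)
qed

text \<open>Convexity and \<open>\<phi> 0 = 0\<close> squeeze \<open>deriv \<phi> x\<close> between \<open>\<phi> x / x\<close> and
  \<open>(\<phi> (2 * x) - \<phi> x) / x\<close>.\<close>

lemma derivative_at_0_plus_eqI:
  assumes lim: "((\<lambda>x. \<phi> x / x) \<longlongrightarrow> c) (at_right 0)"
  shows "derivative_at_0_plus \<phi> = c"
proof -
  have tangent: "deriv \<phi> x * (y - x) \<le> \<phi> y - \<phi> x" if "x > 0" "y \<ge> 0" for x y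
  proof (rule convex_on_imp_above_tangent[OF phi_convex])
    show "connected {0::real..}" by simp
    show "x \<in> interior {0..}" using that by (simp add: interior_real_atLeast)
    show "y \<in> {0..}" using that by simp
    show "(\<phi> has_real_derivative deriv \<phi> x) (at x within {0..})"
      using phi_differentiable[OF that(1)] by (rule has_field_derivative_at_within)
  qed
  have lower: "\<phi> x / x \<le> deriv \<phi> x" if "x > 0" for x
    using tangent[of x 0] that by (simp add: phi_0 field_simps)
  \<comment> \<open>The second chord slope is expressed by slopes from the origin, so that its limit
    is \<open>2 * c - c\<close>.\<close>
  have upper: "deriv \<phi> x \<le> 2 * (\<phi> (2 * x) / (2 * x)) - \<phi> x / x" if "x > 0" for x
    using tangent[of x "2 * x"] that by (simp add: field_simps)
  have "filterlim (\<lambda>x::real. 2 * x) (at_right 0) (at_right 0)"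
  proof (rule filterlim_at_withinI)
    have "((\<lambda>x::real. 2 * x) \<longlongrightarrow> 2 * 0) (at_right 0)" by (intro tendsto_intros)
    then show "((\<lambda>x::real. 2 * x) \<longlongrightarrow> 0) (at_right 0)" by simp
    show "\<forall>\<^sub>F x::real in at_right 0. 2 * x \<in> {0<..} - {0}"
      using eventually_at_right_less[of "0::real"] by eventually_elim auto
  qed
  then have "((\<lambda>x. \<phi> (2 * x) / (2 * x)) \<longlongrightarrow> c) (at_right 0)"
    using filterlim_compose[OF lim] by blast
  then have "((\<lambda>x. 2 * (\<phi> (2 * x) / (2 * x)) - \<phi> x / x) \<longlongrightarrow> 2 * c - c) (at_right 0)"
    by (intro tendsto_intros lim)
  then have up: "((\<lambda>x. 2 * (\<phi> (2 * x) / (2 * x)) - \<phi> x / x) \<longlongrightarrow> c) (at_right 0)" by simp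
  have "(deriv \<phi> \<longlongrightarrow> c) (at_right 0)"
  proof (rule tendsto_sandwich[OF _ _ lim up])
    show "\<forall>\<^sub>F x in at_right 0. \<phi> x / x \<le> deriv \<phi> x"
      using eventually_at_right_less[of "0::real"] by eventually_elim (rule lower)
    show "\<forall>\<^sub>F x in at_right 0. deriv \<phi> x \<le> 2 * (\<phi> (2 * x) / (2 * x)) - \<phi> x / x"
      using eventually_at_right_less[of "0::real"] by eventually_elim (rule upper)
  qed
  then show ?thesis unfolding derivative_at_0_plus_def by (intro tendsto_Lim) auto
qed

end

section \<open>The Laplace transform in the starting point\<close>

lemma nn_integral_exp_unit:
  fixes c :: real
  assumes c: "c > 0"
  shows "(\<integral>\<^sup>+s. ennreal (exp (s * c)) * indicator {0..<1} s \<partial>lborel) = ennreal ((exp c - 1) / c)"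
proof -
  have "(\<integral>\<^sup>+s. ennreal (exp (s * c)) * indicator {0..<1} s \<partial>lborel) =
      (\<integral>\<^sup>+s. ennreal (exp (s * c)) * indicator {0..1} s \<partial>lborel)"
    using AE_lborel_singleton[of "1::real"] by (intro nn_integral_cong_AE) (auto split: split_indicator)
  also have "\<dots> = ennreal (exp (1 * c) / c - exp (0 * c) / c)"
    by (rule nn_integral_FTC_Icc) (use c in \<open>auto intro!: derivative_eq_intros\<close>)
  finally show ?thesis by (simp add: diff_divide_distrib)
qed

context regular_levy
begin

text \<open>Under the bilateral Laplace transform the semigroup of \<open>X\<close> acts by multiplication.\<close>

lemma nn_integral_semigroup:
  fixes g :: "real \<Rightarrow> ennreal"
  assumes g[measurable]: "g \<in> borel_measurable borel" and s: "s \<ge> 0" and l: "l \<ge> 0"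
  shows "(\<integral>\<^sup>+x. ennreal (exp (- l * x)) * (\<integral>\<^sup>+\<omega>. g (x + X s \<omega>) \<partial>M) \<partial>lborel) =
    ennreal (exp (s * \<phi> l)) * (\<integral>\<^sup>+z. ennreal (exp (- l * z)) * g z \<partial>lborel)"
proof -
  note [measurable] = X_measurable[OF s]
  interpret P: pair_sigma_finite lborel M ..
  have inner: "(\<integral>\<^sup>+x. ennreal (exp (- l * x)) * g (x + y) \<partial>lborel) =
      ennreal (exp (l * y)) * (\<integral>\<^sup>+z. ennreal (exp (- l * z)) * g z \<partial>lborel)" for y
  proof -
    have "(\<integral>\<^sup>+x. ennreal (exp (- l * x)) * g (x + y) \<partial>lborel) =
        (\<integral>\<^sup>+z. ennreal (exp (- l * (z - y))) * g z \<partial>lborel)"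
      by (subst nn_integral_real_affine[where c = 1 and t = y and f = "\<lambda>z. ennreal (exp (- l * (z - y))) * g z"])
         (auto simp: add.commute)
    also have "\<dots> = (\<integral>\<^sup>+z. ennreal (exp (l * y)) * (ennreal (exp (- l * z)) * g z) \<partial>lborel)"
    proof (rule nn_integral_cong)
      fix z
      have "exp (- l * (z - y)) = exp (l * y) * exp (- l * z)" by (simp add: algebra_simps flip: exp_add)
      then show "ennreal (exp (- l * (z - y))) * g z = ennreal (exp (l * y)) * (ennreal (exp (- l * z)) * g z)"
        by (simp only: ennreal_mult exp_ge_zero mult.assoc)
    qed
    finally show ?thesis by (simp add: nn_integral_cmult)
  qed
  have "(\<integral>\<^sup>+x. ennreal (exp (- l * x)) * (\<integral>\<^sup>+\<omega>. g (x + X s \<omega>) \<partial>M) \<partial>lborel) =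
      (\<integral>\<^sup>+x. \<integral>\<^sup>+\<omega>. ennreal (exp (- l * x)) * g (x + X s \<omega>) \<partial>M \<partial>lborel)"
    by (intro nn_integral_cong nn_integral_cmult[symmetric]) measurable
  also have "\<dots> = (\<integral>\<^sup>+\<omega>. \<integral>\<^sup>+x. ennreal (exp (- l * x)) * g (x + X s \<omega>) \<partial>lborel \<partial>M)"
    by (rule P.Fubini'[symmetric]) measurable
  also have "\<dots> = (\<integral>\<^sup>+\<omega>. ennreal (exp (l * X s \<omega>)) \<partial>M) * (\<integral>\<^sup>+z. ennreal (exp (- l * z)) * g z \<partial>lborel)"
    unfolding inner by (rule nn_integral_multc) measurable
  also have "(\<integral>\<^sup>+\<omega>. ennreal (exp (l * X s \<omega>)) \<partial>M) = ennreal (exp (s * \<phi> l))"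
    using nn_integral_eq_integral[OF exp_integrable[OF s l]] exp_integral[OF s l] by simp
  finally show ?thesis .
qed

text \<open>All terms are nonnegative, so in \<open>ennreal\<close> the transform can be taken and
  integrals exchanged before anything is known to be finite. The time \<open>1\<close> is an
  arbitrary positive choice.\<close>

lemma transform_kac_nn:
  assumes \<beta>: "\<beta> \<ge> 0"
  shows "(\<integral>\<^sup>+\<omega>. ennreal (transform \<beta> (x + X 1 \<omega>)) \<partial>M) = ennreal (transform \<beta> x) +
    ennreal \<beta> * (\<integral>\<^sup>+s. (\<integral>\<^sup>+\<omega>. ennreal (indicator {..<0} (x + X (max 0 s) \<omega>) * transform \<beta> (x + X (max 0 s) \<omega>)) \<partial>M) *
      indicator {0..<1} s \<partial>lborel)"
proof -
  let ?f = "transform \<beta>"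
  have f01: "0 \<le> ?f x" "?f x \<le> 1" for x using transform_pos[OF \<beta>, of x] transform_le_1[OF \<beta>, of x] by auto
  note fm[measurable] = transform_measurable[OF \<beta>]
  let ?I = "\<lambda>s. \<integral>\<omega>. indicator {..<0} (x + X s \<omega>) * ?f (x + X s \<omega>) \<partial>M"
  note K = transform_kac[OF \<beta>, of 1 x, simplified]
  have I_int: "integrable M (\<lambda>\<omega>. ?f (x + X s \<omega>))"
      "integrable M (\<lambda>\<omega>. indicator {..<0} (x + X s \<omega>) * ?f (x + X s \<omega>))" if "s \<ge> 0" for s
  proof -
    note [measurable] = X_measurable[OF that]
    show "integrable M (\<lambda>\<omega>. ?f (x + X s \<omega>))"
      by (rule integrable_bounded[where B = 1]) (use f01 in auto)
    show "integrable M (\<lambda>\<omega>. indicator {..<0} (x + X s \<omega>) * ?f (x + X s \<omega>))"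
      by (rule integrable_bounded[where B = 1]) (use f01 in \<open>auto split: split_indicator\<close>)
  qed
  have I0: "?I s \<ge> 0" for s using f01 by (intro integral_nonneg_AE) auto
  have J0: "(\<integral>s. indicator {0..<1} s * ?I s \<partial>lborel) \<ge> 0" using I0 by (intro integral_nonneg_AE) auto
  have "(\<integral>\<^sup>+\<omega>. ennreal (?f (x + X 1 \<omega>)) \<partial>M) = ennreal (\<integral>\<omega>. ?f (x + X 1 \<omega>) \<partial>M)"
    using I_int(1)[of 1] f01 by (intro nn_integral_eq_integral) auto
  also have "\<dots> = ennreal (?f x) + ennreal \<beta> * ennreal (\<integral>s. indicator {0..<1} s * ?I s \<partial>lborel)"
    using transform_kac(2)[OF \<beta>, of 1 x] f01 \<beta> J0 by (simp add: ennreal_mult)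
  also have "ennreal (\<integral>s. indicator {0..<1} s * ?I s \<partial>lborel) = (\<integral>\<^sup>+s. ennreal (indicator {0..<1} s * ?I s) \<partial>lborel)"
    using transform_kac(1)[OF \<beta>, of 1 x] I0 by (intro nn_integral_eq_integral[symmetric]) auto
  also have "\<dots> = (\<integral>\<^sup>+s. (\<integral>\<^sup>+\<omega>. ennreal (indicator {..<0} (x + X (max 0 s) \<omega>) * ?f (x + X (max 0 s) \<omega>)) \<partial>M) *
      indicator {0..<1} s \<partial>lborel)"
  proof (rule nn_integral_cong)
    fix s
    show "ennreal (indicator {0..<1} s * ?I s) =
        (\<integral>\<^sup>+\<omega>. ennreal (indicator {..<0} (x + X (max 0 s) \<omega>) * ?f (x + X (max 0 s) \<omega>)) \<partial>M) * indicator {0..<1} s"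
    proof (cases "s \<in> {0..<1}")
      case True
      then have "max 0 s = s" by simp
      then show ?thesis
        using True nn_integral_eq_integral[OF I_int(2)[of s]] f01 by simp
    qed simp
  qed
  finally show ?thesis .
qed

text \<open>Let \<open>A\<close> be the bilateral transform, \<open>B\<close> its part on the
  negative half-line and \<open>c = \<phi> l\<close>. Kac's equation at time \<open>1\<close>
  becomes \<open>exp c * A = A + \<beta> * ((exp c - 1) / c) * B\<close>, hence
  \<open>A = \<beta> / c * B\<close>, and the claim is about \<open>A - B\<close>. The condition
  \<open>l < \<theta>\<close> makes \<open>B\<close> finite, and \<open>l > 0\<close> does so for
  the rest.\<close>

lemma transform_laplace:
  assumes \<beta>: "\<beta> > 0" and \<theta>: "\<theta> > 0" "\<And>x. x < 0 \<Longrightarrow> transform \<beta> x = C * exp (\<theta> * x)" and C: "C \<ge> 0"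
    and l: "0 < l" "l < \<theta>"
  shows "(\<integral>\<^sup>+x. ennreal (exp (- l * x) * transform \<beta> x) * indicator {0..} x \<partial>lborel) =
    ennreal (C / (\<theta> - l) * (\<beta> / \<phi> l - 1))" (is "?P = _")
    and "C / (\<theta> - l) * (\<beta> / \<phi> l - 1) \<ge> 0"
proof -
  have b: "\<beta> \<ge> 0" using \<beta> by simp
  let ?f = "transform \<beta>"
  have f01: "0 \<le> ?f x" "?f x \<le> 1" for x using transform_pos[OF b, of x] transform_le_1[OF b, of x] by auto
  note fm[measurable] = transform_measurable[OF b]
  note [measurable] = X_joint
  define g where "g z = ennreal (indicator {..<0} z * ?f z)" for z
  have gm[measurable]: "g \<in> borel_measurable borel" unfolding g_def by measurable
  define A where "A = (\<integral>\<^sup>+x. ennreal (exp (- l * x)) * ennreal (?f x) \<partial>lborel)"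
  define B where "B = (\<integral>\<^sup>+x. ennreal (exp (- l * x)) * g x \<partial>lborel)"
  define c where "c = \<phi> l"
  have c: "c > 0" unfolding c_def by (rule phi_pos[OF l(1)])
  let ?h = "\<lambda>x s. (\<integral>\<^sup>+\<omega>. g (x + X (max 0 s) \<omega>) \<partial>M)"
  have hm[measurable]: "(\<lambda>(x, s). ?h x s) \<in> borel_measurable (borel \<Otimes>\<^sub>M borel)"
  proof -
    have "(\<lambda>z. (snd (fst z), snd z)) \<in> measurable ((borel \<Otimes>\<^sub>M borel) \<Otimes>\<^sub>M M) (borel \<Otimes>\<^sub>M M)" by measurable
    from measurable_compose[OF this X_joint]
    have [measurable]: "(\<lambda>z. X (max 0 (snd (fst z))) (snd z)) \<in> borel_measurable ((borel \<Otimes>\<^sub>M borel) \<Otimes>\<^sub>M M)"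
      by simp
    have "(\<lambda>z. g (fst (fst z) + X (max 0 (snd (fst z))) (snd z))) \<in> borel_measurable ((borel \<Otimes>\<^sub>M borel) \<Otimes>\<^sub>M M)"
      by measurable
    then show ?thesis by (simp add: split_beta' borel_measurable_nn_integral)
  qed
  have "(\<integral>\<^sup>+x. ennreal (exp (- l * x)) * (\<integral>\<^sup>+\<omega>. ennreal (?f (x + X 1 \<omega>)) \<partial>M) \<partial>lborel) = ennreal (exp c) * A"
    unfolding A_def c_def using nn_integral_semigroup[of "\<lambda>z. ennreal (?f z)" 1 l] l by simp
  moreover have "(\<integral>\<^sup>+x. ennreal (exp (- l * x)) * (\<integral>\<^sup>+\<omega>. ennreal (?f (x + X 1 \<omega>)) \<partial>M) \<partial>lborel) =
      A + ennreal \<beta> * (ennreal ((exp c - 1) / c) * B)"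
  proof -
    have "(\<integral>\<^sup>+x. ennreal (exp (- l * x)) * (\<integral>\<^sup>+\<omega>. ennreal (?f (x + X 1 \<omega>)) \<partial>M) \<partial>lborel) =
        (\<integral>\<^sup>+x. ennreal (exp (- l * x)) * ennreal (?f x) +
          ennreal \<beta> * (ennreal (exp (- l * x)) * (\<integral>\<^sup>+s. ?h x s * indicator {0..<1} s \<partial>lborel)) \<partial>lborel)"
      unfolding transform_kac_nn[OF b] g_def by (intro nn_integral_cong) (simp add: distrib_left mult_ac)
    also have "\<dots> = A + ennreal \<beta> * (\<integral>\<^sup>+x. ennreal (exp (- l * x)) * (\<integral>\<^sup>+s. ?h x s * indicator {0..<1} s \<partial>lborel) \<partial>lborel)"
      unfolding A_def by (subst nn_integral_add) (auto simp: nn_integral_cmult)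
    also have "(\<integral>\<^sup>+x. ennreal (exp (- l * x)) * (\<integral>\<^sup>+s. ?h x s * indicator {0..<1} s \<partial>lborel) \<partial>lborel) =
        (\<integral>\<^sup>+x. \<integral>\<^sup>+s. ennreal (exp (- l * x)) * (?h x s * indicator {0..<1} s) \<partial>lborel \<partial>lborel)"
      by (intro nn_integral_cong nn_integral_cmult[symmetric]) measurable
    also have "\<dots> = (\<integral>\<^sup>+s. \<integral>\<^sup>+x. ennreal (exp (- l * x)) * (?h x s * indicator {0..<1} s) \<partial>lborel \<partial>lborel)"
      by (rule lborel_pair.Fubini'[symmetric]) measurable
    also have "\<dots> = (\<integral>\<^sup>+s. (ennreal (exp (s * c)) * indicator {0..<1} s) * B \<partial>lborel)"
    proof (rule nn_integral_cong)
      fix s :: real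
      have "(\<integral>\<^sup>+x. ennreal (exp (- l * x)) * (?h x s * indicator {0..<1} s) \<partial>lborel) =
          (\<integral>\<^sup>+x. ennreal (exp (- l * x)) * ?h x s \<partial>lborel) * indicator {0..<1} s"
        by (subst nn_integral_multc[symmetric]) (auto simp: mult.assoc)
      also have "(\<integral>\<^sup>+x. ennreal (exp (- l * x)) * ?h x s \<partial>lborel) = ennreal (exp (max 0 s * c)) * B"
        unfolding B_def c_def using l by (intro nn_integral_semigroup) auto
      finally show "(\<integral>\<^sup>+x. ennreal (exp (- l * x)) * (?h x s * indicator {0..<1} s) \<partial>lborel) =
          (ennreal (exp (s * c)) * indicator {0..<1} s) * B"
        by (auto simp: mult_ac split: split_indicator)
    qed
    also have "\<dots> = ennreal ((exp c - 1) / c) * B"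
      by (subst nn_integral_multc) (auto simp: nn_integral_exp_unit[OF c])
    finally show ?thesis .
  qed
  ultimately have eq: "ennreal (exp c) * A = A + ennreal \<beta> * (ennreal ((exp c - 1) / c) * B)" by simp
  have d: "\<theta> - l > 0" using l by simp
  have B_val: "B = ennreal (C / (\<theta> - l))"
  proof -
    have "B = (\<integral>\<^sup>+x. ennreal C * (ennreal (exp ((\<theta> - l) * x)) * indicator {..<0} x) \<partial>lborel)"
      unfolding B_def g_def
    proof (rule nn_integral_cong)
      fix x :: real
      show "ennreal (exp (- l * x)) * ennreal (indicator {..<0} x * ?f x) =
          ennreal C * (ennreal (exp ((\<theta> - l) * x)) * indicator {..<0} x)"
      proof (cases "x < 0")
        case True
        have "exp (- l * x) * (C * exp (\<theta> * x)) = C * exp ((\<theta> - l) * x)"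
          by (simp add: algebra_simps flip: exp_add)
        then have "ennreal (exp (- l * x)) * ennreal (C * exp (\<theta> * x)) = ennreal C * ennreal (exp ((\<theta> - l) * x))"
          using C by (simp only: ennreal_mult[symmetric] exp_ge_zero mult_nonneg_nonneg)
        then show ?thesis using True by (simp add: \<theta>(2))
      qed simp
    qed
    also have "\<dots> = ennreal C * ennreal (1 / (\<theta> - l))"
      by (subst nn_integral_cmult) (auto simp: nn_integral_exp_negative[OF d])
    finally show ?thesis using C d by (simp add: ennreal_mult[symmetric])
  qed
  have A_split: "A = ?P + B"
  proof -
    have "A = (\<integral>\<^sup>+x. ennreal (exp (- l * x) * ?f x) * indicator {0..} x + ennreal (exp (- l * x)) * g x \<partial>lborel)"
      unfolding A_def g_def using f01
      by (intro nn_integral_cong) (auto simp: ennreal_mult split: split_indicator)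
    then show ?thesis unfolding B_def by (subst (asm) nn_integral_add) auto
  qed
  \<comment> \<open>Finiteness has to be secured before the equation is moved from
    \<open>ennreal\<close> to the reals, where subtraction is meaningful.\<close>
  have "?P \<le> (\<integral>\<^sup>+x. ennreal (exp (- l * x)) * indicator {0..} x \<partial>lborel)"
    using f01 by (intro nn_integral_mono) (auto split: split_indicator intro!: ennreal_leI mult_left_le)
  also have "\<dots> < \<infinity>" using nn_integral_exp_tail[OF l(1), of 0] by simp
  finally have "?P \<noteq> \<infinity>" by simp
  then obtain p where p: "?P = ennreal p" "p \<ge> 0" by (cases ?P) auto
  let ?B = "C / (\<theta> - l)"
  have B0: "?B \<ge> 0" using C d by simp
  have e0: "(exp c - 1) / c \<ge> 0" using c by simp
  have "ennreal (exp c * (p + ?B)) = ennreal (p + ?B + \<beta> * ((exp c - 1) / c * ?B))"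
  proof -
    have lhs: "ennreal a * (ennreal x + ennreal y) = ennreal (a * (x + y))"
      and rhs: "ennreal x + ennreal y + ennreal a * (ennreal e * ennreal y) = ennreal (x + y + a * (e * y))"
      if "0 \<le> a" "0 \<le> e" "0 \<le> x" "0 \<le> y" for a e x y
      using that by (simp_all add: ennreal_mult ennreal_plus)
    show ?thesis
      using eq unfolding A_split B_val p(1) lhs[OF exp_ge_zero e0 p(2) B0] rhs[OF b e0 p(2) B0] .
  qed
  then have "exp c * (p + ?B) = p + ?B + \<beta> * ((exp c - 1) / c * ?B)"
    by (rule ennreal_inj[THEN iffD1, rotated 2])
       (intro add_nonneg_nonneg mult_nonneg_nonneg exp_ge_zero p(2) B0 e0 b)+
  \<comment> \<open>The common factor is nonzero because \<open>c > 0\<close>; cancelling it removes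
    the dependence on the chosen time.\<close>
  then have "(exp c - 1) * (p + ?B) = (exp c - 1) * (\<beta> / c * ?B)" by (simp add: algebra_simps diff_divide_distrib)
  moreover have "exp c - 1 \<noteq> 0" using c by simp
  ultimately have "p + ?B = \<beta> / c * ?B" using mult_left_cancel by blast
  then have "p = ?B * (\<beta> / c - 1)"
    unfolding right_diff_distrib mult_1_right mult.commute[of ?B "\<beta> / c"] by linarith
  then show "?P = ennreal (?B * (\<beta> / \<phi> l - 1))" "?B * (\<beta> / \<phi> l - 1) \<ge> 0"
    using p by (simp_all add: c_def)
qed

text \<open>The half-line transform of \<open>transform \<beta>\<close> stays bounded as \<open>l\<close> increases to the decay rate
  \<open>\<theta>\<close>, so the pole at \<open>\<theta>\<close> must cancel: \<open>\<phi> \<theta> = \<beta>\<close>. As \<open>l\<close> decreases to \<open>0\<close> it behaves like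
  \<open>1 / l\<close>, which fixes the constant \<open>transform \<beta> 0\<close>.\<close>

lemma transform_constants:
  assumes \<beta>: "\<beta> > 0" and \<theta>: "\<theta> > 0" "\<And>x. x < 0 \<Longrightarrow> transform \<beta> x = transform \<beta> 0 * exp (\<theta> * x)"
  shows "\<phi> \<theta> = \<beta>" and "((\<lambda>l. \<phi> l / l) \<longlongrightarrow> transform \<beta> 0 * \<beta> / \<theta>) (at_right 0)"
proof -
  have b: "\<beta> \<ge> 0" using \<beta> by simp
  let ?f = "transform \<beta>" let ?C = "transform \<beta> 0"
  note f0 = transform_pos[OF b] and f1 = transform_le_1[OF b]
  have C: "?C \<ge> 0" "?C > 0" using f0[of 0] by auto
  define p where "p l = ?C / (\<theta> - l) * (\<beta> / \<phi> l - 1)" for l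
  have L: "(\<integral>\<^sup>+x. ennreal (exp (- l * x) * ?f x) * indicator {0..} x \<partial>lborel) = ennreal (p l)" "p l \<ge> 0"
    if "0 < l" "l < \<theta>" for l
    using transform_laplace[OF \<beta> \<theta> C(1) that] by (auto simp: p_def)
  have p_le: "p l \<le> 1 / l" if l: "0 < l" "l < \<theta>" for l
  proof -
    have "ennreal (p l) \<le> (\<integral>\<^sup>+x. ennreal (exp (- l * x)) * indicator {0..} x \<partial>lborel)"
      unfolding L(1)[OF l, symmetric] using f0 f1 by (intro nn_integral_mono) (auto split: split_indicator intro!: ennreal_leI mult_left_le)
    then show ?thesis using nn_integral_exp_tail[OF l(1), of 0] l by (simp add: ennreal_le_iff)
  qed
  \<comment> \<open>By monotonicity \<open>transform \<beta>\<close> is at least its value at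
    \<open>K\<close> on all of \<open>{K..}\<close>; the part of the integral before
    \<open>K\<close> is dropped.\<close>
  have p_ge: "?f K * exp (- l * K) / l \<le> p l" if l: "0 < l" "l < \<theta>" and K: "K \<ge> 0" for l K
  proof -
    have "ennreal (?f K) * (\<integral>\<^sup>+x. ennreal (exp (- l * x)) * indicator {K..} x \<partial>lborel) =
        (\<integral>\<^sup>+x. ennreal (?f K) * (ennreal (exp (- l * x)) * indicator {K..} x) \<partial>lborel)"
      by (rule nn_integral_cmult[symmetric]) auto
    also have "\<dots> \<le> (\<integral>\<^sup>+x. ennreal (exp (- l * x) * ?f x) * indicator {0..} x \<partial>lborel)"
    proof (rule nn_integral_mono)
      fix x
      have "?f K * exp (- l * x) \<le> exp (- l * x) * ?f x" if "K \<le> x"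
        using transform_mono[OF b that] by simp
      then show "ennreal (?f K) * (ennreal (exp (- l * x)) * indicator {K..} x) \<le> ennreal (exp (- l * x) * ?f x) * indicator {0..} x"
        using K f0[of K] by (auto split: split_indicator simp: ennreal_mult[symmetric] less_imp_le intro!: ennreal_leI)
    qed
    finally have "ennreal (?f K) * ennreal (exp (- l * K) / l) \<le> ennreal (p l)"
      unfolding nn_integral_exp_tail[OF l(1)] L(1)[OF l] .
    then have "ennreal (?f K * (exp (- l * K) / l)) \<le> ennreal (p l)"
      by (simp only: ennreal_mult[OF less_imp_le[OF f0[of K]] divide_nonneg_nonneg[OF exp_ge_zero less_imp_le[OF l(1)]]])
    then show ?thesis using L(2)[OF l] by (simp add: ennreal_le_iff)
  qed
  have rel: "\<beta> / \<phi> l = 1 + (\<theta> - l) * p l / ?C" if "0 < l" "l < \<theta>" for l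
    using that C by (simp add: p_def)
  show "\<phi> \<theta> = \<beta>"
  proof -
    have cont: "(\<phi> \<longlongrightarrow> \<phi> \<theta>) (at_left \<theta>)"
      using DERIV_isCont[OF phi_differentiable[OF \<theta>(1)]] by (auto simp: isCont_def intro: tendsto_mono[OF at_le])
    \<comment> \<open>Staying to the right of \<open>\<theta> / 2\<close> keeps \<open>p l\<close>
      below \<open>2 / \<theta>\<close>, so the factor \<open>\<theta> - l\<close> forces the
      product to \<open>0\<close>.\<close>
    have ev: "eventually (\<lambda>l. l \<in> {\<theta> / 2<..<\<theta>}) (at_left \<theta>)" using \<theta>(1) by (intro eventually_at_left_real) auto
    have "((\<lambda>l. (\<theta> - l) * p l / ?C) \<longlongrightarrow> 0) (at_left \<theta>)"
    proof (rule tendsto_sandwich[OF _ _ tendsto_const])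
      have "((\<lambda>l. (\<theta> - l) * (2 / \<theta>) / ?C) \<longlongrightarrow> (\<theta> - \<theta>) * (2 / \<theta>) / ?C) (at_left \<theta>)"
        using C by (intro tendsto_intros) auto
      then show "((\<lambda>l. (\<theta> - l) * (2 / \<theta>) / ?C) \<longlongrightarrow> 0) (at_left \<theta>)" by simp
      show "eventually (\<lambda>l. 0 \<le> (\<theta> - l) * p l / ?C) (at_left \<theta>)"
        using ev by eventually_elim (use C L(2) \<theta>(1) in auto)
      show "eventually (\<lambda>l. (\<theta> - l) * p l / ?C \<le> (\<theta> - l) * (2 / \<theta>) / ?C) (at_left \<theta>)"
        using ev
      proof eventually_elim
        case (elim l)
        then have l: "0 < l" "l < \<theta>" using \<theta>(1) by auto
        have "p l \<le> 1 / l" by (rule p_le[OF l])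
        also have "\<dots> \<le> 2 / \<theta>" using elim l \<theta>(1) by (simp add: field_simps)
        finally show ?case using l C by (intro divide_right_mono mult_left_mono) auto
      qed
    qed
    then have "((\<lambda>l. 1 + (\<theta> - l) * p l / ?C) \<longlongrightarrow> 1 + 0) (at_left \<theta>)" by (intro tendsto_intros)
    moreover have "eventually (\<lambda>l. 1 + (\<theta> - l) * p l / ?C = \<beta> / \<phi> l) (at_left \<theta>)"
      using ev by eventually_elim (use rel \<theta>(1) in auto)
    ultimately have "((\<lambda>l. \<beta> / \<phi> l) \<longlongrightarrow> 1 + 0) (at_left \<theta>)" by (rule Lim_transform_eventually)
    moreover have "((\<lambda>l. \<beta> / \<phi> l) \<longlongrightarrow> \<beta> / \<phi> \<theta>) (at_left \<theta>)"
      using phi_pos[OF \<theta>(1)] by (intro tendsto_intros cont) auto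
    ultimately have "\<beta> / \<phi> \<theta> = 1 + 0" by (intro tendsto_unique[of "at_left \<theta>"]) (auto simp: trivial_limit_at_left_real)
    then show ?thesis using phi_pos[OF \<theta>(1)] by (simp add: field_simps)
  qed
  have ev: "eventually (\<lambda>l. l \<in> {0<..<\<theta>}) (at_right 0)" using \<theta>(1) by (intro eventually_at_right_real) auto
  have lp: "((\<lambda>l. l * p l) \<longlongrightarrow> 1) (at_right 0)"
  proof (rule order_tendstoI)
    fix a :: real assume a: "a < 1"
    \<comment> \<open>First a level \<open>n\<close> is fixed at which
      \<open>transform \<beta>\<close> exceeds \<open>a\<close>; only then does \<open>l\<close>
      tend to \<open>0\<close>, which removes the factor \<open>exp (- l * real n)\<close>.\<close>
    have "eventually (\<lambda>n. a < ?f (real n)) sequentially" using transform_at_infinity[OF b] a by (rule order_tendstoD(1))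
    then obtain n where n: "a < ?f (real n)" by (auto simp: eventually_sequentially)
    have "((\<lambda>l. ?f (real n) * exp (- l * real n)) \<longlongrightarrow> ?f (real n) * exp (- 0 * real n)) (at_right 0)"
      by (intro tendsto_intros)
    then have "eventually (\<lambda>l. a < ?f (real n) * exp (- l * real n)) (at_right 0)"
      using n by (intro order_tendstoD(1)) auto
    then show "eventually (\<lambda>l. a < l * p l) (at_right 0)"
      using ev
    proof eventually_elim
      case (elim l)
      then show ?case using p_ge[of l "real n"] by (simp add: field_simps)
    qed
  next
    fix a :: real assume a: "1 < a"
    show "eventually (\<lambda>l. l * p l < a) (at_right 0)"
      using ev
    proof eventually_elim
      case (elim l)
      then show ?case using p_le[of l] a by (simp add: field_simps)
    qed
  qed
  \<comment> \<open>This is \<open>l\<close> times the identity \<open>rel\<close>; with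
    \<open>l * p l\<close> tending to \<open>1\<close> it determines the limit of
    \<open>\<beta> / (\<phi> l / l)\<close>.\<close>
  have "((\<lambda>l. l + (\<theta> - l) * (l * p l) / ?C) \<longlongrightarrow> 0 + (\<theta> - 0) * 1 / ?C) (at_right 0)"
    using C by (intro tendsto_intros lp) auto
  moreover have "eventually (\<lambda>l. l + (\<theta> - l) * (l * p l) / ?C = \<beta> / (\<phi> l / l)) (at_right 0)"
    using ev
  proof eventually_elim
    case (elim l)
    then have "\<beta> / (\<phi> l / l) = l * (\<beta> / \<phi> l)" by simp
    also have "\<dots> = l * (1 + (\<theta> - l) * p l / ?C)" using rel[of l] elim by simp
    finally show ?case by (simp add: algebra_simps)
  qed
  ultimately have "((\<lambda>l. \<beta> / (\<phi> l / l)) \<longlongrightarrow> 0 + (\<theta> - 0) * 1 / ?C) (at_right 0)" by (rule Lim_transform_eventually)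
  then have "((\<lambda>l. \<beta> / (\<beta> / (\<phi> l / l))) \<longlongrightarrow> \<beta> / (0 + (\<theta> - 0) * 1 / ?C)) (at_right 0)"
    using \<theta>(1) C by (intro tendsto_intros) auto
  then show "((\<lambda>l. \<phi> l / l) \<longlongrightarrow> ?C * \<beta> / \<theta>) (at_right 0)"
    using \<beta> by (simp add: mult.commute)
qed

end

section \<open>Comparison with the scale function\<close>

lemma nn_integral_exp_interval:
  fixes k b :: real
  assumes k: "k > 0" and b: "b \<ge> 0"
  shows "(\<integral>\<^sup>+x. ennreal (exp (k * x)) * indicator {0..b} x \<partial>lborel) = ennreal ((exp (k * b) - 1) / k)"
proof -
  have "(\<integral>\<^sup>+x. ennreal (exp (k * x)) * indicator {0..b} x \<partial>lborel) = ennreal (exp (k * b) / k - exp (k * 0) / k)"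
    by (rule nn_integral_FTC_Icc) (use k b in \<open>auto intro!: derivative_eq_intros\<close>)
  then show ?thesis by (simp add: diff_divide_distrib)
qed

text \<open>Tonelli over the region \<open>0 \<le> x \<le> y\<close>: the inner integral of
  \<open>exp ((\<theta> - l) * x)\<close> up to \<open>y\<close> is elementary, and multiplied by
  \<open>exp (- \<theta> * y)\<close> it leaves the difference of the two exponentials.\<close>

lemma laplace_exp_tail_integral:
  fixes w :: "real \<Rightarrow> real"
  assumes w0: "\<And>y. w y \<ge> 0" "\<And>y. y < 0 \<Longrightarrow> w y = 0"
    and int: "\<And>a. a > 0 \<Longrightarrow> integrable lborel (\<lambda>y. exp (- a * y) * w y)"
    and l: "0 < l" "l < \<theta>"
  shows "(\<integral>\<^sup>+x. ennreal (exp (- l * x) * (exp (\<theta> * x) * (\<integral>y. indicator {x..} y * (exp (- \<theta> * y) * w y) \<partial>lborel))) * indicator {0..} x \<partial>lborel)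
    = ennreal ((laplace w l - laplace w \<theta>) / (\<theta> - l))"
proof -
  have th: "\<theta> > 0" and d: "\<theta> - l > 0" using l by auto
  let ?v = "\<lambda>y. exp (- \<theta> * y) * w y"
  have vm[measurable]: "?v \<in> borel_measurable borel" using int[OF th] by simp
  have v0: "?v y \<ge> 0" for y using w0 by simp
  have iv: "integrable lborel (\<lambda>y. indicator {x..} y * ?v y)" for x
  proof (rule Bochner_Integration.integrable_bound[OF int[OF th]])
    show "(\<lambda>y. indicator {x..} y * ?v y) \<in> borel_measurable lborel" by measurable
    show "AE y in lborel. norm (indicator {x..} y * ?v y) \<le> norm (?v y)"
      by (intro AE_I2) (simp add: indicator_def)
  qed
  have I_nn: "ennreal (\<integral>y. indicator {x..} y * ?v y \<partial>lborel) = (\<integral>\<^sup>+y. ennreal (?v y) * indicator {x..} y \<partial>lborel)" for x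
  proof -
    have "ennreal (\<integral>y. indicator {x..} y * ?v y \<partial>lborel) = (\<integral>\<^sup>+y. ennreal (indicator {x..} y * ?v y) \<partial>lborel)"
      using iv v0 by (intro nn_integral_eq_integral[symmetric]) auto
    also have "\<dots> = (\<integral>\<^sup>+y. ennreal (?v y) * indicator {x..} y \<partial>lborel)"
      by (intro nn_integral_cong) (auto split: split_indicator)
    finally show ?thesis .
  qed
  have "(\<integral>\<^sup>+x. ennreal (exp (- l * x) * (exp (\<theta> * x) * (\<integral>y. indicator {x..} y * ?v y \<partial>lborel))) * indicator {0..} x \<partial>lborel) =
      (\<integral>\<^sup>+x. \<integral>\<^sup>+y. (ennreal (exp ((\<theta> - l) * x)) * indicator {0..} x) * (ennreal (?v y) * indicator {x..} y) \<partial>lborel \<partial>lborel)"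
  proof (rule nn_integral_cong)
    fix x :: real
    have "exp (- l * x) * (exp (\<theta> * x) * c) = exp ((\<theta> - l) * x) * c" for c
      by (simp add: algebra_simps flip: exp_add)
    then have "ennreal (exp (- l * x) * (exp (\<theta> * x) * (\<integral>y. indicator {x..} y * ?v y \<partial>lborel))) =
        ennreal (exp ((\<theta> - l) * x)) * (\<integral>\<^sup>+y. ennreal (?v y) * indicator {x..} y \<partial>lborel)"
      unfolding I_nn[symmetric] by (simp only: ennreal_mult' exp_ge_zero)
    then have "ennreal (exp (- l * x) * (exp (\<theta> * x) * (\<integral>y. indicator {x..} y * ?v y \<partial>lborel))) * indicator {0..} x =
        (ennreal (exp ((\<theta> - l) * x)) * indicator {0..} x) * (\<integral>\<^sup>+y. ennreal (?v y) * indicator {x..} y \<partial>lborel)"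
      by (simp only: mult_ac)
    also have "\<dots> = (\<integral>\<^sup>+y. (ennreal (exp ((\<theta> - l) * x)) * indicator {0..} x) * (ennreal (?v y) * indicator {x..} y) \<partial>lborel)"
      by (rule nn_integral_cmult[symmetric]) measurable
    finally show "ennreal (exp (- l * x) * (exp (\<theta> * x) * (\<integral>y. indicator {x..} y * ?v y \<partial>lborel))) * indicator {0..} x = \<dots>" .
  qed
  also have "\<dots> = (\<integral>\<^sup>+y. \<integral>\<^sup>+x. (ennreal (exp ((\<theta> - l) * x)) * indicator {0..} x) * (ennreal (?v y) * indicator {x..} y) \<partial>lborel \<partial>lborel)"
  proof (rule lborel_pair.Fubini'[symmetric])
    have "(\<lambda>z. (ennreal (exp ((\<theta> - l) * fst z)) * indicator {0..} (fst z)) * (if fst z \<le> snd z then ennreal (?v (snd z)) else 0)) \<in> borel_measurable (lborel \<Otimes>\<^sub>M lborel)"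
      by measurable
    then show "(\<lambda>(x, y). (ennreal (exp ((\<theta> - l) * x)) * indicator {0..} x) * (ennreal (?v y) * indicator {x..} y)) \<in> borel_measurable (lborel \<Otimes>\<^sub>M lborel)"
      by (rule measurable_cong[THEN iffD1, rotated]) (auto split: split_indicator)
  qed
  also have "\<dots> = (\<integral>\<^sup>+y. ennreal ((exp (- l * y) * w y - ?v y) / (\<theta> - l)) \<partial>lborel)"
  proof (rule nn_integral_cong)
    fix y :: real
    show "(\<integral>\<^sup>+x. (ennreal (exp ((\<theta> - l) * x)) * indicator {0..} x) * (ennreal (?v y) * indicator {x..} y) \<partial>lborel) =
        ennreal ((exp (- l * y) * w y - ?v y) / (\<theta> - l))"
    proof (cases "y < 0")
      case False
      have "(\<integral>\<^sup>+x. (ennreal (exp ((\<theta> - l) * x)) * indicator {0..} x) * (ennreal (?v y) * indicator {x..} y) \<partial>lborel) =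
          (\<integral>\<^sup>+x. (ennreal (exp ((\<theta> - l) * x)) * indicator {0..y} x) * ennreal (?v y) \<partial>lborel)"
        by (intro nn_integral_cong) (auto split: split_indicator)
      also have "\<dots> = ennreal ((exp ((\<theta> - l) * y) - 1) / (\<theta> - l)) * ennreal (?v y)"
        using False by (subst nn_integral_multc) (auto simp: nn_integral_exp_interval[OF d])
      also have "\<dots> = ennreal ((exp ((\<theta> - l) * y) - 1) / (\<theta> - l) * ?v y)"
        using False d v0 by (intro ennreal_mult[symmetric]) (auto intro!: divide_nonneg_nonneg)
      also have "(exp ((\<theta> - l) * y) - 1) / (\<theta> - l) * ?v y = (exp (- l * y) * w y - ?v y) / (\<theta> - l)"
      proof -
        have "exp ((\<theta> - l) * y) * ?v y = exp (- l * y) * w y"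
          by (simp add: algebra_simps flip: exp_add mult.assoc)
        then show ?thesis by (simp only: times_divide_eq_left left_diff_distrib mult_1)
      qed
      finally show ?thesis .
    qed (simp add: w0)
  qed
  also have "\<dots> = ennreal (\<integral>y. (exp (- l * y) * w y - ?v y) / (\<theta> - l) \<partial>lborel)"
  proof (rule nn_integral_eq_integral)
    show "integrable lborel (\<lambda>y. (exp (- l * y) * w y - ?v y) / (\<theta> - l))"
      by (intro integrable_divide_zero Bochner_Integration.integrable_diff int l th)
    have "?v y \<le> exp (- l * y) * w y" for y
    proof (cases "y < 0")
      case False
      then have "exp (- \<theta> * y) \<le> exp (- l * y)" using l by (simp add: mult_right_mono)
      then show ?thesis using w0(1) by (rule mult_right_mono)
    qed (simp add: w0)
    then show "AE y in lborel. 0 \<le> (exp (- l * y) * w y - ?v y) / (\<theta> - l)" using d by simp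
  qed
  also have "(\<integral>y. (exp (- l * y) * w y - ?v y) / (\<theta> - l) \<partial>lborel) =
      (laplace w l - (\<integral>y. ?v y \<partial>lborel)) / (\<theta> - l)"
    by (subst integral_divide_zero, subst Bochner_Integration.integral_diff[OF int[OF l(1)] int[OF th]]) simp
  finally show ?thesis .
qed

lemma tail_integral_right_cont:
  fixes v :: "real \<Rightarrow> real"
  assumes v: "integrable lborel v"
  shows "((\<lambda>x. \<integral>y. indicator {x..} y * v y \<partial>lborel) \<longlongrightarrow> (\<integral>y. indicator {x..} y * v y \<partial>lborel)) (at_right x)"
proof (rule tendsto_at_right_sequentially[of x "x + 1"])
  have [measurable]: "v \<in> borel_measurable borel" using v by simp
  fix s assume s: "\<And>n. x < s n" "s \<longlonglongrightarrow> x"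
  show "(\<lambda>n. \<integral>y. indicator {s n..} y * v y \<partial>lborel) \<longlonglongrightarrow> (\<integral>y. indicator {x..} y * v y \<partial>lborel)"
  proof (rule integral_dominated_convergence[where w = "\<lambda>y. \<bar>v y\<bar>"])
    show "AE y in lborel. (\<lambda>n. indicator {s n..} y * v y) \<longlonglongrightarrow> indicator {x..} y * v y"
      \<comment> \<open>At \<open>y = x\<close> the indicators are constantly \<open>0\<close> while
        their supposed limit is \<open>1\<close>; this single point is discarded.\<close>
      using AE_lborel_singleton[of x]
    proof eventually_elim
      case (elim y)
      have "eventually (\<lambda>n. indicator {s n..} y = (indicator {x..} y :: real)) sequentially"
      proof (cases "x < y")
        case True
        have "eventually (\<lambda>n. s n < y) sequentially" using s(2) True by (rule order_tendstoD(2))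
        then show ?thesis by eventually_elim (use True in auto)
      next
        case False
        then have "y < x" using elim by auto
        then have "\<not> s n \<le> y" for n using s(1)[of n] by linarith
        then show ?thesis using \<open>y < x\<close> by simp
      qed
      then show ?case by (intro tendsto_mult tendsto_const tendsto_eventually)
    qed
  qed (use v in \<open>auto split: split_indicator\<close>)
qed simp

section \<open>The constants and the scale function formula\<close>

context regular_levy
begin

lemma transform_exponent:
  assumes \<beta>: "\<beta> > 0"
  defines "\<theta> \<equiv> right_inverse_exponent \<phi> \<beta>"
  shows "\<theta> > 0" "\<phi> \<theta> = \<beta>" "\<And>x. x < 0 \<Longrightarrow> transform \<beta> x = transform \<beta> 0 * exp (\<theta> * x)"
    "transform \<beta> 0 = derivative_at_0_plus \<phi> * (\<theta> / \<beta>)"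
proof -
  obtain t where t: "t > 0" "\<And>x. x < 0 \<Longrightarrow> transform \<beta> x = transform \<beta> 0 * exp (t * x)"
    using transform_negative[OF \<beta>] by blast
  note c = transform_constants[OF \<beta> t]
  have eq: "\<theta> = t" unfolding \<theta>_def using t(1) c(1) by (rule right_inverse_exponent_eqI)
  show "\<theta> > 0" "\<phi> \<theta> = \<beta>" "\<And>x. x < 0 \<Longrightarrow> transform \<beta> x = transform \<beta> 0 * exp (\<theta> * x)"
    using t c(1) by (simp_all add: eq)
  show "transform \<beta> 0 = derivative_at_0_plus \<phi> * (\<theta> / \<beta>)"
    using derivative_at_0_plus_eqI[OF c(2)] t(1) \<beta> by (simp add: eq)
qed

text \<open>Both sides are cut off to \<open>{0..}\<close> and compared on
  \<open>(0, \<theta>)\<close>, the interval on which \<open>transform_laplace\<close> gives the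
  left transform. Right-continuity upgrades equality of transforms to equality at the given
  \<open>x\<close>.\<close>

lemma transform_scale_function:
  assumes \<beta>: "\<beta> > 0" and W: "is_scale_function \<phi> W" and x: "x > 0"
  defines "\<theta> \<equiv> right_inverse_exponent \<phi> \<beta>"
  shows "transform \<beta> x = derivative_at_0_plus \<phi> * \<theta> * exp (\<theta> * x) * (LBINT y:{x..}. exp (- \<theta> * y) * W y)"
proof -
  have b: "\<beta> \<ge> 0" using \<beta> by simp
  note T = transform_exponent[OF \<beta>, folded \<theta>_def]
  note f0 = transform_pos[OF b] and f1 = transform_le_1[OF b]
  note fm[measurable] = transform_measurable[OF b]
  \<comment> \<open>Cutting at \<open>0\<close> turns the one-sided integral conditions on
    \<open>W\<close> into statements about \<open>laplace\<close> over the whole line.\<close>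
  define w where "w y = indicator {0..} y * W y" for y
  have w0: "w y \<ge> 0" for y using W by (auto simp: w_def is_scale_function_def split: split_indicator)
  have w_neg: "w y = 0" if "y < 0" for y using that by (simp add: w_def)
  have w_int: "integrable lborel (\<lambda>y. exp (- a * y) * w y)" "laplace w a = 1 / \<phi> a" if "a > 0" for a
  proof -
    have "set_integrable lborel {0..} (\<lambda>x. exp (- a * x) * W x)"
      "(LBINT x:{0..}. exp (- a * x) * W x) = 1 / \<phi> a"
      using W that unfolding is_scale_function_def right_inverse_exponent_0 by auto
    moreover have "indicator {0..} y *\<^sub>R (exp (- a * y) * W y) = exp (- a * y) * w y" for y
      by (simp add: w_def)
    ultimately show "integrable lborel (\<lambda>y. exp (- a * y) * w y)" "laplace w a = 1 / \<phi> a"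
      unfolding set_integrable_def set_lebesgue_integral_def by (simp_all only:)
  qed
  define I where "I x = (\<integral>y. indicator {x..} y * (exp (- \<theta> * y) * w y) \<partial>lborel)" for x
  have I0: "I x \<ge> 0" for x unfolding I_def using w0 by (intro integral_nonneg_AE) auto
  have vm[measurable]: "(\<lambda>y. exp (- \<theta> * y) * w y) \<in> borel_measurable borel" using w_int(1)[OF T(1)] by simp
  have Im[measurable]: "I \<in> borel_measurable borel"
  proof -
    have "(\<lambda>z. (if fst z \<le> snd z then exp (- \<theta> * snd z) * w (snd z) else 0)) \<in> borel_measurable (borel \<Otimes>\<^sub>M lborel)"
      by measurable
    then have "(\<lambda>x. \<integral>y. (if x \<le> y then exp (- \<theta> * y) * w y else 0) \<partial>lborel) \<in> borel_measurable borel"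
      by (intro lborel.borel_measurable_lebesgue_integral) (simp add: split_beta')
    also have "(\<lambda>x. \<integral>y. (if x \<le> y then exp (- \<theta> * y) * w y else 0) \<partial>lborel) = I"
      unfolding I_def by (intro ext Bochner_Integration.integral_cong) (auto split: split_indicator)
    finally show ?thesis .
  qed
  let ?C = "transform \<beta> 0"
  have C: "?C > 0" by (rule f0)
  have K: "derivative_at_0_plus \<phi> * \<theta> = ?C * \<beta>" using T(4) \<beta> by simp
  \<comment> \<open>The claimed right-hand side, with constant \<open>?C * \<beta>\<close> in place
    of \<open>derivative_at_0_plus \<phi> * \<theta>\<close> by \<open>K\<close>, and set to zero on
    the negative half-line as uniqueness requires.\<close>
  define r where "r x = (if x < 0 then 0 else ?C * \<beta> * (exp (\<theta> * x) * I x))" for x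
  define f where "f x = (if x < 0 then 0 else transform \<beta> x)" for x
  have r0: "r x \<ge> 0" and ff0: "f x \<ge> 0" for x using I0 C \<beta> f0[of x] by (auto simp: r_def f_def)
  have rm[measurable]: "r \<in> borel_measurable borel" and fm'[measurable]: "f \<in> borel_measurable borel"
    unfolding r_def f_def by measurable
  have r_nn: "(\<integral>\<^sup>+x. ennreal (exp (- l * x) * r x) \<partial>lborel) = ennreal (?C / (\<theta> - l) * (\<beta> / \<phi> l - 1))"
    if l: "0 < l" "l < \<theta>" for l
  proof -
    have "(\<integral>\<^sup>+x. ennreal (exp (- l * x) * r x) \<partial>lborel) =
        (\<integral>\<^sup>+x. ennreal (?C * \<beta>) * (ennreal (exp (- l * x) * (exp (\<theta> * x) * I x)) * indicator {0..} x) \<partial>lborel)"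
    proof (rule nn_integral_cong)
      fix x
      show "ennreal (exp (- l * x) * r x) = ennreal (?C * \<beta>) * (ennreal (exp (- l * x) * (exp (\<theta> * x) * I x)) * indicator {0..} x)"
      proof (cases "x < 0")
        case False
        then have "exp (- l * x) * r x = (?C * \<beta>) * (exp (- l * x) * (exp (\<theta> * x) * I x))"
          by (simp add: r_def)
        moreover have "0 \<le> ?C * \<beta>" using C \<beta> by simp
        ultimately have "ennreal (exp (- l * x) * r x) = ennreal (?C * \<beta>) * ennreal (exp (- l * x) * (exp (\<theta> * x) * I x))"
          by (simp only: ennreal_mult')
        then show ?thesis using False by simp
      qed (simp add: r_def)
    qed
    also have "\<dots> = ennreal (?C * \<beta>) * ennreal ((1 / \<phi> l - 1 / \<phi> \<theta>) / (\<theta> - l))"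
    proof (subst nn_integral_cmult)
      have LE: "(\<integral>\<^sup>+x. ennreal (exp (- l * x) * (exp (\<theta> * x) * I x)) * indicator {0..} x \<partial>lborel) =
          ennreal ((1 / \<phi> l - 1 / \<phi> \<theta>) / (\<theta> - l))"
        unfolding I_def w_int(2)[OF l(1), symmetric] w_int(2)[OF T(1), symmetric]
        by (rule laplace_exp_tail_integral[OF w0 w_neg w_int(1) l])
      show "ennreal (?C * \<beta>) * (\<integral>\<^sup>+x. ennreal (exp (- l * x) * (exp (\<theta> * x) * I x)) * indicator {0..} x \<partial>lborel) =
          ennreal (?C * \<beta>) * ennreal ((1 / \<phi> l - 1 / \<phi> \<theta>) / (\<theta> - l))"
        by (simp only: LE)
    qed measurable
    also have "\<dots> = ennreal ((?C * \<beta>) * ((1 / \<phi> l - 1 / \<phi> \<theta>) / (\<theta> - l)))"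
      using C \<beta> by (intro ennreal_mult'[symmetric]) simp
    \<comment> \<open>This is where \<open>\<phi> \<theta> = \<beta>\<close> enters: it turns
      \<open>\<beta> / \<phi> \<theta>\<close> into the \<open>1\<close> of
      \<open>transform_laplace\<close>.\<close>
    also have "(?C * \<beta>) * ((1 / \<phi> l - 1 / \<phi> \<theta>) / (\<theta> - l)) = ?C / (\<theta> - l) * (\<beta> / \<phi> l - 1)"
    proof -
      have "(?C * \<beta>) * (u / v) = ?C / v * (\<beta> * u)" for u v by simp
      moreover have "\<beta> * (1 / \<phi> l - 1 / \<phi> \<theta>) = \<beta> / \<phi> l - 1" using \<beta> T(2) by (simp add: right_diff_distrib)
      ultimately show ?thesis by simp
    qed
    finally show ?thesis .
  qed
  have f_nn: "(\<integral>\<^sup>+x. ennreal (exp (- l * x) * f x) \<partial>lborel) = ennreal (?C / (\<theta> - l) * (\<beta> / \<phi> l - 1))"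
    "?C / (\<theta> - l) * (\<beta> / \<phi> l - 1) \<ge> 0" if l: "0 < l" "l < \<theta>" for l
  proof -
    have "(\<integral>\<^sup>+x. ennreal (exp (- l * x) * f x) \<partial>lborel) =
        (\<integral>\<^sup>+x. ennreal (exp (- l * x) * transform \<beta> x) * indicator {0..} x \<partial>lborel)"
      by (intro nn_integral_cong) (auto simp: f_def split: split_indicator)
    then show "(\<integral>\<^sup>+x. ennreal (exp (- l * x) * f x) \<partial>lborel) = ennreal (?C / (\<theta> - l) * (\<beta> / \<phi> l - 1))"
      "?C / (\<theta> - l) * (\<beta> / \<phi> l - 1) \<ge> 0"
      using transform_laplace[OF \<beta> T(1,3) less_imp_le[OF C] l] by simp_all
  qed
  have int_small: "integrable lborel (\<lambda>x. exp (- l * x) * r x)" "integrable lborel (\<lambda>x. exp (- l * x) * f x)"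
    "laplace r l = laplace f l" if l: "0 < l" "l < \<theta>" for l
  proof -
    have "integrable lborel (\<lambda>x. exp (- l * x) * r x) \<and> laplace r l = ?C / (\<theta> - l) * (\<beta> / \<phi> l - 1)"
      using r_nn[OF l] r0 f_nn(2)[OF l] by (intro nn_integral_eq_integrable[THEN iffD1]) auto
    moreover have "integrable lborel (\<lambda>x. exp (- l * x) * f x) \<and> laplace f l = ?C / (\<theta> - l) * (\<beta> / \<phi> l - 1)"
      using f_nn(1)[OF l] ff0 f_nn(2)[OF l] by (intro nn_integral_eq_integrable[THEN iffD1]) auto
    ultimately show "integrable lborel (\<lambda>x. exp (- l * x) * r x)" "integrable lborel (\<lambda>x. exp (- l * x) * f x)"
      "laplace r l = laplace f l" by simp_all
  qed
  \<comment> \<open>The explicit transforms cover arguments below \<theta>, while uniqueness asks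
    for integrability at every positive one; support in \<open>{0..}\<close> makes it pass
    upwards.\<close>
  have larger: "integrable lborel (\<lambda>x. exp (- l * x) * h x)"
    if h: "integrable lborel (\<lambda>x. exp (- m * x) * h x)" "\<And>x. x < 0 \<Longrightarrow> h x = 0" "h \<in> borel_measurable borel" and "m \<le> l"
    for l m and h :: "real \<Rightarrow> real"
  proof (rule Bochner_Integration.integrable_bound[OF h(1)])
    note h(3)[measurable]
    show "(\<lambda>x. exp (- l * x) * h x) \<in> borel_measurable lborel" by measurable
    show "AE x in lborel. norm (exp (- l * x) * h x) \<le> norm (exp (- m * x) * h x)"
    proof (intro AE_I2)
      fix x show "norm (exp (- l * x) * h x) \<le> norm (exp (- m * x) * h x)"
        using h(2)[of x] \<open>m \<le> l\<close> by (cases "x < 0") (auto simp: abs_mult intro!: mult_right_mono)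
    qed
  qed
  have int_all: "integrable lborel (\<lambda>x. exp (- l * x) * r x)" "integrable lborel (\<lambda>x. exp (- l * x) * f x)" if "l > 0" for l
  proof -
    have m: "0 < min l (\<theta> / 2)" "min l (\<theta> / 2) < \<theta>" "min l (\<theta> / 2) \<le> l" using that T(1) by (auto simp: min_def)
    show "integrable lborel (\<lambda>x. exp (- l * x) * r x)"
      by (rule larger[OF int_small(1)[OF m(1,2)] _ rm m(3)]) (simp add: r_def)
    show "integrable lborel (\<lambda>x. exp (- l * x) * f x)"
      by (rule larger[OF int_small(2)[OF m(1,2)] _ fm' m(3)]) (simp add: f_def)
  qed
  have "f x - r x = 0"
  proof (rule laplace_unique[where k = "\<lambda>x. f x - r x" and c = \<theta>])
    show "integrable lborel (\<lambda>x. exp (- l * x) * (f x - r x))" if "l > 0" for l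
      using int_all[OF that] by (simp add: right_diff_distrib)
    show "(\<integral>x. exp (- l * x) * (f x - r x) \<partial>lborel) = 0" if "0 < l" "l < \<theta>" for l
      using int_small[OF that] by (simp add: right_diff_distrib)
    show "f y - r y = 0" if "y < 0" for y using that by (simp add: f_def r_def)
    show "continuous (at_right x) (\<lambda>x. f x - r x)"
    proof (rule continuous_diff)
      have ev: "eventually (\<lambda>y. \<not> y < 0) (at_right x)"
        using eventually_at_right_less[of x] by eventually_elim (use x in auto)
      have "(f \<longlongrightarrow> transform \<beta> x) (at_right x)"
        using transform_right_cont[OF b] ev
        by (rule Lim_transform_eventually[OF _ eventually_mono]) (simp add: f_def)
      then show "continuous (at_right x) f" using x by (simp add: continuous_within f_def)
      have "((\<lambda>x. ?C * \<beta> * (exp (\<theta> * x) * I x)) \<longlongrightarrow> ?C * \<beta> * (exp (\<theta> * x) * I x)) (at_right x)"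
        unfolding I_def by (intro tendsto_intros tail_integral_right_cont w_int T(1))
      then have "(r \<longlongrightarrow> ?C * \<beta> * (exp (\<theta> * x) * I x)) (at_right x)"
        using ev by (rule Lim_transform_eventually[OF _ eventually_mono]) (simp add: r_def)
      then show "continuous (at_right x) r" using x by (simp add: continuous_within r_def)
    qed
  qed (rule T(1))
  then have "transform \<beta> x = ?C * \<beta> * (exp (\<theta> * x) * I x)" using x by (simp add: f_def r_def)
  moreover have "I x = (LBINT y:{x..}. exp (- \<theta> * y) * W y)"
    unfolding I_def set_lebesgue_integral_def w_def using x
    by (intro Bochner_Integration.integral_cong) (auto split: split_indicator)
  ultimately show ?thesis unfolding K by simp
qed

end

section \<open>Regular modification\<close>

text \<open>The identity starts at \<open>0\<close>, is continuous and tends to infinity, so it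
  meets every pathwise demand of \<open>regular_levy\<close> and can replace an exceptional
  path.\<close>

lemma transient_ident: "transient (\<lambda>t. t)"
  by (auto simp: transient_def cadlag_def filterlim_ident intro!: exI continuous_ident)

lemma no_positive_jumps_ident: "no_positive_jumps (\<lambda>t. t)"
proof -
  have "Lim (at_left t) (\<lambda>t. t) = t" for t :: real
    by (rule tendsto_Lim) (auto simp: trivial_limit_at_left_real)
  then show ?thesis by (simp add: no_positive_jumps_def)
qed

lemma exp_neg_time_below:
  assumes "transient p"
  shows "exp_neg \<beta> (time_below_zero p) = exp (- \<beta> * below p)"
proof -
  have "time_below_zero p = (\<integral>\<^sup>+s. ennreal (indicator {0..} s * indicator {..<0} (p s)) \<partial>lborel)"
    unfolding time_below_zero_def by (intro nn_integral_cong) (auto split: split_indicator)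
  also have "\<dots> = ennreal (below p)"
    unfolding below_def by (rule nn_integral_eq_integral[OF below_integrable[OF assms]]) simp
  finally show ?thesis using below_nonneg[of p] by (simp add: exp_neg_def)
qed

text \<open>The two preimages differ only inside a null set, all of whose subsets are measurable by
  completeness. It provides measurability of a functional of the original, unmodified paths.\<close>

lemma (in complete_measure) measurable_AE_eq:
  fixes u v :: "'a \<Rightarrow> real"
  assumes v: "v \<in> borel_measurable M" and N: "N \<in> null_sets M"
    and eq: "\<And>\<omega>. \<omega> \<in> space M \<Longrightarrow> \<omega> \<notin> N \<Longrightarrow> u \<omega> = v \<omega>"
  shows "u \<in> borel_measurable M"
proof (rule measurableI)
  fix B :: "real set" assume B: "B \<in> sets borel"
  have split: "u -` B \<inter> space M = (v -` B \<inter> space M - N) \<union> (u -` B \<inter> space M \<inter> N)"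
    using eq by auto
  have "v -` B \<inter> space M - N \<in> sets M" using measurable_sets[OF v B] N by auto
  moreover have "u -` B \<inter> space M \<inter> N \<in> sets M" by (rule complete[OF _ N]) auto
  ultimately show "u -` B \<inter> space M \<in> sets M" by (subst split) (rule sets.Un)
qed simp

text \<open>On a null set the paths are replaced by \<open>t \<mapsto> t\<close>, so that every path is regular. The modified
  process is still adapted because the filtration contains the null sets.\<close>

lemma regular_modification:
  assumes X: "spectrally_negative_levy_process M F X"
    and triplet: "has_levy_triplet M X \<mu> \<sigma> \<nu>"
    and drift: "drifts_to_infinity M X"
  obtains N where "N \<in> null_sets M"
    and "regular_levy M F (\<lambda>t \<omega>. if \<omega> \<in> N then t else X t \<omega>) (laplace_exponent \<mu> \<sigma> \<nu>)"
proof -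
  interpret spectrally_negative_levy_process M F X by (rule X)
  have "AE \<omega> in M. X 0 \<omega> = 0 \<and> transient (\<lambda>t. X t \<omega>) \<and> no_positive_jumps (\<lambda>t. X t \<omega>)"
    using starts_at_zero cadlag_paths no_positive_jumps_paths drift[unfolded drifts_to_infinity_def]
    by eventually_elim (simp add: transient_def)
  then obtain N where N: "N \<in> null_sets M"
    "{\<omega> \<in> space M. \<not> (X 0 \<omega> = 0 \<and> transient (\<lambda>t. X t \<omega>) \<and> no_positive_jumps (\<lambda>t. X t \<omega>))} \<subseteq> N"
    unfolding eventually_ae_filter by auto
  define Y where "Y t \<omega> = (if \<omega> \<in> N then t else X t \<omega>)" for t \<omega>
  have AE_N: "AE \<omega> in M. \<omega> \<notin> N" using N(1) by (rule AE_not_in)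
  have AE_Y: "AE \<omega> in M. Y t \<omega> = X t \<omega>" for t using AE_N by eventually_elim (simp add: Y_def)
  have sub: "subalgebra M (F t)" if "t \<ge> 0" for t by (rule filtration_subalgebra[OF that])
  have Y_adapted: "Y t \<in> borel_measurable (F t)" if t: "t \<ge> 0" for t
  proof -
    have "N \<in> sets (F t)" using N(1) filtration_complete sets_F_mono[OF t] by auto
    then show ?thesis unfolding Y_def[abs_def] using adapted[OF t]
      by (intro measurable_If_set) auto
  qed
  have XM: "X t \<in> borel_measurable M" and YM: "Y t \<in> borel_measurable M" if "t \<ge> 0" for t
    using measurable_from_subalg[OF sub[OF that]] adapted[OF that] Y_adapted[OF that] by auto
  have "regular_levy M F Y (laplace_exponent \<mu> \<sigma> \<nu>)"
  proof unfold_locales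
    fix s h :: real and A and B :: "real set" assume s: "s \<ge> 0" and h: "h \<ge> 0" and A: "A \<in> sets (F s)" and B: "B \<in> sets borel"
    have sh: "s \<le> s + h" "s + h \<ge> 0" using s h by auto
    note [measurable] = XM[OF s] YM[OF s] XM[OF h] YM[OF h] XM[OF sh(2)] YM[OF sh(2)] XM[OF order_refl] B
    have AM[measurable]: "A \<in> sets M" using A sub[OF s] by (auto simp: subalgebra_def)
    let ?D = "\<lambda>\<omega>. X (s + h) \<omega> - X s \<omega>"
    have D_ev: "?D -` B \<inter> space M \<in> sets (vimage_algebra (space M) ?D borel)"
      using B by (rule in_vimage_algebra)
    have "prob (A \<inter> {\<omega> \<in> space M. Y (s + h) \<omega> - Y s \<omega> \<in> B}) = prob (A \<inter> (?D -` B \<inter> space M))"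
    proof (rule finite_measure_eq_AE)
      show "AE \<omega> in M. (\<omega> \<in> A \<inter> {\<omega> \<in> space M. Y (s + h) \<omega> - Y s \<omega> \<in> B}) = (\<omega> \<in> A \<inter> (?D -` B \<inter> space M))"
        using AE_Y[of s] AE_Y[of "s + h"] by eventually_elim auto
    qed measurable
    also have "\<dots> = prob A * prob (?D -` B \<inter> space M)"
      using independent_increments[OF s sh(1)] A D_ev unfolding indep_sets2_eq by blast
    also have "prob (?D -` B \<inter> space M) = measure (distr M borel ?D) B"
      by (rule measure_distr[symmetric]) measurable
    also have "\<dots> = measure (distr M borel (\<lambda>\<omega>. X h \<omega> - X 0 \<omega>)) B"
      using stationary_increments[OF s sh(1)] by simp
    also have "\<dots> = prob ((\<lambda>\<omega>. X h \<omega> - X 0 \<omega>) -` B \<inter> space M)"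
      by (rule measure_distr) measurable
    \<comment> \<open>Almost surely \<open>X 0 \<omega> = 0\<close> and
      \<open>Y h \<omega> = X h \<omega>\<close>, so the increment from time \<open>0\<close> may be
      replaced by the value itself.\<close>
    also have "\<dots> = prob {\<omega> \<in> space M. Y h \<omega> \<in> B}"
    proof (rule finite_measure_eq_AE)
      show "AE \<omega> in M. (\<omega> \<in> (\<lambda>\<omega>. X h \<omega> - X 0 \<omega>) -` B \<inter> space M) = (\<omega> \<in> {\<omega> \<in> space M. Y h \<omega> \<in> B})"
        using AE_Y[of h] starts_at_zero by eventually_elim auto
    qed measurable
    finally show "prob (A \<inter> {\<omega> \<in> space M. Y (s + h) \<omega> - Y s \<omega> \<in> B}) = prob A * prob {\<omega> \<in> space M. Y h \<omega> \<in> B}" .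
  next
    fix t \<alpha> :: real assume t: "t \<ge> 0" and \<alpha>: "\<alpha> \<ge> 0"
    note [measurable] = XM[OF t] YM[OF t]
    have eq: "AE \<omega> in M. exp (\<alpha> * Y t \<omega>) = exp (\<alpha> * X t \<omega>)" using AE_Y[of t] by eventually_elim simp
    have m: "(\<lambda>\<omega>. exp (\<alpha> * Y t \<omega>)) \<in> borel_measurable M" "(\<lambda>\<omega>. exp (\<alpha> * X t \<omega>)) \<in> borel_measurable M" by measurable
    have T: "integrable M (\<lambda>\<omega>. exp (\<alpha> * X t \<omega>))"
      "(\<integral>\<omega>. exp (\<alpha> * X t \<omega>) \<partial>M) = exp (t * laplace_exponent \<mu> \<sigma> \<nu> \<alpha>)"
      using triplet t \<alpha> unfolding has_levy_triplet_def by blast+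
    show "integrable M (\<lambda>\<omega>. exp (\<alpha> * Y t \<omega>))" using integrable_cong_AE[OF m eq] T by simp
    show "(\<integral>\<omega>. exp (\<alpha> * Y t \<omega>) \<partial>M) = exp (t * laplace_exponent \<mu> \<sigma> \<nu> \<alpha>)"
      using integral_cong_AE[OF m eq] T by simp
  next
    fix \<omega> assume \<omega>: "\<omega> \<in> space M"
    show "Y 0 \<omega> = 0" "transient (\<lambda>t. Y t \<omega>)" "no_positive_jumps (\<lambda>t. Y t \<omega>)"
      using N(2) \<omega> transient_ident no_positive_jumps_ident by (cases "\<omega> \<in> N"; auto simp: Y_def)+
  qed (use sub sets_F_mono Y_adapted in auto)
  then show ?thesis using that[OF N(1)] unfolding Y_def[abs_def] by blast
qed

theorem theorem3p4:
  fixes M :: "'a measure" and F :: "real \<Rightarrow> 'a measure" and X :: "real \<Rightarrow> 'a \<Rightarrow> real"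
    and \<mu> \<sigma> :: real and \<nu> :: "real measure" and \<phi> \<Phi> :: "real \<Rightarrow> real"
  assumes X: "spectrally_negative_levy_process M F X"
    and triplet: "has_levy_triplet M X \<mu> \<sigma> \<nu>"
    and density: "has_lebesgue_density \<nu>"
    and drift: "drifts_to_infinity M X"
    and phi: "\<phi> = laplace_exponent \<mu> \<sigma> \<nu>"
    and Phi: "\<Phi> = right_inverse_exponent \<phi>"
  shows "(\<forall>W. is_scale_function \<phi> W \<longrightarrow>
           (\<forall>x>0. \<forall>\<beta>>0.
              path_expectation M X x (\<lambda>f. exp_neg \<beta> (time_below_zero f)) =
                derivative_at_0_plus \<phi> * \<Phi> \<beta> * exp (\<Phi> \<beta> * x) *
                  (LBINT y:{x..}. exp (- \<Phi> \<beta> * y) * W y))) \<and>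
         (\<forall>\<beta>>0.
            path_expectation M X 0 (\<lambda>f. exp_neg \<beta> (time_below_zero f)) =
              derivative_at_0_plus \<phi> * (\<Phi> \<beta> / \<beta>))"
proof -
  interpret S: spectrally_negative_levy_process M F X by (rule X)
  obtain N where N: "N \<in> null_sets M"
    and Y: "regular_levy M F (\<lambda>t \<omega>. if \<omega> \<in> N then t else X t \<omega>) (laplace_exponent \<mu> \<sigma> \<nu>)"
    using regular_modification[OF X triplet drift] by blast
  define Y where "Y t \<omega> = (if \<omega> \<in> N then t else X t \<omega>)" for t \<omega>
  interpret Y: regular_levy M F Y \<phi> using Y unfolding Y_def[abs_def] phi .
  have expectation: "path_expectation M X x (\<lambda>f. exp_neg \<beta> (time_below_zero f)) = Y.transform \<beta> x"
    if \<beta>: "\<beta> > 0" for x \<beta>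
  proof -
    let ?u = "\<lambda>\<omega>. exp_neg \<beta> (time_below_zero (\<lambda>t. x + X t \<omega>))" and ?v = "Y.future \<beta> 0 x"
    have eq: "?u \<omega> = ?v \<omega>" if "\<omega> \<in> space M" "\<omega> \<notin> N" for \<omega>
      using exp_neg_time_below[OF Y.path_shift_0[OF that(1), of x]] that(2) by (simp add: Y.future_0 Y_def)
    have v: "?v \<in> borel_measurable M" using \<beta> by (intro Y.future_measurable) auto
    \<comment> \<open>On \<open>N\<close> nothing is known about the original paths, so
      measurability is inherited from the modified process by completeness.\<close>
    have u: "?u \<in> borel_measurable M" by (rule S.measurable_AE_eq[OF v N eq])
    have "AE \<omega> in M. ?u \<omega> = ?v \<omega>"
      using AE_not_in[OF N] AE_space by eventually_elim (rule eq)
    then show ?thesis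
      unfolding path_expectation_def Y.transform_eq_future by (rule integral_cong_AE[OF u v])
  qed
  show ?thesis
    using Y.transform_scale_function Y.transform_exponent(4) by (auto simp: expectation Phi)
qed

end
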